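(* For every $\gamma \in (0,\infty)$ and every $a > 1$, $$s_a(\gamma) = \frac{1}{4}\, a \left(1 - \frac{1}{\gamma}\right)^{+},$$ where $s_a(\gamma)$ is the infimum of the values of $s > 0$ for which there is a constant $C$, independent of $f$, such that $\Vert P^{*}_{a,\gamma} f \Vert_{L^2(\mathbb{R})} \leq C \Vert f \Vert_{H^s(\mathbb{R})}$ for all $f \in \mathcal{S}(\mathbb{R})$.
   Context: $\mathcal{S}(\mathbb{R})$ is the Schwartz class of (complex-valued) functions on $\mathbb{R}$. The Fourier transform is normalised as $\widehat{f}(\xi) = \int_{\mathbb{R}} f(x) e^{-ix\xi}\, dx$, and $\Vert f \Vert_{H^s(\mathbb{R})} = \left(\int_{\mathbb{R}} (1+\xi^2)^s |\widehat{f}(\xi)|^2 \, d\xi\right)^{1/2}$. For $a > 1$, $\gamma > 0$, $t > 0$ and $x \in \mathbb{R}$, define $$P^t_{a,\gamma} f(x) = \int_{\mathbb{R}} \widehat{f}(\xi)\, e^{it|\xi|^a} e^{-t^{\gamma}|\xi|^a} e^{ix\xi}\, d\xi,$$ and the maximal operator $P^{*}_{a,\gamma} f(x) = \sup_{t \in (0,1)} |P^t_{a,\gamma} f(x)|$. For $y \in \mathbb{R}$, $y^{+} = \max(0,y)$. *)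

theory Defs
  imports "HOL-Analysis.Analysis"
begin

definition iterated_deriv :: "nat \<Rightarrow> (real \<Rightarrow> complex) \<Rightarrow> real \<Rightarrow> complex" where
  "iterated_deriv n f = ((\<lambda>g x. vector_derivative g (at x)) ^^ n) f"

definition schwartz_space :: "(real \<Rightarrow> complex) set" where
  "schwartz_space = {f.
     (\<forall>n x. iterated_deriv n f differentiable (at x)) \<and>
     (\<forall>k n. bounded (range (\<lambda>x. x ^ k *\<^sub>R iterated_deriv n f x)))}"

definition fourier :: "(real \<Rightarrow> complex) \<Rightarrow> real \<Rightarrow> complex" where
  "fourier f \<xi> = (LINT x|lborel. f x * exp (- \<i> * of_real (x * \<xi>)))"

(* The square root of an extended nonnegative number, with sqrt \<infinity> = \<infinity>; it lets the
   norms below take the value \<infinity>, so that divergent integrals are never read as 0. *)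
definition esqrt :: "ennreal \<Rightarrow> ennreal" where
  "esqrt u = (if u = \<infinity> then \<infinity> else ennreal (sqrt (enn2real u)))"

definition L2_norm :: "(real \<Rightarrow> ennreal) \<Rightarrow> ennreal" where
  "L2_norm F = esqrt (\<integral>\<^sup>+ x. (F x)\<^sup>2 \<partial>lborel)"

definition sobolev_norm :: "real \<Rightarrow> (real \<Rightarrow> complex) \<Rightarrow> ennreal" where
  "sobolev_norm s f =
     esqrt (\<integral>\<^sup>+ \<xi>. ennreal ((1 + \<xi>\<^sup>2) powr s * (cmod (fourier f \<xi>))\<^sup>2) \<partial>lborel)"

definition P_op :: "real \<Rightarrow> real \<Rightarrow> real \<Rightarrow> (real \<Rightarrow> complex) \<Rightarrow> real \<Rightarrow> complex" where
  "P_op a \<gamma> t f x =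
     (LINT \<xi>|lborel. fourier f \<xi> * exp (\<i> * of_real (t * \<bar>\<xi>\<bar> powr a))
        * of_real (exp (- (t powr \<gamma>) * \<bar>\<xi>\<bar> powr a)) * exp (\<i> * of_real (x * \<xi>)))"

definition P_max :: "real \<Rightarrow> real \<Rightarrow> (real \<Rightarrow> complex) \<Rightarrow> real \<Rightarrow> ennreal" where
  "P_max a \<gamma> f x = (SUP t\<in>{0<..<1}. ennreal (cmod (P_op a \<gamma> t f x)))"

definition maximal_bound :: "real \<Rightarrow> real \<Rightarrow> real \<Rightarrow> bool" where
  "maximal_bound a \<gamma> s \<longleftrightarrow>
     (\<exists>C::real. \<forall>f\<in>schwartz_space. L2_norm (P_max a \<gamma> f) \<le> ennreal C * sobolev_norm s f)"

(* Infimum in the extended reals, so that it would be \<infinity> if no exponent were admissible. *)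
definition critical_exponent :: "real \<Rightarrow> real \<Rightarrow> ereal" where
  "critical_exponent a \<gamma> = Inf (ereal ` {s. s > 0 \<and> maximal_bound a \<gamma> s})"

end

theory Submission
  imports Defs "HOL-Probability.Probability"
begin

text \<open>
  Upper bound. Cut the frequency axis dyadically and choose the time as a measurable function
  \<open>T\<close> of \<open>x\<close>. After rescaling to frequencies of size 1, the \<open>T T\<^sup>*\<close> kernel of the linearised
  operator at frequency \<open>N\<close> is an oscillatory integral with phase \<open>X \<eta> + S \<eta>\<^sup>a\<close> and damping
  \<open>exp (- U \<eta>\<^sup>a)\<close>. It decays like \<open>X\<^bsup>-2\<^esup>\<close> off the stationary region \<open>|X| \<lesssim> |S|\<close> and like
  \<open>|X|\<^bsup>-1/2\<^esup>\<close> inside it, where the damping moreover cuts it off at \<open>|X| \<approx> N\<^bsup>a(1-1/\<gamma>)\<^esup>\<close>. The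
  resulting majorant depends on \<open>X\<close> only and has mass \<open>max 1 N\<^bsup>a(1-1/\<gamma>)/2\<^esup>\<close>, so the maximal
  operator costs \<open>N\<^sup>s\<close> with \<open>s = (a/4) (1 - 1/\<gamma>)\<^sup>+\<close>.

  Lower bound. A Gaussian wave packet at frequency \<open>N\<close> with bandwidth \<open>L\<close> travels with speed
  \<open>a N\<^bsup>a-1\<^esup>\<close> and keeps its size for as long as \<open>t N\<^bsup>a-2\<^esup> L\<^sup>2\<close> and \<open>t\<^sup>\<gamma> N\<^sup>a\<close> stay small, that is, for
  \<open>t\<close> up to about \<open>N\<^bsup>-a/\<gamma>\<^esup>\<close> when \<open>L \<approx> N\<^bsup>1-2s\<^esup>\<close> for the critical \<open>s\<close>. Comparing the interval swept
  out with the Sobolev norm gives the matching exponent.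
\<close>

section \<open>Oscillatory integrals\<close>

text \<open>The obstacle of the upper bound is that the time is an arbitrary measurable function of
  x. The kernel at a pair of points therefore involves two unrelated times t and t', while a row
  bound of Schur type needs a majorant in X alone. What saves the argument is that the phase
  parameter S = \<kappa> (t - t') and the damping U = \<kappa> (t^\<gamma> + t'^\<gamma>) are both
  governed by the larger of the two times: a large |S| forces a large U, and the exponential in U
  then pays for the size of X.

  Choosing the time also destroys orthogonality between the frequency blocks, so they are added by a
  weighted Cauchy-Schwarz inequality. This costs an arbitrarily small power of N, which an infimum
  over s does not see, but it leaves the endpoint undecided.

  In the lower bound the bandwidth is the largest one for which dispersion is still harmless at the
  time when damping sets in. A larger L lowers the Sobolev norm relative to the height of the
  packet, so this choice is what makes the two exponents meet.\<close>

lemma exp_has_vector_derivative: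
  fixes f :: "real \<Rightarrow> complex"
  assumes "(f has_vector_derivative f') (at x within S)"
  shows "((\<lambda>x. exp (f x)) has_vector_derivative f' * exp (f x)) (at x within S)"
  using field_vector_diff_chain_within[OF assms DERIV_exp[THEN has_field_derivative_at_within]]
  by (simp add: o_def)

text \<open>Instead of isolating the stationary point, subtract the derivative of
  \<open>- \<i> e\<^bsup>i\<phi>\<^esup> v \<psi> / (\<mu> + v\<^sup>2)\<close> with \<open>v = \<phi>'\<close>: what remains is controlled by \<open>\<sigma> v' / (\<mu> + v\<^sup>2)\<close>, the
  derivative of an arctangent.\<close>
lemma van_der_Corput_second:
  fixes \<phi> v v' \<psi> \<psi>' :: "real \<Rightarrow> real" and \<alpha> \<beta> \<mu> \<sigma> A B :: real
  assumes "\<alpha> \<le> \<beta>" "\<mu> > 0"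
    and d\<phi>: "\<And>x. x \<in> {\<alpha>..\<beta>} \<Longrightarrow> (\<phi> has_real_derivative v x) (at x within {\<alpha>..\<beta>})"
    and dv: "\<And>x. x \<in> {\<alpha>..\<beta>} \<Longrightarrow> (v has_real_derivative v' x) (at x within {\<alpha>..\<beta>})"
    and d\<psi>: "\<And>x. x \<in> {\<alpha>..\<beta>} \<Longrightarrow> (\<psi> has_real_derivative \<psi>' x) (at x within {\<alpha>..\<beta>})"
    and \<sigma>: "\<bar>\<sigma>\<bar> = 1" and v': "\<And>x. x \<in> {\<alpha>..\<beta>} \<Longrightarrow> \<sigma> * v' x \<ge> \<mu>"
    and A: "\<And>x. x \<in> {\<alpha>..\<beta>} \<Longrightarrow> \<bar>\<psi> x\<bar> \<le> A"
    and B: "\<And>x. x \<in> {\<alpha>..\<beta>} \<Longrightarrow> \<bar>\<psi>' x\<bar> \<le> B"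
    and ends: "\<psi> \<alpha> = 0" "\<psi> \<beta> = 0"
  shows "norm (integral {\<alpha>..\<beta>} (\<lambda>x. exp (\<i> * of_real (\<phi> x)) * of_real (\<psi> x)))
           \<le> (2 * pi * A + B * (\<beta> - \<alpha>)) / sqrt \<mu>"
proof -
  let ?I = "{\<alpha>..\<beta>}"
  define D where "D = (\<lambda>x. \<mu> + (v x)\<^sup>2)"
  define r where "r = (\<lambda>x. v x * \<psi> x / D x)"
  define r' where "r' = (\<lambda>x. v' x * \<psi> x * (\<mu> - (v x)\<^sup>2) / (D x)\<^sup>2 + v x * \<psi>' x / D x)"
  define F where "F = (\<lambda>x. exp (\<i> * of_real (\<phi> x)) * (- \<i>) * of_real (r x))"
  define F' where "F' = (\<lambda>x. exp (\<i> * of_real (\<phi> x)) * (of_real (v x * r x) - \<i> * of_real (r' x)))"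
  define g where "g = (\<lambda>x. 2 * A * (\<sigma> * v' x / D x) + B / (2 * sqrt \<mu>))"
  have \<sigma>': "\<sigma> = 1 \<or> \<sigma> = -1" using \<sigma> by linarith
  have Dpos: "D x > 0" for x using \<open>\<mu> > 0\<close> by (simp add: D_def add_pos_nonneg)
  have A0: "A \<ge> 0" using A[of \<alpha>] assms(1) by force
  have B0: "B \<ge> 0" using B[of \<alpha>] assms(1) by force
  have dr: "(r has_real_derivative r' x) (at x within ?I)" if "x \<in> ?I" for x
    unfolding r_def D_def
    apply (rule derivative_eq_intros dv d\<psi> that refl)+
    using Dpos[of x] apply (simp add: D_def)
    using Dpos[of x] apply (simp add: r'_def D_def divide_simps)
    apply (simp add: algebra_simps power2_eq_square)
    done
  have dF: "(F has_vector_derivative F' x) (at x within ?I)" if "x \<in> ?I" for x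
  proof -
    have "((\<lambda>x. \<i> * complex_of_real (\<phi> x)) has_vector_derivative \<i> * of_real (v x)) (at x within ?I)"
      by (intro has_vector_derivative_mult_right has_vector_derivative_of_real d\<phi> that)
    note 1 = exp_has_vector_derivative[OF this]
    have 2: "((\<lambda>x. complex_of_real (r x)) has_vector_derivative of_real (r' x)) (at x within ?I)"
      by (intro has_vector_derivative_of_real dr that)
    show ?thesis unfolding F_def F'_def
      by (rule has_vector_derivative_eq_rhs[OF has_vector_derivative_mult[OF has_vector_derivative_mult_left[OF 1] 2]])
         (simp add: algebra_simps)
  qed
  have FTC: "(F' has_integral (F \<beta> - F \<alpha>)) ?I"
    using assms(1) dF by (intro fundamental_theorem_of_calculus) auto
  have Fe: "F \<beta> - F \<alpha> = 0" by (simp add: F_def r_def ends)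
  have c\<phi>: "continuous_on ?I \<phi>" by (rule DERIV_continuous_on[OF d\<phi>])
  have c\<psi>: "continuous_on ?I \<psi>" by (rule DERIV_continuous_on[OF d\<psi>])
  have int: "(\<lambda>x. exp (\<i> * of_real (\<phi> x)) * of_real (\<psi> x)) integrable_on ?I" (is "?f integrable_on _")
    by (intro integrable_continuous_interval continuous_intros c\<phi> c\<psi>)
  have hi: "((\<lambda>x. ?f x - F' x) has_integral integral ?I ?f) ?I"
    using has_integral_diff[OF integrable_integral[OF int] FTC] Fe by simp
  define c where "c = 1 / sqrt \<mu>"
  have dat: "((\<lambda>x. arctan (v x / sqrt \<mu>) / sqrt \<mu>) has_real_derivative v' x / D x) (at x within ?I)"
    if "x \<in> ?I" for x
  proof -
    have "((\<lambda>x. c * arctan (c * v x)) has_real_derivative c * (c * v' x / (1 + (c * v x)\<^sup>2))) (at x within ?I)"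
      by (auto intro!: derivative_eq_intros dv that simp: divide_simps)
    moreover have "c * (c * v' x / (1 + (c * v x)\<^sup>2)) = v' x / D x"
    proof -
      have 1: "(c * v x)\<^sup>2 = (v x)\<^sup>2 / \<mu>" and 2: "c * c = 1 / \<mu>"
        using \<open>\<mu> > 0\<close> by (simp_all add: c_def power_divide)
      have "c * (c * v' x / (1 + (c * v x)\<^sup>2)) = c * c * v' x / (1 + (v x)\<^sup>2 / \<mu>)"
        unfolding 1 by simp
      also have "\<dots> = v' x / D x"
        unfolding 2 using \<open>\<mu> > 0\<close> by (simp add: D_def divide_simps)
      finally show ?thesis .
    qed
    ultimately have "((\<lambda>x. c * arctan (c * v x)) has_real_derivative v' x / D x) (at x within ?I)"
      by (simp only:)
    thus ?thesis by (simp add: c_def)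
  qed
  have gi: "(g has_integral 2 * A * (\<sigma> * (arctan (v \<beta> / sqrt \<mu>) / sqrt \<mu> - arctan (v \<alpha> / sqrt \<mu>) / sqrt \<mu>))
      + B / (2 * sqrt \<mu>) * (\<beta> - \<alpha>)) ?I"
    unfolding g_def
    using has_integral_add[OF has_integral_mult_right[OF has_integral_mult_right[OF
          fundamental_theorem_of_calculus[OF assms(1) dat[THEN has_real_derivative_iff_has_vector_derivative[THEN iffD1]]], of \<sigma>], of "2 * A"]
        has_integral_const_real[of "B / (2 * sqrt \<mu>)" \<alpha> \<beta>]] assms(1)
    by (simp add: mult_ac)
  have bd: "norm (?f x - F' x) \<le> g x" if x: "x \<in> ?I" for x
  proof -
    have s1: "\<sigma> * v' x = \<bar>v' x\<bar>" using \<sigma>' v'[OF x] \<open>\<mu> > 0\<close> by auto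
    have "?f x - F' x = exp (\<i> * of_real (\<phi> x)) * (of_real (\<psi> x - v x * r x) + \<i> * of_real (r' x))"
      by (simp add: F'_def algebra_simps)
    hence "norm (?f x - F' x) = norm (of_real (\<psi> x - v x * r x) + \<i> * of_real (r' x))"
      by (simp add: norm_mult)
    also have "\<dots> \<le> \<bar>\<psi> x - v x * r x\<bar> + \<bar>r' x\<bar>"
      by (rule order_trans[OF norm_triangle_ineq]) (simp add: norm_mult del: of_real_diff of_real_mult)
    also have "\<psi> x - v x * r x = \<mu> * \<psi> x / D x"
      using Dpos[of x] by (simp add: r_def D_def field_simps power2_eq_square)
    \<comment> \<open>The spare factor \<mu> is traded for \<sigma> v', which turns this remainder
      into a multiple of the derivative of an arctangent.\<close>
    also have "\<bar>\<mu> * \<psi> x / D x\<bar> \<le> A * (\<sigma> * v' x / D x)"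
    proof -
      have "\<mu> * \<bar>\<psi> x\<bar> \<le> (\<sigma> * v' x) * A"
        using A[OF x] v'[OF x] \<open>\<mu> > 0\<close> by (intro mult_mono) auto
      thus ?thesis using Dpos[of x] \<open>\<mu> > 0\<close> by (simp add: abs_mult divide_right_mono mult.commute)
    qed
    also have "\<bar>r' x\<bar> \<le> A * (\<sigma> * v' x / D x) + B / (2 * sqrt \<mu>)"
    proof -
      have muv: "\<bar>\<mu> - (v x)\<^sup>2\<bar> \<le> D x"
        using \<open>\<mu> > 0\<close> zero_le_power2[of "v x"] unfolding D_def by linarith
      have "\<bar>v' x * \<psi> x * (\<mu> - (v x)\<^sup>2) / (D x)\<^sup>2\<bar> = \<bar>v' x\<bar> * \<bar>\<psi> x\<bar> * \<bar>\<mu> - (v x)\<^sup>2\<bar> / (D x)\<^sup>2"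
        by (simp add: abs_mult)
      also have "\<dots> \<le> \<bar>v' x\<bar> * A * D x / (D x)\<^sup>2"
        using A[OF x] A0 muv by (intro divide_right_mono mult_mono) auto
      also have "\<dots> = A * (\<sigma> * v' x / D x)"
        unfolding s1 using Dpos[of x] by (simp add: power2_eq_square)
      finally have 1: "\<bar>v' x * \<psi> x * (\<mu> - (v x)\<^sup>2) / (D x)\<^sup>2\<bar> \<le> A * (\<sigma> * v' x / D x)" .
      have "0 \<le> (sqrt \<mu> - \<bar>v x\<bar>)\<^sup>2" by simp
      hence "2 * sqrt \<mu> * \<bar>v x\<bar> \<le> D x"
        using \<open>\<mu> > 0\<close> by (simp add: D_def power2_eq_square algebra_simps abs_mult_self_eq)
      hence "\<bar>v x\<bar> / D x \<le> 1 / (2 * sqrt \<mu>)"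
        using Dpos[of x] \<open>\<mu> > 0\<close> by (simp add: field_simps)
      hence "\<bar>v x\<bar> / D x * \<bar>\<psi>' x\<bar> \<le> 1 / (2 * sqrt \<mu>) * B"
        using B[OF x] \<open>\<mu> > 0\<close> by (intro mult_mono) auto
      hence 2: "\<bar>v x * \<psi>' x / D x\<bar> \<le> B / (2 * sqrt \<mu>)" using Dpos[of x] by (simp add: abs_mult)
      show ?thesis unfolding r'_def using 1 2 by linarith
    qed
    finally show ?thesis by (simp add: g_def)
  qed
  have "norm (integral ?I ?f) \<le> integral ?I g"
    using integral_norm_bound_integral[OF has_integral_integrable[OF hi] has_integral_integrable[OF gi] bd]
      hi by (simp add: integral_unique)
  also have "\<dots> = (2 * A * (\<sigma> * (arctan (v \<beta> / sqrt \<mu>) - arctan (v \<alpha> / sqrt \<mu>))) + B / 2 * (\<beta> - \<alpha>)) / sqrt \<mu>"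
    using gi \<open>\<mu> > 0\<close> by (simp add: integral_unique field_simps)
  also have "\<dots> \<le> (2 * pi * A + B * (\<beta> - \<alpha>)) / sqrt \<mu>"
  proof -
    \<comment> \<open>An arctangent varies by at most pi wherever a zero of \<open>v\<close> may
      lie, so the bound does not see the linear part of the phase.\<close>
    have "\<bar>arctan (v \<beta> / sqrt \<mu>) - arctan (v \<alpha> / sqrt \<mu>)\<bar> \<le> pi"
      using arctan_bounded[of "v \<beta> / sqrt \<mu>"] arctan_bounded[of "v \<alpha> / sqrt \<mu>"] by linarith
    hence "\<sigma> * (arctan (v \<beta> / sqrt \<mu>) - arctan (v \<alpha> / sqrt \<mu>)) \<le> pi"
      using \<sigma>' by (auto simp: abs_le_iff)
    hence "2 * A * (\<sigma> * (arctan (v \<beta> / sqrt \<mu>) - arctan (v \<alpha> / sqrt \<mu>))) \<le> 2 * A * pi"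
      using A0 by (intro mult_left_mono) auto
    moreover have "B / 2 * (\<beta> - \<alpha>) \<le> B * (\<beta> - \<alpha>)"
      using B0 assms(1) by (intro mult_right_mono) auto
    moreover have "2 * pi * A = 2 * A * pi" by simp
    ultimately show ?thesis using \<open>\<mu> > 0\<close> by (intro divide_right_mono add_mono) (simp_all only: real_sqrt_ge_0_iff less_imp_le)
  qed
  finally show ?thesis .
qed

text \<open>The cutoff is the square of \<open>bump\<close>: it must have double zeros at \<open>1/2\<close> and \<open>3\<close> for two
  integrations by parts, and its square root is the weight in the \<open>T T\<^sup>*\<close> argument.\<close>
definition bump :: "real \<Rightarrow> real" where
  "bump \<eta> = (2 * \<eta> - 1) * (3 - \<eta>)"

text \<open>\<open>S\<close> and \<open>U\<close> are separate parameters because a product with a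
  conjugate, as in the \<open>T T\<^sup>*\<close> kernel, subtracts the phases but adds the
  dampings.\<close>

definition osc :: "real \<Rightarrow> real \<Rightarrow> real \<Rightarrow> real \<Rightarrow> real \<Rightarrow> complex" where
  "osc a X S U \<eta> = exp (\<i> * of_real (X * \<eta> + S * \<eta> powr a) - of_real (U * \<eta> powr a))"

definition osc_kernel :: "real \<Rightarrow> real \<Rightarrow> real \<Rightarrow> real \<Rightarrow> complex" where
  "osc_kernel a X S U = integral {1/2..3} (\<lambda>\<eta>. osc a X S U \<eta> * of_real ((bump \<eta>)\<^sup>2))"

lemma osc_eq: "osc a X S U \<eta> = exp (\<i> * of_real (X * \<eta> + S * \<eta> powr a)) * of_real (exp (- (U * \<eta> powr a)))"
  unfolding osc_def exp_of_real[symmetric] mult_exp_exp by simp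

lemma norm_osc: "norm (osc a X S U \<eta>) = exp (- (U * \<eta> powr a))"
  by (simp add: osc_def norm_exp)

lemma DERIV_powr_const:
  "x > 0 \<Longrightarrow> ((\<lambda>\<eta>. \<eta> powr p) has_real_derivative p * x powr (p - 1)) (at x within A)" for x :: real
  by (rule has_field_derivative_at_within[OF has_real_derivative_powr])

lemma powr_bounds_half_three:
  fixes \<eta> :: real
  assumes "\<eta> \<in> {1/2..3}"
  shows "\<eta> powr p \<le> 3 powr \<bar>p\<bar>" "3 powr (- \<bar>p\<bar>) \<le> \<eta> powr p"
proof -
  have "ln \<eta> \<le> ln 3" using assms by simp
  moreover have "ln (1/3) \<le> ln \<eta>" using assms by (subst ln_le_cancel_iff) auto
  ultimately have "\<bar>ln \<eta>\<bar> \<le> ln 3" by (simp add: ln_div)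
  hence "\<bar>p * ln \<eta>\<bar> \<le> \<bar>p\<bar> * ln 3" unfolding abs_mult by (rule mult_left_mono) simp
  thus "\<eta> powr p \<le> 3 powr \<bar>p\<bar>" "3 powr (- \<bar>p\<bar>) \<le> \<eta> powr p"
    using assms by (auto simp: powr_def abs_le_iff)
qed

lemma bump_bounds:
  assumes "\<eta> \<in> {1/2..3}"
  shows "0 \<le> bump \<eta>" "bump \<eta> \<le> 25 / 8" "\<bar>7 - 4 * \<eta>\<bar> \<le> 5"
proof -
  show "0 \<le> bump \<eta>" "\<bar>7 - 4 * \<eta>\<bar> \<le> 5" using assms by (auto simp: bump_def)
  \<comment> \<open>7/4 is the vertex of the parabola \<open>bump\<close>, and 25/8 its value
    there.\<close>
  have "0 \<le> (\<eta> - 7/4)\<^sup>2" by simp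
  thus "bump \<eta> \<le> 25 / 8" by (simp add: bump_def power2_eq_square algebra_simps)
qed

lemma bump_sq_le: "\<eta> \<in> {1/2..3} \<Longrightarrow> (bump \<eta>)\<^sup>2 \<le> 10"
proof -
  assume "\<eta> \<in> {1/2..3}"
  hence "(bump \<eta>)\<^sup>2 \<le> (25/8)\<^sup>2" by (intro power_mono bump_bounds)
  thus ?thesis by (simp add: power2_eq_square)
qed

lemma bump_has_derivative [derivative_intros]:
  "(bump has_real_derivative 7 - 4 * \<eta>) (at \<eta> within A)"
  unfolding bump_def[abs_def]
  by (rule derivative_eq_intros refl)+ (simp add: algebra_simps)

lemma continuous_on_bump [continuous_intros]: "continuous_on A bump"
  unfolding bump_def[abs_def] by (intro continuous_intros)

lemma continuous_on_osc [continuous_intros]: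
  "A \<subseteq> {0<..} \<Longrightarrow> continuous_on A (osc a X S U)"
  unfolding osc_def[abs_def] by (intro continuous_intros) auto

lemma osc_kernel_trivial:
  assumes "U \<ge> 0"
  shows "norm (osc_kernel a X S U) \<le> 25"
proof -
  have "norm (osc_kernel a X S U) \<le> integral {1/2..3::real} (\<lambda>\<eta>. 10)"
    unfolding osc_kernel_def
  proof (rule integral_norm_bound_integral)
    show "(\<lambda>\<eta>. osc a X S U \<eta> * complex_of_real ((bump \<eta>)\<^sup>2)) integrable_on {1/2..3}"
      by (intro integrable_continuous_interval continuous_intros) auto
    fix \<eta> :: real assume *: "\<eta> \<in> {1/2..3}"
    have "norm (osc a X S U \<eta>) * norm (complex_of_real ((bump \<eta>)\<^sup>2)) \<le> 1 * 10"
      using bump_sq_le[OF *] assms by (intro mult_mono) (auto simp: norm_osc simp del: of_real_power)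
    thus "norm (osc a X S U \<eta> * complex_of_real ((bump \<eta>)\<^sup>2)) \<le> 10" by (simp add: norm_mult del: of_real_power)
  qed auto
  thus ?thesis by simp
qed

text \<open>The second derivative of the phase is S a (a - 1) \<eta>^(a-2), of size |S| on the whole
  support whatever X is, so the second derivative test applies with \<mu> proportional to |S|. The
  damping is put into the amplitude; its derivative costs the factor 1 + U. The exponential is kept
  in the bound because it has to pay for large X later.\<close>

lemma osc_kernel_stationary:
  assumes "a > 1"
  obtains C where "C > 0"
    "\<And>X S U. U \<ge> 0 \<Longrightarrow> S \<noteq> 0 \<Longrightarrow>
       norm (osc_kernel a X S U) \<le> C * ((1 + U) * exp (- (U * 3 powr (-a)))) / sqrt \<bar>S\<bar>"
proof -
  \<comment> \<open>A lower bound for a (a - 1) \<eta>^(a-2) on the support, valid for a below and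
    above 2.\<close>
  define k where "k = a * (a - 1) * 3 powr (- \<bar>a - 2\<bar>)"
  have "k > 0" using assms by (simp add: k_def)
  \<comment> \<open>The two parts of the derivative of the amplitude: 50 bounds the derivative of
    the squared cutoff, the rest comes from differentiating the damping.\<close>
  define P where "P = 50 + 10 * a * 3 powr (a - 1)"
  have P: "P \<ge> 50" using assms by (simp add: P_def)
  have main: "norm (osc_kernel a X S U) \<le> ((2 * pi * 10 + P * (5/2)) / sqrt k) * ((1 + U) * exp (- (U * 3 powr (-a)))) / sqrt \<bar>S\<bar>"
    if U: "U \<ge> 0" and S: "S \<noteq> 0" for X S U
  proof -
    define E where "E = exp (- (U * 3 powr (-a)))"
    define \<phi> where "\<phi> = (\<lambda>\<eta>. X * \<eta> + S * \<eta> powr a)"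
    define v where "v = (\<lambda>\<eta>. X + S * (a * \<eta> powr (a - 1)))"
    define v' where "v' = (\<lambda>\<eta>. S * (a * ((a - 1) * \<eta> powr (a - 2))))"
    define \<psi> where "\<psi> = (\<lambda>\<eta>. exp (- (U * \<eta> powr a)) * (bump \<eta>)\<^sup>2)"
    define \<psi>' where "\<psi>' = (\<lambda>\<eta>. exp (- (U * \<eta> powr a)) * (2 * bump \<eta> * (7 - 4 * \<eta>))
        - U * (a * \<eta> powr (a - 1)) * exp (- (U * \<eta> powr a)) * (bump \<eta>)\<^sup>2)"
    have eE: "exp (- (U * \<eta> powr a)) \<le> E" if "\<eta> \<in> {1/2..3}" for \<eta>
      using powr_bounds_half_three(2)[OF that, of a] assms U by (auto simp: E_def intro: mult_left_mono)
    have "norm (integral {1/2..3} (\<lambda>x. exp (\<i> * of_real (\<phi> x)) * of_real (\<psi> x)))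
      \<le> (2 * pi * (10 * ((1 + U) * E)) + (P * ((1 + U) * E)) * (3 - 1/2)) / sqrt (\<bar>S\<bar> * k)"
    proof (rule van_der_Corput_second[where v = v and v' = v' and \<psi>' = \<psi>' and \<sigma> = "sgn S"])
      show "0 < \<bar>S\<bar> * k" using S \<open>k > 0\<close> by simp
      show "\<bar>sgn S\<bar> = 1" using S by (simp add: sgn_if)
      show "\<psi> (1/2) = 0" "\<psi> 3 = 0" by (simp_all add: \<psi>_def bump_def)
      fix x :: real assume x: "x \<in> {1/2..3}"
      hence x0: "x > 0" by simp
      show "(\<phi> has_real_derivative v x) (at x within {1/2..3})"
        unfolding \<phi>_def v_def using x0
        by (auto intro!: derivative_eq_intros DERIV_powr_const)
      show "(v has_real_derivative v' x) (at x within {1/2..3})"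
        unfolding v_def v'_def using x0
        by (auto intro!: derivative_eq_intros DERIV_powr_const)
      show "(\<psi> has_real_derivative \<psi>' x) (at x within {1/2..3})"
        unfolding \<psi>_def \<psi>'_def using x0
        by (auto intro!: derivative_eq_intros DERIV_powr_const)
      have "k * \<bar>S\<bar> \<le> \<bar>S\<bar> * (a * ((a - 1) * x powr (a - 2)))"
        unfolding k_def using powr_bounds_half_three(2)[OF x, of "a - 2"] assms
        by (simp add: mult_ac mult_left_mono)
      thus "\<bar>S\<bar> * k \<le> sgn S * v' x"
        by (simp add: v'_def mult_ac abs_sgn)
      have b2: "(bump x)\<^sup>2 \<le> 10" using bump_sq_le[OF x] .
      have EU: "E \<le> (1 + U) * E" "U * E \<le> (1 + U) * E" using U by (auto simp: E_def algebra_simps)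
      have "exp (- (U * x powr a)) * (bump x)\<^sup>2 \<le> E * 10"
        using eE[OF x] b2 by (intro mult_mono) (auto simp: E_def)
      thus "\<bar>\<psi> x\<bar> \<le> 10 * ((1 + U) * E)" using EU unfolding \<psi>_def by (simp add: abs_mult)
      have "\<bar>exp (- (U * x powr a)) * (2 * bump x * (7 - 4 * x))\<bar> \<le> E * (2 * 5 * 5)"
        unfolding abs_mult using eE[OF x] bump_bounds[OF x]
        by (intro mult_mono) (auto simp: E_def)
      moreover have "\<bar>U * (a * x powr (a - 1)) * exp (- (U * x powr a)) * (bump x)\<^sup>2\<bar>
          \<le> U * (a * 3 powr (a - 1)) * E * 10"
        unfolding abs_mult using eE[OF x] b2 assms U powr_bounds_half_three(1)[OF x, of "a - 1"]
        by (intro mult_mono) (auto simp: E_def)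
      ultimately have "\<bar>\<psi>' x\<bar> \<le> 50 * E + 10 * a * 3 powr (a - 1) * (U * E)"
        unfolding \<psi>'_def by (simp add: mult_ac)
      also have "\<dots> \<le> 50 * ((1 + U) * E) + 10 * a * 3 powr (a - 1) * ((1 + U) * E)"
        using EU assms by (intro add_mono mult_left_mono) auto
      finally show "\<bar>\<psi>' x\<bar> \<le> P * ((1 + U) * E)" by (simp add: P_def algebra_simps)
    qed auto
    also have "integral {1/2..3} (\<lambda>x. exp (\<i> * of_real (\<phi> x)) * of_real (\<psi> x)) = osc_kernel a X S U"
      unfolding osc_kernel_def
      by (intro integral_cong) (simp add: osc_eq \<phi>_def \<psi>_def mult.assoc)
    finally show ?thesis
      using \<open>k > 0\<close> S by (simp add: E_def real_sqrt_mult field_simps)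
  qed
  show ?thesis
    by (rule that[OF _ main]) (use P \<open>k > 0\<close> in \<open>auto intro!: divide_pos_pos add_pos_pos\<close>)
qed

text \<open>With p = 1 / \<Phi>', two integrations by parts replace w by (p (p w)')', whose
  expansion is the four-term sum in the last hypothesis. Both steps are done at once by an explicit
  primitive. \<Phi> is complex, so that the damping can be part of the exponent instead of the
  amplitude.\<close>

lemma integral_by_parts_twice:
  fixes \<Phi> D p p1 p2 w w1 w2 :: "real \<Rightarrow> complex" and \<alpha> \<beta> M :: real
  assumes "\<alpha> \<le> \<beta>"
    and d\<Phi>: "\<And>x. x \<in> {\<alpha>..\<beta>} \<Longrightarrow> (\<Phi> has_vector_derivative D x) (at x within {\<alpha>..\<beta>})"
    and dp: "\<And>x. x \<in> {\<alpha>..\<beta>} \<Longrightarrow> (p has_vector_derivative p1 x) (at x within {\<alpha>..\<beta>})"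
    and dp1: "\<And>x. x \<in> {\<alpha>..\<beta>} \<Longrightarrow> (p1 has_vector_derivative p2 x) (at x within {\<alpha>..\<beta>})"
    and dw: "\<And>x. x \<in> {\<alpha>..\<beta>} \<Longrightarrow> (w has_vector_derivative w1 x) (at x within {\<alpha>..\<beta>})"
    and dw1: "\<And>x. x \<in> {\<alpha>..\<beta>} \<Longrightarrow> (w1 has_vector_derivative w2 x) (at x within {\<alpha>..\<beta>})"
    and pD: "\<And>x. x \<in> {\<alpha>..\<beta>} \<Longrightarrow> p x * D x = 1"
    and ends: "w \<alpha> = 0" "w1 \<alpha> = 0" "w \<beta> = 0" "w1 \<beta> = 0"
    and small: "\<And>x. x \<in> {\<alpha>..\<beta>} \<Longrightarrow> Re (\<Phi> x) \<le> 0"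
    and M: "\<And>x. x \<in> {\<alpha>..\<beta>} \<Longrightarrow>
       norm ((p1 x)\<^sup>2 * w x + p x * p2 x * w x + 3 * p x * p1 x * w1 x + (p x)\<^sup>2 * w2 x) \<le> M"
  shows "norm (integral {\<alpha>..\<beta>} (\<lambda>x. exp (\<Phi> x) * w x)) \<le> M * (\<beta> - \<alpha>)"
proof -
  let ?I = "{\<alpha>..\<beta>}"
  define R where "R = (\<lambda>x. (p1 x)\<^sup>2 * w x + p x * p2 x * w x + 3 * p x * p1 x * w1 x + (p x)\<^sup>2 * w2 x)"
  \<comment> \<open>The sum of the two boundary terms, e^\<Phi> (p w - p (p w)'). Its derivative is
    e^\<Phi> (w - R), and the double zeros of w make it vanish at both ends.\<close>
  define F where "F = (\<lambda>x. exp (\<Phi> x) * (p x * w x - p x * (p1 x * w x + p x * w1 x)))"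
  have dF: "(F has_vector_derivative exp (\<Phi> x) * (w x - R x)) (at x within ?I)" if x: "x \<in> ?I" for x
  proof -
    have "(F has_vector_derivative
       exp (\<Phi> x) * ((p x * w1 x + p1 x * w x) - (p x * ((p1 x * w1 x + p2 x * w x) + (p x * w2 x + p1 x * w1 x))
            + p1 x * (p1 x * w x + p x * w1 x)))
       + D x * exp (\<Phi> x) * (p x * w x - p x * (p1 x * w x + p x * w1 x))) (at x within ?I)"
      unfolding F_def
      by (intro has_vector_derivative_mult has_vector_derivative_diff has_vector_derivative_add
          exp_has_vector_derivative d\<Phi> dp dp1 dw dw1 x)
    moreover have "D x * exp (\<Phi> x) * (p x * w x - p x * (p1 x * w x + p x * w1 x))
        = exp (\<Phi> x) * (p x * D x) * (w x - (p1 x * w x + p x * w1 x))"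
      by (simp add: algebra_simps)
    ultimately show ?thesis
      unfolding pD[OF x] by (auto elim!: has_vector_derivative_eq_rhs simp: R_def algebra_simps power2_eq_square)
  qed
  have FTC: "((\<lambda>x. exp (\<Phi> x) * (w x - R x)) has_integral (F \<beta> - F \<alpha>)) ?I"
    using assms(1) dF by (intro fundamental_theorem_of_calculus) auto
  have Fe: "F \<beta> - F \<alpha> = 0" by (simp add: F_def ends)
  have c: "continuous_on ?I \<Phi>" "continuous_on ?I w"
    using continuous_on_vector_derivative[OF d\<Phi>] continuous_on_vector_derivative[OF dw] by auto
  have int: "(\<lambda>x. exp (\<Phi> x) * w x) integrable_on ?I" (is "?f integrable_on _")
    by (intro integrable_continuous_interval continuous_intros c)
  \<comment> \<open>Integrability of e^\<Phi> R comes for free: it is the difference of a continuous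
    function and an exact derivative.\<close>
  have hi: "((\<lambda>x. exp (\<Phi> x) * R x) has_integral integral ?I ?f) ?I"
    using has_integral_diff[OF integrable_integral[OF int] FTC] Fe by (simp add: algebra_simps)
  have "norm (integral ?I ?f) \<le> integral ?I (\<lambda>x. M)"
    unfolding integral_unique[OF hi, symmetric]
  proof (rule integral_norm_bound_integral)
    fix x assume x: "x \<in> ?I"
    have "norm (exp (\<Phi> x)) * norm (R x) \<le> 1 * M"
      using M[OF x] small[OF x] by (intro mult_mono) (auto simp: R_def)
    thus "norm (exp (\<Phi> x) * R x) \<le> M" by (simp add: norm_mult)
  qed (use hi in auto)
  thus ?thesis using assms(1) by (simp add: mult.commute)
qed

text \<open>The bound must be uniform in U, hence the damping is integrated by parts together with
  the phase. All higher derivatives of the exponent are multiples of z = \<i> S - U, and z is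
  controlled by the first derivative D: the real part of D sees U, and its imaginary part, which is
  at least |X| / 2 here, sees S. So each derivative of 1 / D is again O(1 / |D|).\<close>

lemma osc_kernel_nonstationary:
  assumes "a > 1"
  obtains C where "C > 0"
    "\<And>X S U. U \<ge> 0 \<Longrightarrow> X \<noteq> 0 \<Longrightarrow> 2 * a * 3 powr (a - 1) * \<bar>S\<bar> \<le> \<bar>X\<bar> \<Longrightarrow>
       norm (osc_kernel a X S U) \<le> C / X\<^sup>2"
proof -
  define K where "K = 1 + 3 powr (a - 1)"
  define K1 where "K1 = K * (a * (a - 1) * 3 powr \<bar>a - 2\<bar>)"
  define K2 where "K2 = K * (a * (a - 1) * \<bar>a - 2\<bar> * 3 powr \<bar>a - 3\<bar>)"
  \<comment> \<open>One summand for each term of the integrated expression; 10, 50 and 75 bound the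
    squared cutoff and its first two derivatives.\<close>
  define M where "M = K1\<^sup>2 * 10 + (K2 + 2 * K1\<^sup>2) * 10 + 3 * K1 * 50 + 75"
  have K: "K > 0" by (simp add: K_def add_pos_nonneg)
  have K12: "K1 \<ge> 0" "K2 \<ge> 0" using K assms by (auto simp: K1_def K2_def)
  have main: "norm (osc_kernel a X S U) \<le> (10 * M) / X\<^sup>2"
    if U: "U \<ge> 0" and X: "X \<noteq> 0" and SX: "2 * a * 3 powr (a - 1) * \<bar>S\<bar> \<le> \<bar>X\<bar>" for X S U
  proof -
    define z where "z = \<i> * complex_of_real S - of_real U"
    define \<Phi> where "\<Phi> = (\<lambda>\<eta>. \<i> * of_real (X * \<eta>) + z * of_real (\<eta> powr a))"
    define D where "D = (\<lambda>\<eta>. \<i> * of_real X + z * of_real (a * \<eta> powr (a - 1)))"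
    define D1 where "D1 = (\<lambda>\<eta>. z * of_real (a * ((a - 1) * \<eta> powr (a - 2))))"
    define D2 where "D2 = (\<lambda>\<eta>. z * of_real (a * ((a - 1) * ((a - 2) * \<eta> powr (a - 3)))))"
    define p where "p = (\<lambda>\<eta>. inverse (D \<eta>))"
    define p1 where "p1 = (\<lambda>\<eta>. - (D1 \<eta> * (p \<eta> * p \<eta>)))"
    define p2 where "p2 = (\<lambda>\<eta>. - (D1 \<eta> * (p \<eta> * p1 \<eta> + p1 \<eta> * p \<eta>) + D2 \<eta> * (p \<eta> * p \<eta>)))"
    define w where "w = (\<lambda>\<eta>. complex_of_real ((bump \<eta>)\<^sup>2))"
    define w1 where "w1 = (\<lambda>\<eta>. complex_of_real (2 * bump \<eta> * (7 - 4 * \<eta>)))"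
    define w2 where "w2 = (\<lambda>\<eta>. complex_of_real (2 * (7 - 4 * \<eta>)\<^sup>2 - 8 * bump \<eta>))"
    let ?I = "{1/2..3::real}"
    \<comment> \<open>The factor 2 in the hypothesis on S leaves half of X in the imaginary part, so
      X and the contribution of S cannot cancel.\<close>
    have DD: "norm (D \<eta>) \<ge> \<bar>X\<bar> / 2 \<and> norm z \<le> K * norm (D \<eta>)" if \<eta>: "\<eta> \<in> ?I" for \<eta>
    proof -
      note b = powr_bounds_half_three[OF \<eta>, of "a - 1"]
      have b1: "\<eta> powr (a - 1) \<le> 3 powr (a - 1)" "1 / 3 powr (a - 1) \<le> \<eta> powr (a - 1)"
        using b assms unfolding powr_minus_divide by simp_all
      have g1: "3 powr (a - 1) \<ge> 1" using assms by (intro ge_one_powr_ge_zero) auto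
      have im: "Im (D \<eta>) = X + S * (a * \<eta> powr (a - 1))" and re: "Re (D \<eta>) = - (U * (a * \<eta> powr (a - 1)))"
        by (simp_all add: D_def z_def)
      have "\<bar>S * (a * \<eta> powr (a - 1))\<bar> \<le> \<bar>S\<bar> * (a * 3 powr (a - 1))"
        unfolding abs_mult using b1 assms by (intro mult_left_mono) auto
      also have "\<dots> \<le> \<bar>X\<bar> / 2" using SX by (simp add: mult_ac)
      finally have "\<bar>X\<bar> / 2 \<le> \<bar>Im (D \<eta>)\<bar>" unfolding im by linarith
      hence 1: "\<bar>X\<bar> / 2 \<le> norm (D \<eta>)" using abs_Im_le_cmod[of "D \<eta>"] by linarith
      have "1 * \<bar>S\<bar> \<le> (a * 3 powr (a - 1)) * \<bar>S\<bar>"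
        using g1 assms mult_mono[of 1 a 1 "3 powr (a - 1)"] by (intro mult_right_mono) auto
      hence S: "\<bar>S\<bar> \<le> norm (D \<eta>)" using SX 1 by simp
      have "U * 1 \<le> U * (a * (3 powr (a - 1) * \<eta> powr (a - 1)))"
      proof (rule mult_left_mono)
        have "1 \<le> 3 powr (a - 1) * \<eta> powr (a - 1)" using b1(2) g1 by (simp add: field_simps)
        from mult_mono[OF less_imp_le[OF assms] this] show "1 \<le> a * (3 powr (a - 1) * \<eta> powr (a - 1))"
          using assms by simp
      qed (use U in auto)
      also have "\<dots> = 3 powr (a - 1) * \<bar>Re (D \<eta>)\<bar>" unfolding re using U assms by (simp add: abs_mult)
      also have "\<dots> \<le> 3 powr (a - 1) * norm (D \<eta>)" by (intro mult_left_mono abs_Re_le_cmod) auto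
      finally have U': "U \<le> 3 powr (a - 1) * norm (D \<eta>)" by simp
      have "norm z \<le> norm (\<i> * complex_of_real S) + norm (complex_of_real U)"
        unfolding z_def by (rule norm_triangle_ineq4)
      also have "\<dots> = \<bar>S\<bar> + U" using U by (simp add: norm_mult)
      also have "\<dots> \<le> K * norm (D \<eta>)" using S U' by (simp add: K_def algebra_simps)
      finally show ?thesis using 1 by simp
    qed
    have D0: "D \<eta> \<noteq> 0" if "\<eta> \<in> ?I" for \<eta> using DD[OF that] X by auto
    have powr_vd: "((\<lambda>\<eta>. complex_of_real (c * \<eta> powr q)) has_vector_derivative of_real (c * (q * \<eta> powr (q - 1)))) (at \<eta> within ?I)"
      if "\<eta> \<in> ?I" for \<eta> c q
      using that by (intro has_vector_derivative_of_real DERIV_cmult DERIV_powr_const) auto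
    have dD: "(D has_vector_derivative D1 \<eta>) (at \<eta> within ?I)" if "\<eta> \<in> ?I" for \<eta>
      unfolding D_def D1_def
      using has_vector_derivative_add[OF has_vector_derivative_const
          has_vector_derivative_mult_right[OF powr_vd[OF that, of a "a - 1"], of z], of "\<i> * of_real X"]
      by simp
    have dD1: "(D1 has_vector_derivative D2 \<eta>) (at \<eta> within ?I)" if "\<eta> \<in> ?I" for \<eta>
      unfolding D1_def D2_def
      using has_vector_derivative_mult_right[OF powr_vd[OF that, of "a * (a - 1)" "a - 2"], of z]
      by (simp add: mult.assoc)
    have dp: "(p has_vector_derivative p1 \<eta>) (at \<eta> within ?I)" if "\<eta> \<in> ?I" for \<eta>
      using field_vector_diff_chain_within[OF dD[OF that] has_field_derivative_at_within[OF DERIV_inverse[OF D0[OF that]]]]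
      by (simp add: p_def p1_def o_def power2_eq_square)
    have dp1: "(p1 has_vector_derivative p2 \<eta>) (at \<eta> within ?I)" if "\<eta> \<in> ?I" for \<eta>
      unfolding p1_def p2_def
      using has_vector_derivative_minus[OF has_vector_derivative_mult[OF dD1[OF that] has_vector_derivative_mult[OF dp[OF that] dp[OF that]]]]
      unfolding p1_def .
    have "norm (integral ?I (\<lambda>x. exp (\<Phi> x) * w x)) \<le> (M * (4 / X\<^sup>2)) * (3 - 1/2)"
    proof (rule integral_by_parts_twice[where D = D and p = p and ?p1.0 = p1 and ?p2.0 = p2 and ?w1.0 = w1 and ?w2.0 = w2])
      fix \<eta> assume \<eta>: "\<eta> \<in> ?I"
      show "(\<Phi> has_vector_derivative D \<eta>) (at \<eta> within ?I)"
      proof -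
        have "((\<lambda>\<eta>. complex_of_real (X * \<eta>)) has_vector_derivative of_real X) (at \<eta> within ?I)"
          by (intro has_vector_derivative_of_real) (auto intro!: derivative_eq_intros)
        from has_vector_derivative_add[OF has_vector_derivative_mult_right[OF this, of \<i>]
            has_vector_derivative_mult_right[OF powr_vd[OF \<eta>, of 1 a], of z]]
        show ?thesis unfolding \<Phi>_def D_def by simp
      qed
      show "(p has_vector_derivative p1 \<eta>) (at \<eta> within ?I)" "(p1 has_vector_derivative p2 \<eta>) (at \<eta> within ?I)"
        using dp dp1 \<eta> by auto
      show "(w has_vector_derivative w1 \<eta>) (at \<eta> within ?I)"
        unfolding w_def w1_def
        by (intro has_vector_derivative_of_real) (rule derivative_eq_intros refl | simp)+
      show "(w1 has_vector_derivative w2 \<eta>) (at \<eta> within ?I)"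
        unfolding w1_def w2_def
        by (intro has_vector_derivative_of_real)
          ((rule derivative_eq_intros refl)+, simp add: algebra_simps power2_eq_square)
      show "p \<eta> * D \<eta> = 1" using D0[OF \<eta>] by (simp add: p_def)
      show "Re (\<Phi> \<eta>) \<le> 0" using U by (simp add: \<Phi>_def z_def)
      define q where "q = norm (p \<eta>)"
      have q: "q = 1 / norm (D \<eta>)" by (simp add: q_def p_def norm_inverse divide_inverse)
      have Dp: "norm (D \<eta>) > 0" using D0[OF \<eta>] by simp
      have q0: "q \<ge> 0" by (simp add: q_def)
      have "q \<le> 2 / \<bar>X\<bar>" using DD[OF \<eta>] X Dp unfolding q by (simp add: field_simps)
      hence "q\<^sup>2 \<le> (2 / \<bar>X\<bar>)\<^sup>2" using q0 by (intro power_mono) auto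
      hence q2: "q\<^sup>2 \<le> 4 / X\<^sup>2" by (simp add: power_divide)
      have zq: "norm z * q \<le> K" using DD[OF \<eta>] Dp by (simp add: q field_simps)
      have "norm (D1 \<eta>) = norm z * (a * (a - 1) * \<eta> powr (a - 2))"
        using assms unfolding D1_def norm_mult norm_of_real by (simp add: abs_mult)
      also have "\<dots> \<le> norm z * (a * (a - 1) * 3 powr \<bar>a - 2\<bar>)"
        using assms powr_bounds_half_three(1)[OF \<eta>] by (intro mult_left_mono) auto
      finally have "norm (D1 \<eta>) * q \<le> norm z * (a * (a - 1) * 3 powr \<bar>a - 2\<bar>) * q"
        using q0 by (rule mult_right_mono)
      also have "\<dots> = (norm z * q) * (a * (a - 1) * 3 powr \<bar>a - 2\<bar>)" by (simp add: mult_ac)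
      also have "\<dots> \<le> K1" unfolding K1_def using zq assms by (intro mult_right_mono) auto
      finally have D1q: "norm (D1 \<eta>) * q \<le> K1" .
      have "norm (D2 \<eta>) = norm z * (a * (a - 1) * \<bar>a - 2\<bar> * \<eta> powr (a - 3))"
        using assms unfolding D2_def norm_mult norm_of_real by (simp add: abs_mult)
      also have "\<dots> \<le> norm z * (a * (a - 1) * \<bar>a - 2\<bar> * 3 powr \<bar>a - 3\<bar>)"
        using assms powr_bounds_half_three(1)[OF \<eta>] by (intro mult_left_mono) auto
      finally have "norm (D2 \<eta>) * q \<le> norm z * (a * (a - 1) * \<bar>a - 2\<bar> * 3 powr \<bar>a - 3\<bar>) * q"
        using q0 by (rule mult_right_mono)
      also have "\<dots> = (norm z * q) * (a * (a - 1) * \<bar>a - 2\<bar> * 3 powr \<bar>a - 3\<bar>)" by (simp add: mult_ac)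
      also have "\<dots> \<le> K2" unfolding K2_def using zq assms by (intro mult_right_mono) auto
      finally have D2q: "norm (D2 \<eta>) * q \<le> K2" .
      have "norm (p1 \<eta>) = (norm (D1 \<eta>) * q) * q" by (simp add: p1_def norm_mult q_def)
      also have "\<dots> \<le> K1 * q" using D1q q0 by (rule mult_right_mono)
      finally have p1: "norm (p1 \<eta>) \<le> K1 * q" .
      have "norm (p2 \<eta>) \<le> norm (D1 \<eta>) * (q * norm (p1 \<eta>) + norm (p1 \<eta>) * q) + norm (D2 \<eta>) * (q * q)"
        unfolding p2_def norm_minus_cancel q_def norm_mult[symmetric]
        by (intro order_trans[OF norm_triangle_ineq] add_mono) (simp_all add: norm_mult)
      also have "\<dots> = 2 * (norm (D1 \<eta>) * q) * norm (p1 \<eta>) + (norm (D2 \<eta>) * q) * q" by (simp add: algebra_simps)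
      also have "\<dots> \<le> 2 * K1 * (K1 * q) + K2 * q"
        using D1q D2q p1 K12 q0 by (intro add_mono mult_mono) auto
      finally have p2: "norm (p2 \<eta>) \<le> (K2 + 2 * K1\<^sup>2) * q" by (simp add: algebra_simps power2_eq_square)
      have c0: "norm (w \<eta>) \<le> 10" using bump_sq_le[OF \<eta>] by (simp add: w_def del: of_real_power)
      have c1: "norm (w1 \<eta>) \<le> 50"
      proof -
        have "norm (w1 \<eta>) = 2 * \<bar>bump \<eta>\<bar> * \<bar>7 - 4 * \<eta>\<bar>"
          unfolding w1_def norm_of_real by (simp add: abs_mult)
        also have "\<dots> \<le> 2 * 5 * 5" using bump_bounds[OF \<eta>] by (intro mult_mono) auto
        finally show ?thesis by simp
      qed
      have c2: "norm (w2 \<eta>) \<le> 75"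
      proof -
        have "\<bar>7 - 4 * \<eta>\<bar>\<^sup>2 \<le> 5\<^sup>2" using bump_bounds[OF \<eta>] by (intro power_mono) auto
        hence "(7 - 4 * \<eta>)\<^sup>2 \<le> 25" by simp
        moreover have "(7 - 4 * \<eta>)\<^sup>2 \<ge> 0" by simp
        ultimately have "\<bar>2 * (7 - 4 * \<eta>)\<^sup>2 - 8 * bump \<eta>\<bar> \<le> 75"
          using bump_bounds(1,2)[OF \<eta>] by linarith
        thus ?thesis unfolding w2_def norm_of_real .
      qed
      have "norm ((p1 \<eta>)\<^sup>2 * w \<eta> + p \<eta> * p2 \<eta> * w \<eta> + 3 * p \<eta> * p1 \<eta> * w1 \<eta> + (p \<eta>)\<^sup>2 * w2 \<eta>)
         \<le> (norm (p1 \<eta>))\<^sup>2 * norm (w \<eta>) + q * norm (p2 \<eta>) * norm (w \<eta>) + 3 * q * norm (p1 \<eta>) * norm (w1 \<eta>) + q\<^sup>2 * norm (w2 \<eta>)"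
        by (intro order_trans[OF norm_triangle_ineq] add_mono) (simp_all add: norm_mult norm_power q_def)
      also have "\<dots> \<le> (K1 * q)\<^sup>2 * 10 + q * ((K2 + 2 * K1\<^sup>2) * q) * 10 + 3 * q * (K1 * q) * 50 + q\<^sup>2 * 75"
        using p1 p2 c0 c1 c2 q0 K12 by (intro add_mono mult_mono power_mono) auto
      also have "\<dots> = M * q\<^sup>2" by (simp add: M_def algebra_simps power2_eq_square)
      also have "\<dots> \<le> M * (4 / X\<^sup>2)" using q2 K12 by (intro mult_left_mono) (auto simp: M_def)
      finally show "norm ((p1 \<eta>)\<^sup>2 * w \<eta> + p \<eta> * p2 \<eta> * w \<eta> + 3 * p \<eta> * p1 \<eta> * w1 \<eta> + (p \<eta>)\<^sup>2 * w2 \<eta>) \<le> M * (4 / X\<^sup>2)" .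
    qed (simp_all add: w_def w1_def bump_def)
    also have "integral ?I (\<lambda>x. exp (\<Phi> x) * w x) = osc_kernel a X S U"
      unfolding osc_kernel_def
      by (intro integral_cong) (simp add: osc_def \<Phi>_def w_def z_def algebra_simps)
    finally show ?thesis by simp
  qed
  show ?thesis
    by (rule that[OF _ main]) (use K12 in \<open>auto simp: M_def intro!: add_nonneg_pos\<close>)
qed

section \<open>The dual form of the maximal estimate\<close>

lemma Fubini_bounded:
  fixes f :: "'a \<Rightarrow> 'b \<Rightarrow> 'c::{banach, second_countable_topology}"
  assumes "finite_measure M" "finite_measure N"
    and f: "case_prod f \<in> borel_measurable (M \<Otimes>\<^sub>M N)" and C: "\<And>x y. norm (f x y) \<le> C"
  shows "(\<integral>x. \<integral>y. f x y \<partial>N \<partial>M) = (\<integral>y. \<integral>x. f x y \<partial>M \<partial>N)"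
proof -
  interpret M: finite_measure M by fact
  interpret N: finite_measure N by fact
  interpret pair_sigma_finite M N ..
  interpret MN: finite_measure "M \<Otimes>\<^sub>M N" by (intro finite_measure_pair_measure assms)
  have "integrable (M \<Otimes>\<^sub>M N) (case_prod f)"
    using C by (intro MN.integrable_const_bound[where B = C] f) auto
  from Fubini_integral[OF this] show ?thesis by simp
qed

lemma (in finite_measure) norm_integral_bounded:
  fixes f :: "'a \<Rightarrow> 'b::{banach, second_countable_topology}"
  assumes C: "\<And>x. norm (f x) \<le> C"
  shows "norm (\<integral>x. f x \<partial>M) \<le> C * measure M (space M)"
proof (cases "integrable M f")
  case True
  hence "norm (\<integral>x. f x \<partial>M) \<le> (\<integral>x. norm (f x) \<partial>M)" by simp
  also have "\<dots> \<le> (\<integral>x. C \<partial>M)" using True C by (intro integral_mono) auto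
  finally show ?thesis by (simp add: mult.commute)
next
  case False
  have "C \<ge> 0" using C[of undefined] norm_ge_zero order_trans by blast
  with False show ?thesis by (simp add: not_integrable_integral_eq)
qed

lemma borel_measurable_cnj [measurable]: "cnj \<in> borel_measurable borel"
  by (intro borel_measurable_continuous_onI continuous_intros)

text \<open>Let F be the operator applied to g, and let H be the transposed operator applied to the
  conjugate of F. Then the squared norm of F is the integral of g H, and the squared norm of H is a
  quadratic form in F with the kernel \<open>k\<close>, which Schur's test bounds by B times the
  squared norm of F. Finite measures and bounded data make every exchange of integrals legitimate
  and the norm of F finite, so that it may be absorbed at the end.\<close>

lemma TTstar_bound:
  fixes e :: "'a \<Rightarrow> 'b \<Rightarrow> complex" and g :: "'b \<Rightarrow> complex"
  assumes "finite_measure M" "finite_measure N"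
    and e [measurable]: "case_prod e \<in> borel_measurable (M \<Otimes>\<^sub>M N)"
    and g [measurable]: "g \<in> borel_measurable N"
    and Ce: "\<And>x y. norm (e x y) \<le> Ce" and Cg: "\<And>y. norm (g y) \<le> Cg"
    and "B > 0"
    and K: "\<And>x. x \<in> space M \<Longrightarrow> (\<integral>\<^sup>+x'. norm (\<integral>y. e x y * cnj (e x' y) \<partial>N) \<partial>M) \<le> ennreal B"
  shows "(\<integral>x. (norm (\<integral>y. g y * e x y \<partial>N))\<^sup>2 \<partial>M) \<le> B * (\<integral>y. (norm (g y))\<^sup>2 \<partial>N)"
proof -
  interpret M: finite_measure M by fact
  interpret N: finite_measure N by fact
  interpret MN: pair_sigma_finite M N ..
  interpret MM: pair_sigma_finite M M ..
  define F where "F = (\<lambda>x. \<integral>y. g y * e x y \<partial>N)"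
  define H where "H = (\<lambda>y. \<integral>x. cnj (F x) * e x y \<partial>M)"
  define k where "k = (\<lambda>x x'. \<integral>y. e x y * cnj (e x' y) \<partial>N)"
  have Ce0: "Ce \<ge> 0" using Ce norm_ge_zero order_trans by blast
  have Cg0: "Cg \<ge> 0" using Cg norm_ge_zero order_trans by blast
  have eL [measurable (raw)]: "(\<lambda>z. e (u z) (v z)) \<in> borel_measurable L"
    if "u \<in> L \<rightarrow>\<^sub>M M" "v \<in> L \<rightarrow>\<^sub>M N" for u v and L :: "'d measure"
    using measurable_compose[OF measurable_Pair[OF that] e] by simp
  have Fm [measurable]: "F \<in> borel_measurable M" unfolding F_def by measurable
  have Hm [measurable]: "H \<in> borel_measurable N" unfolding H_def by measurable
  have km [measurable]: "case_prod k \<in> borel_measurable (M \<Otimes>\<^sub>M M)"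
  proof -
    have "(\<lambda>z. \<integral>y. e (fst z) y * cnj (e (snd z) y) \<partial>N) \<in> borel_measurable (M \<Otimes>\<^sub>M M)"
      by measurable
    thus ?thesis by (simp add: k_def case_prod_beta')
  qed
  define CF where "CF = Cg * Ce * measure N (space N)"
  have CF: "norm (F x) \<le> CF" for x
    unfolding F_def CF_def using Ce Cg Cg0
    by (intro N.norm_integral_bounded) (auto simp: norm_mult intro: mult_mono)
  have CF0: "CF \<ge> 0" using CF norm_ge_zero order_trans by blast
  define CH where "CH = CF * Ce * measure M (space M)"
  have CH: "norm (H y) \<le> CH" for y
    unfolding H_def CH_def using Ce CF CF0
    by (intro M.norm_integral_bounded) (auto simp: norm_mult intro: mult_mono)
  have CH0: "CH \<ge> 0" using CH norm_ge_zero order_trans by blast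
  define Ck where "Ck = Ce * Ce * measure N (space N)"
  have Ck: "norm (k x x') \<le> Ck" for x x'
    unfolding k_def Ck_def using Ce Ce0
    by (intro N.norm_integral_bounded) (auto simp: norm_mult intro: mult_mono)
  have Ck0: "Ck \<ge> 0" using Ck norm_ge_zero order_trans by blast
  have ksym: "norm (k x x') = norm (k x' x)" for x x'
  proof -
    have "k x x' = cnj (k x' x)" unfolding k_def Bochner_Integration.integral_cnj[symmetric] by (simp add: mult.commute)
    thus ?thesis by simp
  qed
  have kB: "(\<integral>x'. norm (k x x') \<partial>M) \<le> B" if "x \<in> space M" for x
    using K[OF that] \<open>B > 0\<close> by (intro integral_real_bounded) (auto simp: k_def)
  define X where "X = (\<integral>x. (norm (F x))\<^sup>2 \<partial>M)"
  define Y where "Y = (\<integral>y. (norm (H y))\<^sup>2 \<partial>N)"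
  define G where "G = (\<integral>y. (norm (g y))\<^sup>2 \<partial>N)"
  have iF: "integrable M (\<lambda>x. (norm (F x))\<^sup>2)"
    by (rule M.integrable_const_bound[where B = "CF\<^sup>2"]) (auto intro!: power_mono CF)
  have iH: "integrable N (\<lambda>x. (norm (H x))\<^sup>2)"
    by (rule N.integrable_const_bound[where B = "CH\<^sup>2"]) (auto intro!: power_mono CH)
  have ig: "integrable N (\<lambda>x. (norm (g x))\<^sup>2)"
    by (rule N.integrable_const_bound[where B = "Cg\<^sup>2"]) (auto intro!: power_mono Cg)
  have X0: "X \<ge> 0" and Y0: "Y \<ge> 0" by (auto simp: X_def Y_def)
  have "complex_of_real X = (\<integral>x. cnj (F x) * F x \<partial>M)"
    unfolding X_def integral_complex_of_real[symmetric]
    by (intro Bochner_Integration.integral_cong) (simp_all add: complex_norm_square mult.commute del: of_real_power)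
  also have "\<dots> = (\<integral>x. \<integral>y. cnj (F x) * (g y * e x y) \<partial>N \<partial>M)"
    unfolding F_def by simp
  also have "\<dots> = (\<integral>y. \<integral>x. cnj (F x) * (g y * e x y) \<partial>M \<partial>N)"
  proof (rule Fubini_bounded[OF assms(1,2)])
    show "norm (cnj (F x) * (g y * e x y)) \<le> CF * (Cg * Ce)" for x y
      unfolding norm_mult complex_mod_cnj using CF Cg Ce CF0 Cg0 by (intro mult_mono) auto
    show "(\<lambda>(x, y). cnj (F x) * (g y * e x y)) \<in> borel_measurable (M \<Otimes>\<^sub>M N)" by measurable
  qed
  also have "\<dots> = (\<integral>y. g y * H y \<partial>N)"
    unfolding H_def by (simp flip: Bochner_Integration.integral_mult_right_zero add: mult_ac)
  finally have "X = norm (\<integral>y. g y * H y \<partial>N)" using X0 by (metis norm_of_real abs_of_nonneg)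
  also have "\<dots> \<le> (\<integral>y. norm (g y * H y) \<partial>N)" by (rule integral_norm_bound)
  \<comment> \<open>Young's inequality with weight B replaces Cauchy-Schwarz: once Y \<le> B X is
    known, the second term is at most X / 2.\<close>
  also have "\<dots> \<le> (\<integral>y. B / 2 * (norm (g y))\<^sup>2 + 1 / (2 * B) * (norm (H y))\<^sup>2 \<partial>N)"
  proof (rule Bochner_Integration.integral_mono)
    show "integrable N (\<lambda>y. norm (g y * H y))"
      using CH Cg Cg0 by (intro N.integrable_const_bound[where B = "Cg * CH"]) (auto simp: norm_mult intro!: mult_mono AE_I2)
    show "integrable N (\<lambda>y. B / 2 * (norm (g y))\<^sup>2 + 1 / (2 * B) * (norm (H y))\<^sup>2)"
      using iH ig by auto
    fix y
    have "0 \<le> (B * norm (g y) - norm (H y))\<^sup>2 / (2 * B)" using \<open>B > 0\<close> by simp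
    also have "\<dots> = B / 2 * (norm (g y))\<^sup>2 + 1 / (2 * B) * (norm (H y))\<^sup>2 - norm (g y) * norm (H y)"
      using \<open>B > 0\<close> by (simp add: power2_diff field_simps power2_eq_square)
    finally show "norm (g y * H y) \<le> B / 2 * (norm (g y))\<^sup>2 + 1 / (2 * B) * (norm (H y))\<^sup>2"
      by (simp add: norm_mult)
  qed
  also have "\<dots> = B / 2 * G + 1 / (2 * B) * Y" using iH ig by (simp add: G_def Y_def)
  finally have XGY: "X \<le> B / 2 * G + 1 / (2 * B) * Y" .

  have b2: "norm ((norm (F x'))\<^sup>2 / 2 * norm (k x x')) \<le> CF\<^sup>2 / 2 * Ck" for x x'
    unfolding real_norm_def abs_mult using CF Ck CF0 by (intro mult_mono) (auto intro!: power_mono divide_right_mono)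
  have iFk: "integrable M (\<lambda>x. (\<integral>x'. (norm (F x'))\<^sup>2 / 2 * norm (k x x') \<partial>M))"
    using M.norm_integral_bounded[OF b2]
    by (intro M.integrable_const_bound[where B = "CF\<^sup>2 / 2 * Ck * measure M (space M)"]) auto
  have "complex_of_real Y = (\<integral>y. H y * cnj (H y) \<partial>N)"
    unfolding Y_def integral_complex_of_real[symmetric]
    by (intro Bochner_Integration.integral_cong) (simp_all add: complex_norm_square del: of_real_power)
  also have "\<dots> = (\<integral>y. \<integral>x. cnj (F x) * e x y * cnj (H y) \<partial>M \<partial>N)"
    unfolding H_def by simp
  also have "\<dots> = (\<integral>x. \<integral>y. cnj (F x) * e x y * cnj (H y) \<partial>N \<partial>M)"
  proof (rule Fubini_bounded[OF assms(1,2), symmetric])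
    show "norm (cnj (F x) * e x y * cnj (H y)) \<le> CF * Ce * CH" for x y
      unfolding norm_mult complex_mod_cnj using CF CH Ce CF0 Ce0 by (intro mult_mono) auto
    show "(\<lambda>(x, y). cnj (F x) * e x y * cnj (H y)) \<in> borel_measurable (M \<Otimes>\<^sub>M N)" by measurable
  qed
  also have "\<dots> = (\<integral>x. \<integral>x'. cnj (F x) * F x' * k x x' \<partial>M \<partial>M)"
  proof (rule Bochner_Integration.integral_cong[OF refl])
    fix x assume x: "x \<in> space M"
    have [measurable]: "(\<lambda>y. e x y) \<in> borel_measurable N" using x by measurable
    have "(\<integral>y. cnj (F x) * e x y * cnj (H y) \<partial>N) = (\<integral>y. \<integral>x'. cnj (F x) * e x y * (F x' * cnj (e x' y)) \<partial>M \<partial>N)"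
      unfolding H_def by (simp flip: Bochner_Integration.integral_cnj)
    also have "\<dots> = (\<integral>x'. \<integral>y. cnj (F x) * e x y * (F x' * cnj (e x' y)) \<partial>N \<partial>M)"
    proof (rule Fubini_bounded[OF assms(1,2), symmetric])
      show "norm (cnj (F x) * e x y * (F x' * cnj (e x' y))) \<le> CF * Ce * (CF * Ce)" for x' y
        unfolding norm_mult complex_mod_cnj using CF Ce CF0 Ce0 by (intro mult_mono) auto
      show "(\<lambda>(x', y). cnj (F x) * e x y * (F x' * cnj (e x' y))) \<in> borel_measurable (M \<Otimes>\<^sub>M N)" by measurable
    qed
    also have "\<dots> = (\<integral>x'. cnj (F x) * F x' * k x x' \<partial>M)"
      unfolding k_def by (simp flip: Bochner_Integration.integral_mult_right_zero add: mult_ac)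
    finally show "(\<integral>y. cnj (F x) * e x y * cnj (H y) \<partial>N) = (\<integral>x'. cnj (F x) * F x' * k x x' \<partial>M)" .
  qed
  finally have "Y = norm (\<integral>x. \<integral>x'. cnj (F x) * F x' * k x x' \<partial>M \<partial>M)"
    using Y0 by (metis norm_of_real abs_of_nonneg)
  also have "\<dots> \<le> (\<integral>x. norm (\<integral>x'. cnj (F x) * F x' * k x x' \<partial>M) \<partial>M)" by (rule integral_norm_bound)
  also have "\<dots> \<le> (\<integral>x. (norm (F x))\<^sup>2 / 2 * B + (\<integral>x'. (norm (F x'))\<^sup>2 / 2 * norm (k x x') \<partial>M) \<partial>M)"
  proof (rule Bochner_Integration.integral_mono)
    have b1: "norm (cnj (F x) * F x' * k x x') \<le> CF * CF * Ck" for x x'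
      unfolding norm_mult complex_mod_cnj using CF Ck CF0 by (intro mult_mono) auto
    show "integrable M (\<lambda>x. norm (\<integral>x'. cnj (F x) * F x' * k x x' \<partial>M))"
      using M.norm_integral_bounded[OF b1]
      by (intro M.integrable_const_bound[where B = "CF * CF * Ck * measure M (space M)"]) auto
    show "integrable M (\<lambda>x. (norm (F x))\<^sup>2 / 2 * B + (\<integral>x'. (norm (F x'))\<^sup>2 / 2 * norm (k x x') \<partial>M))"
      using iF iFk by auto
    fix x assume x: "x \<in> space M"
    have [measurable]: "(\<lambda>x'. k x x') \<in> borel_measurable M" using measurable_compose[OF measurable_Pair1'[OF x] km] by simp
    have ik: "integrable M (\<lambda>x'. norm (k x x'))"
      using Ck by (intro M.integrable_const_bound[where B = Ck]) auto
    have i2: "integrable M (\<lambda>x'. (norm (F x'))\<^sup>2 / 2 * norm (k x x'))"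
      using b2 by (intro M.integrable_const_bound[where B = "CF\<^sup>2 / 2 * Ck"] AE_I2) (auto simp del: real_norm_def)
    have "norm (\<integral>x'. cnj (F x) * F x' * k x x' \<partial>M) \<le> (\<integral>x'. norm (cnj (F x) * F x' * k x x') \<partial>M)"
      by (rule integral_norm_bound)
    also have "\<dots> \<le> (\<integral>x'. (norm (F x))\<^sup>2 / 2 * norm (k x x') + (norm (F x'))\<^sup>2 / 2 * norm (k x x') \<partial>M)"
    proof (rule Bochner_Integration.integral_mono)
      show "integrable M (\<lambda>x'. norm (cnj (F x) * F x' * k x x'))"
        using b1 by (intro M.integrable_const_bound[where B = "CF * CF * Ck"] AE_I2) auto
      show "integrable M (\<lambda>x'. (norm (F x))\<^sup>2 / 2 * norm (k x x') + (norm (F x'))\<^sup>2 / 2 * norm (k x x'))"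
        using ik i2 by auto
      fix x'
      have "norm (F x) * norm (F x') \<le> (norm (F x))\<^sup>2 / 2 + (norm (F x'))\<^sup>2 / 2"
        using sum_squares_bound[of "norm (F x)" "norm (F x')"] by simp
      from mult_right_mono[OF this norm_ge_zero[of "k x x'"]]
      show "norm (cnj (F x) * F x' * k x x') \<le> (norm (F x))\<^sup>2 / 2 * norm (k x x') + (norm (F x'))\<^sup>2 / 2 * norm (k x x')"
        by (simp add: norm_mult distrib_right)
    qed
    also have "\<dots> = (norm (F x))\<^sup>2 / 2 * (\<integral>x'. norm (k x x') \<partial>M) + (\<integral>x'. (norm (F x'))\<^sup>2 / 2 * norm (k x x') \<partial>M)"
      using ik i2 by simp
    also have "\<dots> \<le> (norm (F x))\<^sup>2 / 2 * B + (\<integral>x'. (norm (F x'))\<^sup>2 / 2 * norm (k x x') \<partial>M)"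
      using kB[OF x] by (intro add_right_mono mult_left_mono) auto
    finally show "norm (\<integral>x'. cnj (F x) * F x' * k x x' \<partial>M) \<le>
        (norm (F x))\<^sup>2 / 2 * B + (\<integral>x'. (norm (F x'))\<^sup>2 / 2 * norm (k x x') \<partial>M)" .
  qed
  also have "\<dots> = X / 2 * B + (\<integral>x. (\<integral>x'. (norm (F x'))\<^sup>2 / 2 * norm (k x x') \<partial>M) \<partial>M)"
    using iF iFk by (simp add: X_def)
  \<comment> \<open>This half of the quadratic form asks for a column bound; exchanging the
    integrals and the Hermitian symmetry of \<open>k\<close> reduce it to the row bound.\<close>
  also have "(\<integral>x. (\<integral>x'. (norm (F x'))\<^sup>2 / 2 * norm (k x x') \<partial>M) \<partial>M)
      = (\<integral>x'. (\<integral>x. (norm (F x'))\<^sup>2 / 2 * norm (k x x') \<partial>M) \<partial>M)"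
    by (rule Fubini_bounded[OF assms(1,1) _ b2]) measurable
  also have "\<dots> = (\<integral>x'. (norm (F x'))\<^sup>2 / 2 * (\<integral>x. norm (k x' x) \<partial>M) \<partial>M)"
    by (subst ksym) simp
  also have "\<dots> \<le> (\<integral>x'. (norm (F x'))\<^sup>2 / 2 * B \<partial>M)"
  proof (rule Bochner_Integration.integral_mono)
    show "integrable M (\<lambda>x'. (norm (F x'))\<^sup>2 / 2 * B)" using iF by auto
    have ki: "norm (\<integral>x. norm (k x' x) \<partial>M) \<le> Ck * measure M (space M)" for x'
      using Ck by (intro M.norm_integral_bounded) auto
    have "norm ((norm (F x'))\<^sup>2 / 2 * (\<integral>x. norm (k x' x) \<partial>M)) \<le> CF\<^sup>2 / 2 * (Ck * measure M (space M))" for x'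
      unfolding norm_mult using CF ki by (intro mult_mono) (auto intro!: power_mono divide_right_mono)
    thus "integrable M (\<lambda>x'. (norm (F x'))\<^sup>2 / 2 * (\<integral>x. norm (k x' x) \<partial>M))"
      by (intro M.integrable_const_bound[where B = "CF\<^sup>2 / 2 * (Ck * measure M (space M))"] AE_I2) auto
  qed (auto intro!: mult_left_mono kB)
  also have "\<dots> = X / 2 * B" by (simp add: X_def)
  finally have "Y \<le> B * X" by (simp add: mult.commute)
  hence "1 / (2 * B) * Y \<le> X / 2" using \<open>B > 0\<close> by (simp add: field_simps)
  with XGY have "X \<le> B * G" by (simp add: field_simps)
  thus ?thesis by (simp add: X_def G_def F_def)
qed

section \<open>The majorant of the kernel\<close>

lemma one_plus_powr_exp_bounded:
  fixes c p :: real
  assumes "c > 0" "p \<ge> 0"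
  obtains C where "C > 0" "\<And>u. u \<ge> 0 \<Longrightarrow> (1 + u) powr p * exp (- (c * u)) \<le> C"
proof -
  \<comment> \<open>Large enough that p / m \<le> c, so that (1 + u)^p \<le> m^p e^(p u / m) is
    beaten by the exponential.\<close>
  define m where "m = 1 + p / c"
  have m: "m \<ge> 1" "p / m \<le> c" using assms by (auto simp: m_def field_simps)
  have "(1 + u) powr p * exp (- (c * u)) \<le> m powr p" if "u \<ge> 0" for u
  proof -
    have "1 + u \<le> m * (1 + u / m)" using m by (simp add: field_simps)
    also have "\<dots> \<le> m * exp (u / m)" using m by (intro mult_left_mono exp_ge_add_one_self) auto
    finally have "(1 + u) powr p \<le> (m * exp (u / m)) powr p"
      using that assms by (intro powr_mono2) auto
    also have "\<dots> = m powr p * exp (p / m * u)"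
      using m by (simp add: powr_mult) (simp add: powr_def mult_ac)
    also have "\<dots> \<le> m powr p * exp (c * u)"
      using mult_right_mono[OF m(2) that] by (intro mult_left_mono) auto
    finally have "(1 + u) powr p * exp (- (c * u)) \<le> m powr p * exp (c * u) * exp (- (c * u))"
      by (intro mult_right_mono) auto
    also have "\<dots> = m powr p" by (simp add: exp_minus field_simps)
    finally show ?thesis .
  qed
  thus ?thesis using m by (intro that[of "m powr p"]) auto
qed

text \<open>Decays like |X|^(-1/2) up to |X| = P and like |X|^(-3/2) beyond: slowly enough to
  dominate the non-stationary X^(-2), fast enough to be integrable. This product form compares with
  a function that has an elementary primitive.\<close>

definition majorant :: "real \<Rightarrow> real \<Rightarrow> real" where
  "majorant P X = 1 / (sqrt (1 + \<bar>X\<bar>) * (1 + \<bar>X\<bar> / P))"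

lemma majorant_nonneg: "P > 0 \<Longrightarrow> majorant P X \<ge> 0"
  by (simp add: majorant_def)

lemma borel_measurable_majorant [measurable]: "majorant P \<in> borel_measurable borel"
  unfolding majorant_def[abs_def] by measurable

text \<open>On the positive half-line, P \<ge> 1 allows 2 P + 2 X to be replaced by the smaller P +
  1 + X. With y = sqrt (1 + X) the integrand becomes 4 P / (P + y^2), whose primitive is
  \<open>F\<close>; each half-line contributes at most 2 pi sqrt P.\<close>

lemma nn_integral_majorant:
  assumes "P \<ge> 1"
  shows "(\<integral>\<^sup>+X. ennreal (majorant P X) \<partial>lborel) \<le> ennreal (4 * pi * sqrt P)"
proof -
  define f where "f = (\<lambda>X. 2 * P / (sqrt (1 + X) * (P + 1 + X)))"
  define F where "F = (\<lambda>X. 4 * sqrt P * arctan (sqrt (1 + X) / sqrt P))"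
  have half: "(\<integral>\<^sup>+X. ennreal (majorant P X) * indicator {0..} X \<partial>lborel) \<le> ennreal (2 * pi * sqrt P)"
  proof -
    have "(\<integral>\<^sup>+X. ennreal (majorant P X) * indicator {0..} X \<partial>lborel) \<le> (\<integral>\<^sup>+X. ennreal (f X) * indicator {0..} X \<partial>lborel)"
    proof (intro nn_integral_mono)
      fix X :: real
      have "majorant P X \<le> f X" if "X \<ge> 0"
      proof -
        have "majorant P X = 2 * P / (sqrt (1 + X) * (2 * P + 2 * X))"
        proof -
          have "1 + X / P = (P + X) / P" using assms by (simp add: field_simps)
          hence "majorant P X = P / (sqrt (1 + X) * (P + X))" using that by (simp add: majorant_def)
          also have "\<dots> = (2 * P) / (2 * (sqrt (1 + X) * (P + X)))" by simp
          also have "2 * (sqrt (1 + X) * (P + X)) = sqrt (1 + X) * (2 * P + 2 * X)" by (simp add: algebra_simps)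
          finally show ?thesis .
        qed
        also have "\<dots> \<le> f X" unfolding f_def using that assms
          by (intro divide_left_mono mult_left_mono mult_pos_pos) auto
        finally show ?thesis .
      qed
      thus "ennreal (majorant P X) * indicator {0..} X \<le> ennreal (f X) * indicator {0..} X"
        by (auto simp: indicator_def intro: ennreal_leI)
    qed
    also have "\<dots> = ennreal (4 * sqrt P * (pi / 2) - F 0)"
    proof (rule nn_integral_FTC_atLeast)
      show "f \<in> borel_measurable borel" unfolding f_def by measurable
      fix X :: real assume X: "0 \<le> X"
      show "f X \<ge> 0" unfolding f_def using X assms by simp
      define y where "y = sqrt (1 + X)"
      define q where "q = sqrt P"
      have y: "y > 0" "y * y = 1 + X" and q: "q > 0" "q * q = P" using X assms by (auto simp: y_def q_def)
      have "((\<lambda>X. sqrt (1 + X)) has_real_derivative (inverse y / 2)) (at X)"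
        unfolding y_def using X by (auto intro!: derivative_eq_intros)
      from DERIV_cmult[OF DERIV_chain2[OF DERIV_arctan DERIV_cdivide[OF this, of q]], of "4 * q"]
      have "(F has_real_derivative 4 * q * (inverse (1 + (y / q)\<^sup>2) * (inverse y / 2 / q))) (at X)"
        by (simp only: F_def y_def q_def)
      moreover have "4 * q * (inverse (1 + (y / q)\<^sup>2) * (inverse y / 2 / q)) = f X"
      proof -
        have "1 + (y / q)\<^sup>2 = (P + 1 + X) / P" using y q assms by (simp add: power2_eq_square field_simps)
        hence "4 * q * (inverse (1 + (y / q)\<^sup>2) * (inverse y / 2 / q))
            = 4 * q * (inverse ((P + 1 + X) / P) * (inverse y / 2 / q))" by (simp only:)
        also have "\<dots> = f X"
        proof -
          define Z where "Z = P + 1 + X"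
          have "Z > 0" using assms X by (simp add: Z_def)
          thus ?thesis
            unfolding f_def y_def[symmetric] Z_def[symmetric] using \<open>q > 0\<close> \<open>y > 0\<close> by (simp add: field_simps)
        qed
        finally show ?thesis .
      qed
      ultimately show "(F has_real_derivative f X) (at X)" by simp
    next
      have "((\<lambda>X. 4 * sqrt P * arctan (sqrt (1 + X) / sqrt P)) \<longlongrightarrow> 4 * sqrt P * (pi / 2)) at_top"
      proof (intro tendsto_mult tendsto_const filterlim_compose[OF tendsto_arctan_at_top])
        have "filterlim (\<lambda>X::real. sqrt (1 + X)) at_top at_top"
          by (rule filterlim_compose[OF sqrt_at_top filterlim_tendsto_add_at_top[OF tendsto_const filterlim_ident]])
        thus "filterlim (\<lambda>X::real. sqrt (1 + X) / sqrt P) at_top at_top"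
          unfolding divide_inverse mult.commute[of _ "inverse (sqrt P)"] using assms
          by (intro filterlim_tendsto_pos_mult_at_top[OF tendsto_const]) auto
      qed
      thus "(F \<longlongrightarrow> 4 * sqrt P * (pi / 2)) at_top" unfolding F_def .
    qed
    also have "\<dots> \<le> ennreal (2 * pi * sqrt P)"
      using assms by (intro ennreal_leI) (simp add: F_def)
    finally show ?thesis .
  qed
  have "(\<integral>\<^sup>+X. ennreal (majorant P X) \<partial>lborel) \<le>
      (\<integral>\<^sup>+X. ennreal (majorant P X) * indicator {0..} X + ennreal (majorant P X) * indicator {..0} X \<partial>lborel)"
    by (intro nn_integral_mono) (auto simp: indicator_def)
  also have "\<dots> = (\<integral>\<^sup>+X. ennreal (majorant P X) * indicator {0..} X \<partial>lborel) + (\<integral>\<^sup>+X. ennreal (majorant P X) * indicator {..0} X \<partial>lborel)"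
    by (rule nn_integral_add) auto
  also have "(\<integral>\<^sup>+X. ennreal (majorant P X) * indicator {..0} X \<partial>lborel) = (\<integral>\<^sup>+X. ennreal (majorant P X) * indicator {0..} X \<partial>lborel)"
    by (subst nn_integral_real_affine[where c = "-1" and t = 0])
       (auto simp: majorant_def indicator_def intro!: nn_integral_cong)
  also have "(\<integral>\<^sup>+X. ennreal (majorant P X) * indicator {0..} X \<partial>lborel) + (\<integral>\<^sup>+X. ennreal (majorant P X) * indicator {0..} X \<partial>lborel)
      \<le> ennreal (2 * pi * sqrt P) + ennreal (2 * pi * sqrt P)"
    by (intro add_mono half)
  also have "\<dots> = ennreal (4 * pi * sqrt P)" using assms by (subst ennreal_plus[symmetric]) auto
  finally show ?thesis .
qed

text \<open>The crucial case is the stationary one. With m the larger of the two times, |X| is at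
  most a multiple of |S| \<le> \<kappa> m, while U \<ge> \<kappa> m^\<gamma>. Eliminating m gives
  |X| / P \<le> c U^(1/\<gamma>), so the second factor of the majorant is paid for by the
  exponential in U and both times disappear from the bound.\<close>

lemma osc_kernel_majorised:
  assumes "a > 1" "\<gamma> > 0"
  obtains C where "C > 0"
    "\<And>X \<kappa> t t'. \<kappa> \<ge> 0 \<Longrightarrow> t > 0 \<Longrightarrow> t' > 0 \<Longrightarrow>
       norm (osc_kernel a X (\<kappa> * (t - t')) (\<kappa> * (t powr \<gamma> + t' powr \<gamma>)))
         \<le> C * majorant (max 1 (\<kappa> powr (1 - 1 / \<gamma>))) X"
proof -
  obtain CN where CN: "CN > 0" "\<And>X S U. U \<ge> 0 \<Longrightarrow> X \<noteq> 0 \<Longrightarrow> 2 * a * 3 powr (a - 1) * \<bar>S\<bar> \<le> \<bar>X\<bar> \<Longrightarrow>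
       norm (osc_kernel a X S U) \<le> CN / X\<^sup>2" using osc_kernel_nonstationary[OF assms(1)] by blast
  obtain CS where CS: "CS > 0" "\<And>X S U. U \<ge> 0 \<Longrightarrow> S \<noteq> 0 \<Longrightarrow>
       norm (osc_kernel a X S U) \<le> CS * ((1 + U) * exp (- (U * 3 powr (-a)))) / sqrt \<bar>S\<bar>"
    using osc_kernel_stationary[OF assms(1)] by blast
  \<comment> \<open>In the exponent, 1 is the factor 1 + U lost in the stationary bound and 1 /
    \<gamma> is the price of 1 + |X| / P.\<close>
  obtain CE where CE: "CE > 0" "\<And>u. u \<ge> 0 \<Longrightarrow> (1 + u) powr (1 + 1 / \<gamma>) * exp (- (3 powr (-a) * u)) \<le> CE"
    using one_plus_powr_exp_bounded[of "3 powr (-a)" "1 + 1/\<gamma>"] assms by auto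
  define c where "c = 2 * a * 3 powr (a - 1)"
  have c: "c > 0" using assms by (simp add: c_def)
  \<comment> \<open>One summand for each regime. For |X| \<le> 1 the majorant is at least 1/4 and
    the kernel at most 25, hence 100; for |X| > 1 the majorant is at least 1 / (4 X^2), hence 4
    \<open>CN\<close>.\<close>
  define C where "C = 100 + 4 * CN + CS * sqrt (2 * c) * ((1 + c) * CE)"
  have Cge: "C \<ge> 100" "C \<ge> 4 * CN" "C \<ge> CS * sqrt (2 * c) * ((1 + c) * CE)"
    using CN(1) CS(1) CE(1) c by (auto simp: C_def)
  have main: "norm (osc_kernel a X (\<kappa> * (t - t')) (\<kappa> * (t powr \<gamma> + t' powr \<gamma>)))
         \<le> C * majorant (max 1 (\<kappa> powr (1 - 1 / \<gamma>))) X"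
    if \<kappa>: "\<kappa> \<ge> 0" and t: "t > 0" "t' > 0" for X \<kappa> t t'
  proof -
    define P where "P = max 1 (\<kappa> powr (1 - 1 / \<gamma>))"
    define S where "S = \<kappa> * (t - t')"
    define U where "U = \<kappa> * (t powr \<gamma> + t' powr \<gamma>)"
    have U: "U \<ge> 0" using \<kappa> t by (simp add: U_def)
    have P: "P \<ge> 1" by (simp add: P_def)
    have k0: "majorant P X \<ge> 0" using P by (intro majorant_nonneg) auto
    consider (small) "\<bar>X\<bar> \<le> 1" | (ns) "\<bar>X\<bar> > 1" "c * \<bar>S\<bar> \<le> \<bar>X\<bar>" | (st) "\<bar>X\<bar> > 1" "c * \<bar>S\<bar> > \<bar>X\<bar>" by linarith
    hence "norm (osc_kernel a X S U) \<le> C * majorant P X"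
    proof cases
      case small
      have "sqrt (1 + \<bar>X\<bar>) * (1 + \<bar>X\<bar> / P) \<le> 2 * 2"
      proof (rule mult_mono)
        have "sqrt (1 + \<bar>X\<bar>) \<le> sqrt 4" using small by (intro real_sqrt_le_mono) auto
        thus "sqrt (1 + \<bar>X\<bar>) \<le> 2" by simp
        show "1 + \<bar>X\<bar> / P \<le> 2" using small P by (simp add: field_simps)
      qed (use P in auto)
      hence "1 / 4 \<le> majorant P X" unfolding majorant_def using P
        by (intro divide_left_mono) (auto intro!: mult_pos_pos add_pos_nonneg)
      hence "100 * (1 / 4) \<le> C * majorant P X" using Cge by (intro mult_mono) auto
      thus ?thesis using osc_kernel_trivial[OF U, of a X S] by simp
    next
      case ns
      have "norm (osc_kernel a X S U) \<le> CN / X\<^sup>2"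
        using ns U by (intro CN(2)) (auto simp: c_def)
      also have "\<dots> \<le> 4 * CN * majorant P X"
      proof -
        have "sqrt (1 + \<bar>X\<bar>) * (1 + \<bar>X\<bar> / P) \<le> (1 + \<bar>X\<bar>) * (1 + \<bar>X\<bar>)"
        proof (rule mult_mono)
          show "sqrt (1 + \<bar>X\<bar>) \<le> 1 + \<bar>X\<bar>"
            by (rule real_le_lsqrt) (auto simp: power2_eq_square algebra_simps)
          have "\<bar>X\<bar> / P \<le> \<bar>X\<bar> / 1" using P by (intro divide_left_mono) auto
          thus "1 + \<bar>X\<bar> / P \<le> 1 + \<bar>X\<bar>" by simp
        qed (use P in auto)
        also have "\<dots> \<le> (2 * \<bar>X\<bar>) * (2 * \<bar>X\<bar>)" using ns by (intro mult_mono) auto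
        also have "\<dots> = 4 * X\<^sup>2" by (simp add: power2_eq_square)
        finally have "1 / (4 * X\<^sup>2) \<le> majorant P X" unfolding majorant_def using P ns
          by (intro divide_left_mono) (auto intro!: mult_pos_pos add_pos_nonneg)
        hence "4 * CN * (1 / (4 * X\<^sup>2)) \<le> 4 * CN * majorant P X" using CN by (intro mult_left_mono) auto
        thus ?thesis by simp
      qed
      also have "\<dots> \<le> C * majorant P X" using Cge k0 by (intro mult_right_mono) auto
      finally show ?thesis .
    next
      case st
      have S0: "S \<noteq> 0" using st by auto
      hence \<kappa>0: "\<kappa> > 0" using \<kappa> by (cases "\<kappa> = 0") (auto simp: S_def)
      define m where "m = max t t'"
      have m: "m > 0" using t by (simp add: m_def)
      have "\<bar>S\<bar> = \<kappa> * \<bar>t - t'\<bar>" using \<kappa> by (simp add: S_def abs_mult)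
      also have "\<dots> \<le> \<kappa> * m" using \<kappa> t by (intro mult_left_mono) (auto simp: m_def)
      finally have "c * \<bar>S\<bar> \<le> c * (\<kappa> * m)" using c by (intro mult_left_mono) auto
      with st have Xm: "\<bar>X\<bar> \<le> c * (\<kappa> * m)" by linarith
      have "m powr \<gamma> \<le> t powr \<gamma> + t' powr \<gamma>" by (simp add: m_def max_def)
      hence "\<kappa> * m powr \<gamma> \<le> U" unfolding U_def using \<kappa> by (rule mult_left_mono)
      hence "(\<kappa> * m powr \<gamma>) powr (1 / \<gamma>) \<le> U powr (1 / \<gamma>)" using \<kappa> assms by (intro powr_mono2) auto
      also have "(\<kappa> * m powr \<gamma>) powr (1 / \<gamma>) = \<kappa> powr (1 / \<gamma>) * m"
        using \<kappa> m assms by (simp add: powr_mult powr_powr)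
      finally have Um: "\<kappa> powr (1 / \<gamma>) * m \<le> U powr (1 / \<gamma>)" .
      \<comment> \<open>The first factor combines with m into U^(1/\<gamma>); the second is where
        the critical power of the frequency appears.\<close>
      have "\<kappa> = \<kappa> powr (1 / \<gamma>) * \<kappa> powr (1 - 1 / \<gamma>)" using \<kappa>0 by (simp flip: powr_add)
      also have "\<dots> \<le> \<kappa> powr (1 / \<gamma>) * P" by (intro mult_left_mono) (auto simp: P_def)
      finally have "\<kappa> * m \<le> \<kappa> powr (1 / \<gamma>) * P * m" using m by (intro mult_right_mono) auto
      also have "\<dots> = (\<kappa> powr (1 / \<gamma>) * m) * P" by simp
      also have "\<dots> \<le> U powr (1 / \<gamma>) * P" using Um P by (intro mult_right_mono) auto
      finally have "c * (\<kappa> * m) \<le> c * (U powr (1 / \<gamma>) * P)" using c by (intro mult_left_mono) auto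
      with Xm have "\<bar>X\<bar> \<le> c * (U powr (1 / \<gamma>) * P)" by linarith
      hence "\<bar>X\<bar> / P \<le> c * U powr (1 / \<gamma>)" using P by (simp add: field_simps)
      moreover have "U powr (1 / \<gamma>) \<le> (1 + U) powr (1 / \<gamma>)" using U assms by (intro powr_mono2) auto
      hence "c * U powr (1 / \<gamma>) \<le> c * (1 + U) powr (1 / \<gamma>)" using c by (intro mult_left_mono) auto
      moreover have "1 \<le> (1 + U) powr (1 / \<gamma>)" using U assms by (intro ge_one_powr_ge_zero) auto
      ultimately have XP: "1 + \<bar>X\<bar> / P \<le> (1 + c) * (1 + U) powr (1 / \<gamma>)" by (simp add: algebra_simps)
      define E where "E = (1 + U) * exp (- (U * 3 powr (-a)))"
      have E0: "E \<ge> 0" using U by (simp add: E_def)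
      have "(1 + \<bar>X\<bar> / P) * E \<le> (1 + c) * (1 + U) powr (1 / \<gamma>) * E" using XP E0 by (rule mult_right_mono)
      also have "\<dots> = (1 + c) * ((1 + U) powr (1 + 1 / \<gamma>) * exp (- (3 powr (-a) * U)))"
        using U by (simp add: E_def powr_add mult_ac)
      also have "\<dots> \<le> (1 + c) * CE" using c CE(2)[OF U] by (intro mult_left_mono) auto
      finally have EP: "(1 + \<bar>X\<bar> / P) * E \<le> (1 + c) * CE" .
      have "1 + \<bar>X\<bar> \<le> 2 * c * \<bar>S\<bar>" using st by linarith
      hence "sqrt (1 + \<bar>X\<bar>) \<le> sqrt (2 * c) * sqrt \<bar>S\<bar>"
        unfolding real_sqrt_mult[symmetric] by (rule real_sqrt_le_mono)
      hence XS: "1 / sqrt \<bar>S\<bar> \<le> sqrt (2 * c) / sqrt (1 + \<bar>X\<bar>)" using S0 by (simp add: field_simps)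
      have "norm (osc_kernel a X S U) \<le> CS * E / sqrt \<bar>S\<bar>" unfolding E_def by (rule CS(2)[OF U S0])
      also have "\<dots> = CS * E * (1 / sqrt \<bar>S\<bar>)" by simp
      also have "\<dots> \<le> CS * E * (sqrt (2 * c) / sqrt (1 + \<bar>X\<bar>))"
        using XS CS(1) E0 by (intro mult_left_mono) auto
      also have "\<dots> = CS * sqrt (2 * c) * ((1 + \<bar>X\<bar> / P) * E) * majorant P X"
      proof -
        have "1 + \<bar>X\<bar> / P > 0" using P by (intro add_pos_nonneg) auto
        thus ?thesis by (simp add: majorant_def)
      qed
      also have "\<dots> \<le> CS * sqrt (2 * c) * ((1 + c) * CE) * majorant P X"
        using EP CS(1) c k0 by (intro mult_right_mono mult_left_mono) auto
      also have "\<dots> \<le> C * majorant P X" using Cge k0 by (intro mult_right_mono) auto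
      finally show ?thesis .
    qed
    thus ?thesis by (simp add: S_def U_def P_def)
  qed
  show ?thesis by (rule that[OF _ main]) (use Cge in auto)
qed

text \<open>The dual argument runs on finite measures; this removes the truncation in x, since its
  bound does not depend on the interval.\<close>

lemma nn_integral_le_if_interval_le:
  fixes f :: "real \<Rightarrow> ennreal"
  assumes [measurable]: "f \<in> borel_measurable borel"
    and le: "\<And>n::nat. (\<integral>\<^sup>+x. f x * indicator {- real n..real n} x \<partial>lborel) \<le> R"
  shows "(\<integral>\<^sup>+x. f x \<partial>lborel) \<le> R"
proof -
  have sup: "(SUP n. f x * indicator {- real n..real n} x) = f x" for x
  proof (rule antisym)
    show "(SUP n. f x * indicator {- real n..real n} x) \<le> f x"
      by (rule SUP_least) (auto simp: indicator_def)
    obtain n where "\<bar>x\<bar> \<le> real n" using real_arch_simple by blast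
    hence "f x = f x * indicator {- real n..real n} x" by (auto simp: indicator_def)
    thus "f x \<le> (SUP n. f x * indicator {- real n..real n} x)"
      using SUP_upper[of n UNIV "\<lambda>n. f x * indicator {- real n..real n} x"] by simp
  qed
  have "(\<integral>\<^sup>+x. f x \<partial>lborel) = (\<integral>\<^sup>+x. (SUP n. f x * indicator {- real n..real n} x) \<partial>lborel)"
    unfolding sup ..
  also have "\<dots> = (SUP n. \<integral>\<^sup>+x. f x * indicator {- real n..real n} x \<partial>lborel)"
    by (rule nn_integral_monotone_convergence_SUP)
       (auto simp: incseq_def le_fun_def indicator_def intro!: mult_left_mono)
  also have "\<dots> \<le> R" by (rule SUP_least) (rule le)
  finally show ?thesis .
qed

section \<open>The linearised estimate at frequencies of size 1\<close>

lemma borel_measurable_osc [measurable (raw)]: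
  assumes [measurable]: "f \<in> borel_measurable L" "g \<in> borel_measurable L" "h \<in> borel_measurable L" "k \<in> borel_measurable L"
  shows "(\<lambda>x. osc a (f x) (g x) (h x) (k x)) \<in> borel_measurable L"
  unfolding osc_def by measurable

lemma borel_measurable_bump [measurable]: "bump \<in> borel_measurable borel"
  unfolding bump_def[abs_def] by measurable

lemma osc_mult_cnj: "osc a X S U \<eta> * cnj (osc a X' S' U' \<eta>) = osc a (X - X') (S - S') (U + U') \<eta>"
  unfolding osc_def exp_cnj mult_exp_exp by (simp add: algebra_simps)

text \<open>Here \<open>\<kappa>\<close> is \<open>N\<^sup>a\<close> for the frequency block at \<open>N\<close>, and \<open>\<kappa> = 0\<close> for low frequencies, where the
  junk value \<open>0 powr p = 0\<close> makes the constant equal to \<open>C\<close>.\<close>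
locale unit_scale_estimate =
  fixes a \<gamma> C :: real
  assumes a: "a > 1" and \<gamma>: "\<gamma> > 0" and C: "C > 0"
    and unit: "\<And>T \<kappa> h Ch. T \<in> borel_measurable borel \<Longrightarrow> (\<And>x. T x > 0) \<Longrightarrow> \<kappa> \<ge> 0 \<Longrightarrow>
       h \<in> borel_measurable borel \<Longrightarrow> (\<And>\<eta>. norm (h \<eta>) \<le> Ch) \<Longrightarrow>
       (\<integral>\<^sup>+X. ennreal ((norm (LINT \<eta>:{1..2}|lborel. h \<eta> * osc a X (\<kappa> * T X) (\<kappa> * T X powr \<gamma>) \<eta>))\<^sup>2) \<partial>lborel)
         \<le> ennreal (C * max 1 (\<kappa> powr ((1 - 1 / \<gamma>) / 2))) * (\<integral>\<^sup>+\<eta>. ennreal ((norm (h \<eta>))\<^sup>2) * indicator {1..2} \<eta> \<partial>lborel)"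

text \<open>The row bound of the \<open>T T\<^sup>*\<close> kernel is the mass of the majorant,
  because its argument is the difference X - X' alone. That mass is of order sqrt P, which halves
  the exponent 1 - 1/\<gamma>.\<close>

lemma unit_scale_bound:
  assumes "a > 1" "\<gamma> > 0"
  obtains C where "unit_scale_estimate a \<gamma> C"
proof -
  obtain CK where CK: "CK > 0"
    "\<And>X \<kappa> t t'. \<kappa> \<ge> 0 \<Longrightarrow> t > 0 \<Longrightarrow> t' > 0 \<Longrightarrow>
       norm (osc_kernel a X (\<kappa> * (t - t')) (\<kappa> * (t powr \<gamma> + t' powr \<gamma>)))
         \<le> CK * majorant (max 1 (\<kappa> powr (1 - 1 / \<gamma>))) X"
    using osc_kernel_majorised[OF assms] by blast
  define C where "C = CK * (4 * pi)"
  have main: "(\<integral>\<^sup>+X. ennreal ((norm (LINT \<eta>:{1..2}|lborel. h \<eta> * osc a X (\<kappa> * T X) (\<kappa> * T X powr \<gamma>) \<eta>))\<^sup>2) \<partial>lborel)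
         \<le> ennreal (C * max 1 (\<kappa> powr ((1 - 1 / \<gamma>) / 2))) * (\<integral>\<^sup>+\<eta>. ennreal ((norm (h \<eta>))\<^sup>2) * indicator {1..2} \<eta> \<partial>lborel)"
    if T [measurable]: "T \<in> borel_measurable borel" and T0: "\<And>x. T x > 0" and \<kappa>: "\<kappa> \<ge> 0"
      and h [measurable]: "h \<in> borel_measurable borel" and Ch: "\<And>\<eta>. norm (h \<eta>) \<le> Ch" for T \<kappa> h Ch
  proof (rule nn_integral_le_if_interval_le)
    show "(\<lambda>X. ennreal ((norm (LINT \<eta>:{1..2}|lborel. h \<eta> * osc a X (\<kappa> * T X) (\<kappa> * T X powr \<gamma>) \<eta>))\<^sup>2)) \<in> borel_measurable borel"
      unfolding set_lebesgue_integral_def by measurable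
    fix n :: nat
    define P where "P = max 1 (\<kappa> powr (1 - 1 / \<gamma>))"
    define B where "B = CK * (4 * pi * sqrt P)"
    have P: "P \<ge> 1" by (simp add: P_def)
    have B: "B > 0" using CK P by (simp add: B_def)
    have "sqrt P = max 1 (\<kappa> powr ((1 - 1 / \<gamma>) / 2))"
    proof -
      have "sqrt (\<kappa> powr (1 - 1 / \<gamma>)) = \<kappa> powr ((1 - 1 / \<gamma>) / 2)"
        using powr_powr[of \<kappa> "1 - 1/\<gamma>" "1/2"] by (simp add: powr_half_sqrt)
      note this [symmetric]
      thus ?thesis unfolding P_def by (simp add: max_def)
    qed
    hence Beq: "C * max 1 (\<kappa> powr ((1 - 1 / \<gamma>) / 2)) = B" by (simp add: B_def C_def)
    define M where "M = restrict_space lborel {- real n..real n}"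
    define N where "N = restrict_space lborel {1/2..3::real}"
    \<comment> \<open>The cutoff is moved from g into e: g e is still h times the oscillation on
      [1, 2], while the product of e with its conjugate carries the squared cutoff. Dividing by the
      cutoff in g is harmless, since it is at least 1 on [1, 2].\<close>
    define e where "e = (\<lambda>X \<eta>. indicator {1/2..3} \<eta> * complex_of_real (bump \<eta>) * osc a X (\<kappa> * T X) (\<kappa> * T X powr \<gamma>) \<eta>)"
    define g where "g = (\<lambda>\<eta>. indicator {1..2} \<eta> * h \<eta> / of_real (bump \<eta>))"
    have Ch0: "Ch \<ge> 0" using Ch norm_ge_zero order_trans by blast
    have fin: "finite_measure M" "finite_measure N"
      by (auto intro!: finite_measureI simp: M_def N_def space_restrict_space emeasure_restrict_space)
    have bump1: "bump \<eta> \<ge> 1" if "\<eta> \<in> {1..2}" for \<eta>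
    proof -
      have "1 * 1 \<le> (2 * \<eta> - 1) * (3 - \<eta>)" using that by (intro mult_mono) auto
      thus ?thesis by (simp add: bump_def)
    qed
    have gle: "norm (g \<eta>) \<le> norm (h \<eta>) * indicator {1..2} \<eta>" for \<eta>
      using bump1[of \<eta>] mult_left_mono[of 1 "bump \<eta>" "norm (h \<eta>)"]
      by (auto simp: g_def norm_divide norm_mult indicator_def field_simps)
    have gC: "norm (g \<eta>) \<le> Ch" for \<eta> using gle[of \<eta>] Ch[of \<eta>] Ch0 by (cases "\<eta> \<in> {1..2}") auto
    have eC: "norm (e X \<eta>) \<le> 25/8" for X \<eta>
    proof (cases "\<eta> \<in> {1/2..3}")
      case True
      have "norm (complex_of_real (bump \<eta>)) * norm (osc a X (\<kappa> * T X) (\<kappa> * T X powr \<gamma>) \<eta>) \<le> 25/8 * 1"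
        using bump_bounds[OF True] \<kappa> by (intro mult_mono) (auto simp: norm_osc)
      thus ?thesis using True by (simp add: e_def norm_mult)
    qed (simp add: e_def)
    have TT: "(\<integral>X. (norm (\<integral>\<eta>. g \<eta> * e X \<eta> \<partial>N))\<^sup>2 \<partial>M) \<le> B * (\<integral>\<eta>. (norm (g \<eta>))\<^sup>2 \<partial>N)"
    proof (rule TTstar_bound[OF fin _ _ eC gC B])
      have eb: "case_prod e \<in> borel_measurable (borel \<Otimes>\<^sub>M borel)"
        unfolding e_def by measurable
      have "(\<lambda>x. x) \<in> M \<rightarrow>\<^sub>M borel" "(\<lambda>x. x) \<in> N \<rightarrow>\<^sub>M borel"
        unfolding M_def N_def by (rule measurable_restrict_space1, simp)+
      hence "(\<lambda>z. (fst z, snd z)) \<in> M \<Otimes>\<^sub>M N \<rightarrow>\<^sub>M borel \<Otimes>\<^sub>M borel"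
        by (intro measurable_Pair measurable_compose[OF measurable_fst] measurable_compose[OF measurable_snd])
      from measurable_compose[OF this eb] show "case_prod e \<in> borel_measurable (M \<Otimes>\<^sub>M N)"
        by simp
      show "g \<in> borel_measurable N" unfolding g_def N_def by (rule measurable_restrict_space1) measurable
      fix X assume "X \<in> space M"
      have ker: "(\<integral>\<eta>. e X \<eta> * cnj (e X' \<eta>) \<partial>N) = osc_kernel a (X - X') (\<kappa> * (T X - T X')) (\<kappa> * (T X powr \<gamma> + T X' powr \<gamma>))" for X'
      proof -
        let ?J = "\<lambda>\<eta>. osc a (X - X') (\<kappa> * (T X - T X')) (\<kappa> * (T X powr \<gamma> + T X' powr \<gamma>)) \<eta> * complex_of_real ((bump \<eta>)\<^sup>2)"
        have eJ: "indicator {1/2..3} \<eta> *\<^sub>R (e X \<eta> * cnj (e X' \<eta>)) = indicator {1/2..3} \<eta> *\<^sub>R ?J \<eta>" for \<eta>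
          unfolding right_diff_distrib distrib_left osc_mult_cnj[symmetric]
          by (simp add: e_def indicator_def power2_eq_square mult_ac)
        have "(\<integral>\<eta>. e X \<eta> * cnj (e X' \<eta>) \<partial>N) = (LINT \<eta>:{1/2..3}|lborel. ?J \<eta>)"
          unfolding N_def set_lebesgue_integral_def
          by (subst integral_restrict_space) (auto simp: eJ)
        also have "\<dots> = integral {1/2..3} ?J"
          by (intro set_borel_integral_eq_integral borel_integrable_atLeastAtMost' continuous_intros) auto
        finally show ?thesis by (simp add: osc_kernel_def)
      qed
      have "(\<integral>\<^sup>+X'. ennreal (norm (\<integral>\<eta>. e X \<eta> * cnj (e X' \<eta>) \<partial>N)) \<partial>M) \<le> (\<integral>\<^sup>+X'. ennreal (CK * majorant P (X - X')) \<partial>M)"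
        unfolding ker P_def using CK(2) T0 \<kappa> by (intro nn_integral_mono ennreal_leI) auto
      also have "\<dots> \<le> (\<integral>\<^sup>+X'. ennreal (CK * majorant P (X - X')) \<partial>lborel)"
        unfolding M_def by (subst nn_integral_restrict_space) (auto intro!: nn_integral_mono simp: indicator_def)
      also have "\<dots> = (\<integral>\<^sup>+u. ennreal (CK * majorant P u) \<partial>lborel)"
        using nn_integral_real_affine[of "\<lambda>u. ennreal (CK * majorant P u)" "-1" X] by simp
      also have "\<dots> = ennreal CK * (\<integral>\<^sup>+u. ennreal (majorant P u) \<partial>lborel)"
        using CK P by (subst nn_integral_cmult[symmetric]) (auto simp: ennreal_mult majorant_nonneg)
      also have "\<dots> \<le> ennreal CK * ennreal (4 * pi * sqrt P)"
        using nn_integral_majorant[OF P] by (intro mult_left_mono) auto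
      also have "\<dots> = ennreal B" using CK P by (simp add: B_def ennreal_mult)
      finally show "(\<integral>\<^sup>+X'. ennreal (norm (\<integral>\<eta>. e X \<eta> * cnj (e X' \<eta>) \<partial>N)) \<partial>M) \<le> ennreal B" .
    qed
    have ge: "(\<integral>\<eta>. g \<eta> * e X \<eta> \<partial>N) = (LINT \<eta>:{1..2}|lborel. h \<eta> * osc a X (\<kappa> * T X) (\<kappa> * T X powr \<gamma>) \<eta>)" for X
      unfolding N_def set_lebesgue_integral_def
      using bump1 by (subst integral_restrict_space)
         (force simp: e_def g_def indicator_def intro!: Bochner_Integration.integral_cong)+
    interpret M: finite_measure M by (rule fin)
    interpret N: finite_measure N by (rule fin)
    have ig: "integrable N (\<lambda>\<eta>. (norm (g \<eta>))\<^sup>2)"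
    proof (rule N.integrable_const_bound[where B = "Ch\<^sup>2"])
      show "AE \<eta> in N. norm ((norm (g \<eta>))\<^sup>2) \<le> Ch\<^sup>2" by (auto intro!: power_mono gC)
      show "(\<lambda>\<eta>. (norm (g \<eta>))\<^sup>2) \<in> borel_measurable N" unfolding g_def N_def by (rule measurable_restrict_space1) measurable
    qed
    have iF: "integrable M (\<lambda>X. (norm (\<integral>\<eta>. g \<eta> * e X \<eta> \<partial>N))\<^sup>2)"
    proof (rule M.integrable_const_bound[where B = "(Ch * (25/8) * measure N (space N))\<^sup>2"])
      have "norm (g \<eta> * e X \<eta>) \<le> Ch * (25/8)" for X \<eta>
        unfolding norm_mult using gC eC Ch0 by (intro mult_mono) auto
      hence "norm (\<integral>\<eta>. g \<eta> * e X \<eta> \<partial>N) \<le> Ch * (25/8) * measure N (space N)" for X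
        by (intro N.norm_integral_bounded)
      thus "AE X in M. norm ((norm (\<integral>\<eta>. g \<eta> * e X \<eta> \<partial>N))\<^sup>2) \<le> (Ch * (25/8) * measure N (space N))\<^sup>2"
        by (auto intro!: power_mono)
      show "(\<lambda>X. (norm (\<integral>\<eta>. g \<eta> * e X \<eta> \<partial>N))\<^sup>2) \<in> borel_measurable M"
        unfolding ge set_lebesgue_integral_def M_def by (rule measurable_restrict_space1) measurable
    qed
    have "(\<integral>\<^sup>+X. ennreal ((norm (LINT \<eta>:{1..2}|lborel. h \<eta> * osc a X (\<kappa> * T X) (\<kappa> * T X powr \<gamma>) \<eta>))\<^sup>2) * indicator {- real n..real n} X \<partial>lborel)
        = (\<integral>\<^sup>+X. ennreal ((norm (\<integral>\<eta>. g \<eta> * e X \<eta> \<partial>N))\<^sup>2) \<partial>M)"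
      unfolding ge M_def by (subst nn_integral_restrict_space) auto
    also have "\<dots> = ennreal (\<integral>X. (norm (\<integral>\<eta>. g \<eta> * e X \<eta> \<partial>N))\<^sup>2 \<partial>M)"
      by (rule nn_integral_eq_integral[OF iF]) auto
    also have "\<dots> \<le> ennreal (B * (\<integral>\<eta>. (norm (g \<eta>))\<^sup>2 \<partial>N))" by (rule ennreal_leI[OF TT])
    also have "\<dots> = ennreal B * (\<integral>\<^sup>+\<eta>. ennreal ((norm (g \<eta>))\<^sup>2) \<partial>N)"
      using B by (subst nn_integral_eq_integral[OF ig]) (auto simp: ennreal_mult)
    also have "(\<integral>\<^sup>+\<eta>. ennreal ((norm (g \<eta>))\<^sup>2) \<partial>N) \<le> (\<integral>\<^sup>+\<eta>. ennreal ((norm (h \<eta>))\<^sup>2) * indicator {1..2} \<eta> \<partial>lborel)"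
      unfolding N_def
    proof (subst nn_integral_restrict_space; (intro nn_integral_mono)?)
      fix \<eta>
      have "(norm (g \<eta>))\<^sup>2 \<le> (norm (h \<eta>) * indicator {1..2} \<eta>)\<^sup>2" by (intro power_mono gle) auto
      thus "ennreal ((norm (g \<eta>))\<^sup>2) * indicator {1 / 2..3} \<eta> \<le> ennreal ((norm (h \<eta>))\<^sup>2) * indicator {1..2} \<eta>"
        by (auto simp: indicator_def intro: ennreal_leI split: if_splits)
    qed auto
    finally show "(\<integral>\<^sup>+X. ennreal ((norm (LINT \<eta>:{1..2}|lborel. h \<eta> * osc a X (\<kappa> * T X) (\<kappa> * T X powr \<gamma>) \<eta>))\<^sup>2) * indicator {- real n..real n} X \<partial>lborel)
       \<le> ennreal (C * max 1 (\<kappa> powr ((1 - 1 / \<gamma>) / 2))) * (\<integral>\<^sup>+\<eta>. ennreal ((norm (h \<eta>))\<^sup>2) * indicator {1..2} \<eta> \<partial>lborel)"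
      unfolding Beq using mult_left_mono by fastforce
  qed
  have "C > 0" using CK by (simp add: C_def)
  with assms have "unit_scale_estimate a \<gamma> C" using main by (rule unit_scale_estimate.intro)
  thus ?thesis by (rule that)
qed

section \<open>Summing over the frequency blocks\<close>

text \<open>Cauchy-Schwarz with summable weights c stands in for orthogonality of the summands,
  which is lost once each point x chooses its own time.\<close>

lemma nn_integral_square_sums:
  fixes F :: "nat \<Rightarrow> 'a \<Rightarrow> complex" and G :: "'a \<Rightarrow> complex" and c :: "nat \<Rightarrow> real"
  assumes [measurable]: "\<And>j. F j \<in> borel_measurable M"
    and sums: "\<And>x. x \<in> space M \<Longrightarrow> (\<lambda>j. F j x) sums G x"
    and c: "\<And>j. c j > 0" "summable c"
  shows "(\<integral>\<^sup>+x. ennreal ((norm (G x))\<^sup>2) \<partial>M)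
    \<le> ennreal (suminf c) * (\<Sum>j. ennreal (1 / c j) * (\<integral>\<^sup>+x. ennreal ((norm (F j x))\<^sup>2) \<partial>M))"
proof -
  have pt: "ennreal ((norm (G x))\<^sup>2) \<le> ennreal (suminf c) * (\<Sum>j. ennreal (1 / c j) * ennreal ((norm (F j x))\<^sup>2))"
    if x: "x \<in> space M" for x
  proof (rule LIMSEQ_le_const2)
    show "(\<lambda>n. ennreal ((norm (\<Sum>j<n. F j x))\<^sup>2)) \<longlonglongrightarrow> ennreal ((norm (G x))\<^sup>2)"
      using sums[OF x] unfolding sums_def by (intro tendsto_intros)
    have "ennreal ((norm (\<Sum>j<n. F j x))\<^sup>2) \<le> ennreal (suminf c) * (\<Sum>j. ennreal (1 / c j) * ennreal ((norm (F j x))\<^sup>2))" for n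
    proof -
      have "(norm (\<Sum>j<n. F j x))\<^sup>2 \<le> (\<Sum>j<n. norm (F j x))\<^sup>2"
        by (intro power_mono norm_sum) auto
      also have "\<dots> = (\<Sum>j<n. sqrt (c j) * (norm (F j x) / sqrt (c j)))\<^sup>2"
        using c(1) by (simp add: less_imp_neq[THEN not_sym])
      also have "\<dots> \<le> (\<Sum>j<n. (sqrt (c j))\<^sup>2) * (\<Sum>j<n. (norm (F j x) / sqrt (c j))\<^sup>2)"
        by (rule Cauchy_Schwarz_ineq_sum)
      also have "\<dots> = (\<Sum>j<n. c j) * (\<Sum>j<n. 1 / c j * (norm (F j x))\<^sup>2)"
        using c(1) by (simp add: power_divide less_imp_le)
      also have "\<dots> \<le> suminf c * (\<Sum>j<n. 1 / c j * (norm (F j x))\<^sup>2)"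
        using c by (intro mult_right_mono sum_le_suminf sum_nonneg) (auto intro: less_imp_le intro!: divide_nonneg_pos)
      finally have "ennreal ((norm (\<Sum>j<n. F j x))\<^sup>2) \<le> ennreal (suminf c * (\<Sum>j<n. 1 / c j * (norm (F j x))\<^sup>2))"
        by (rule ennreal_leI)
      also have "\<dots> = ennreal (suminf c) * (\<Sum>j<n. ennreal (1 / c j) * ennreal ((norm (F j x))\<^sup>2))"
      proof -
        have "(\<Sum>j<n. ennreal (1 / c j) * ennreal ((norm (F j x))\<^sup>2)) = ennreal (\<Sum>j<n. 1 / c j * (norm (F j x))\<^sup>2)"
          using c(1) by (subst sum_ennreal[symmetric]) (auto intro!: sum.cong divide_nonneg_pos simp: ennreal_mult[symmetric] less_imp_le)
        thus ?thesis
          using c by (simp only:) (intro ennreal_mult suminf_nonneg sum_nonneg, auto intro: less_imp_le divide_nonneg_pos)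
      qed
      also have "\<dots> \<le> ennreal (suminf c) * (\<Sum>j. ennreal (1 / c j) * ennreal ((norm (F j x))\<^sup>2))"
        by (intro mult_left_mono sum_le_suminf) auto
      finally show ?thesis .
    qed
    thus "\<exists>N. \<forall>n\<ge>N. ennreal ((norm (\<Sum>j<n. F j x))\<^sup>2) \<le> ennreal (suminf c) * (\<Sum>j. ennreal (1 / c j) * ennreal ((norm (F j x))\<^sup>2))"
      by blast
  qed
  have "(\<integral>\<^sup>+x. ennreal ((norm (G x))\<^sup>2) \<partial>M) \<le> (\<integral>\<^sup>+x. ennreal (suminf c) * (\<Sum>j. ennreal (1 / c j) * ennreal ((norm (F j x))\<^sup>2)) \<partial>M)"
    by (rule nn_integral_mono[OF pt])
  also have "\<dots> = ennreal (suminf c) * (\<integral>\<^sup>+x. (\<Sum>j. ennreal (1 / c j) * ennreal ((norm (F j x))\<^sup>2)) \<partial>M)"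
    by (rule nn_integral_cmult) measurable
  also have "(\<integral>\<^sup>+x. (\<Sum>j. ennreal (1 / c j) * ennreal ((norm (F j x))\<^sup>2)) \<partial>M)
      = (\<Sum>j. \<integral>\<^sup>+x. ennreal (1 / c j) * ennreal ((norm (F j x))\<^sup>2) \<partial>M)"
    by (rule nn_integral_suminf) measurable
  also have "\<dots> = (\<Sum>j. ennreal (1 / c j) * (\<integral>\<^sup>+x. ennreal ((norm (F j x))\<^sup>2) \<partial>M))"
    by (intro suminf_cong nn_integral_cmult) measurable
  finally show ?thesis .
qed

lemma set_lebesgue_integral_sums:
  fixes f :: "'a \<Rightarrow> 'b :: {banach, second_countable_topology}"
  assumes A: "\<And>i::nat. A i \<in> sets M" and disj: "disjoint_family A"
    and int: "set_integrable M (\<Union>i. A i) f"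
  shows "(\<lambda>i. LINT x:A i|M. f x) sums (LINT x:(\<Union>i. A i)|M. f x)"
proof -
  have U: "(\<lambda>n. LINT x:(\<Union>i<n. A i)|M. f x) \<longlonglongrightarrow> (LINT x:(\<Union>n. \<Union>i<n. A i)|M. f x)"
  proof (rule set_integral_cont_up)
    show "incseq (\<lambda>n. \<Union>i<n. A i)" by (fastforce simp: incseq_def)
    have "(\<Union>n. \<Union>i<n. A i) = (\<Union>i. A i)" by auto
    thus "set_integrable M (\<Union>n. \<Union>i<n. A i) f" using int by simp
  qed (use A in auto)
  have "(LINT x:(\<Union>i<n. A i)|M. f x) = (\<Sum>i<n. LINT x:A i|M. f x)" for n
  proof (rule set_integral_finite_Union)
    show "disjoint_family_on A {..<n}" using disj by (auto simp: disjoint_family_on_def)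
    show "set_integrable M (A i) f" for i by (rule set_integrable_subset[OF int]) (use A in auto)
  qed (use A in auto)
  moreover have "(\<Union>n. \<Union>i<n. A i) = (\<Union>i. A i)" by auto
  ultimately show ?thesis using U by (simp add: sums_def)
qed

lemma osc_rescale:
  assumes "N \<ge> 0" "\<eta> \<ge> 0"
  shows "osc a x S U (N * \<eta>) = osc a (N * x) (N powr a * S) (N powr a * U) \<eta>"
  using assms by (simp add: osc_def powr_mult mult_ac)

context unit_scale_estimate
begin

text \<open>Dilation by N. The prefactor N^2 is used up by the two changes of variable, one in x and
  one in \<xi>, so only the constant at unit scale survives. The times are left unscaled: the whole
  effect on phase and damping is the common factor \<kappa> = N^a.\<close>

lemma dyadic_piece:
  assumes T [measurable]: "T \<in> borel_measurable borel" and T0: "\<And>x. T x > 0" and N: "N > 0"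
    and h [measurable]: "h \<in> borel_measurable borel" and Ch: "\<And>\<eta>. norm (h \<eta>) \<le> Ch"
  shows "(\<integral>\<^sup>+x. ennreal ((norm (LINT \<xi>:{N..<2 * N}|lborel. h \<xi> * osc a x (T x) (T x powr \<gamma>) \<xi>))\<^sup>2) \<partial>lborel)
         \<le> ennreal (C * max 1 (N powr (a * (1 - 1 / \<gamma>) / 2))) * (\<integral>\<^sup>+\<xi>. ennreal ((norm (h \<xi>))\<^sup>2) * indicator {N..<2 * N} \<xi> \<partial>lborel)"
proof -
  define \<kappa> where "\<kappa> = N powr a"
  \<comment> \<open>Transporting the choice of times along the dilation is admissible because the
    unit-scale estimate allows any positive measurable function.\<close>
  define T' where "T' = (\<lambda>X. T (X / N))"
  define g where "g = (\<lambda>\<eta>. h (N * \<eta>) * indicator {1..<2} \<eta>)"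
  define W where "W = (\<lambda>X. LINT \<eta>:{1..2}|lborel. g \<eta> * osc a X (\<kappa> * T' X) (\<kappa> * T' X powr \<gamma>) \<eta>)"
  have [measurable]: "T' \<in> borel_measurable borel" "g \<in> borel_measurable borel"
    unfolding T'_def g_def by measurable
  have Wm [measurable]: "W \<in> borel_measurable borel" unfolding W_def set_lebesgue_integral_def by measurable
  have g: "norm (g \<eta>) \<le> Ch" for \<eta>
    using Ch[of "N * \<eta>"] order_trans[OF norm_ge_zero Ch] by (auto simp: g_def norm_mult indicator_def)
  have FW: "(LINT \<xi>:{N..<2 * N}|lborel. h \<xi> * osc a x (T x) (T x powr \<gamma>) \<xi>) = of_real N * W (N * x)" for x
  proof -
    have ind: "indicator {N..<2 * N} (N * \<eta>) = (indicator {1..<2} \<eta> :: real)" for \<eta>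
      using N by (auto simp: indicator_def)
    have "(LINT \<xi>:{N..<2 * N}|lborel. h \<xi> * osc a x (T x) (T x powr \<gamma>) \<xi>)
       = N *\<^sub>R (\<integral>\<eta>. indicator {N..<2 * N} (N * \<eta>) *\<^sub>R (h (N * \<eta>) * osc a x (T x) (T x powr \<gamma>) (N * \<eta>)) \<partial>lborel)"
      unfolding set_lebesgue_integral_def using N by (subst lborel_integral_real_affine[where c = N and t = 0]) auto
    also have "(\<integral>\<eta>. indicator {N..<2 * N} (N * \<eta>) *\<^sub>R (h (N * \<eta>) * osc a x (T x) (T x powr \<gamma>) (N * \<eta>)) \<partial>lborel) = W (N * x)"
      unfolding W_def set_lebesgue_integral_def
    proof (intro Bochner_Integration.integral_cong refl)
      fix \<eta> :: real
      show "indicator {N..<2 * N} (N * \<eta>) *\<^sub>R (h (N * \<eta>) * osc a x (T x) (T x powr \<gamma>) (N * \<eta>)) =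
            indicator {1..2} \<eta> *\<^sub>R (g \<eta> * osc a (N * x) (\<kappa> * T' (N * x)) (\<kappa> * T' (N * x) powr \<gamma>) \<eta>)"
      proof (cases "\<eta> \<in> {1..<2}")
        case True
        thus ?thesis using N by (simp add: ind g_def osc_rescale T'_def \<kappa>_def)
      qed (simp add: ind g_def)
    qed
    finally show ?thesis by (simp add: scaleR_conv_of_real)
  qed
  have \<kappa>eq: "\<kappa> powr ((1 - 1 / \<gamma>) / 2) = N powr (a * (1 - 1 / \<gamma>) / 2)"
    by (simp add: \<kappa>_def powr_powr)
  have "(\<integral>\<^sup>+x. ennreal ((norm (LINT \<xi>:{N..<2 * N}|lborel. h \<xi> * osc a x (T x) (T x powr \<gamma>) \<xi>))\<^sup>2) \<partial>lborel)
      = (\<integral>\<^sup>+x. ennreal (N\<^sup>2) * ennreal ((norm (W (N * x)))\<^sup>2) \<partial>lborel)"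
    unfolding FW using N by (intro nn_integral_cong) (simp add: norm_mult power_mult_distrib ennreal_mult)
  also have "\<dots> = ennreal N * (ennreal N * (\<integral>\<^sup>+x. ennreal ((norm (W (N * x)))\<^sup>2) \<partial>lborel))"
    using N by (subst nn_integral_cmult) (auto simp: power2_eq_square ennreal_mult mult.assoc)
  also have "ennreal N * (\<integral>\<^sup>+x. ennreal ((norm (W (N * x)))\<^sup>2) \<partial>lborel) = (\<integral>\<^sup>+X. ennreal ((norm (W X))\<^sup>2) \<partial>lborel)"
    using N nn_integral_real_affine[of "\<lambda>X. ennreal ((norm (W X))\<^sup>2)" N 0] by simp
  also have "ennreal N * \<dots> \<le> ennreal N * (ennreal (C * max 1 (\<kappa> powr ((1 - 1 / \<gamma>) / 2))) *
       (\<integral>\<^sup>+\<eta>. ennreal ((norm (g \<eta>))\<^sup>2) * indicator {1..2} \<eta> \<partial>lborel))"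
    unfolding W_def by (intro mult_left_mono unit[OF _ _ _ _ g]) (auto simp: \<kappa>_def T'_def T0)
  also have "\<dots> = ennreal (C * max 1 (\<kappa> powr ((1 - 1 / \<gamma>) / 2))) *
      (ennreal N * (\<integral>\<^sup>+\<eta>. ennreal ((norm (g \<eta>))\<^sup>2) * indicator {1..2} \<eta> \<partial>lborel))"
    by (simp add: mult_ac)
  also have "(\<integral>\<^sup>+\<eta>. ennreal ((norm (g \<eta>))\<^sup>2) * indicator {1..2} \<eta> \<partial>lborel)
     = (\<integral>\<^sup>+\<eta>. ennreal ((norm (h (N * \<eta>)))\<^sup>2) * indicator {N..<2 * N} (N * \<eta>) \<partial>lborel)"
    using N by (intro nn_integral_cong) (auto simp: g_def indicator_def)
  also have "ennreal N * \<dots> = (\<integral>\<^sup>+\<xi>. ennreal ((norm (h \<xi>))\<^sup>2) * indicator {N..<2 * N} \<xi> \<partial>lborel)"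
    using N nn_integral_real_affine[of "\<lambda>\<xi>. ennreal ((norm (h \<xi>))\<^sup>2) * indicator {N..<2 * N} \<xi>" N 0] by simp
  finally show ?thesis unfolding \<kappa>eq .
qed

text \<open>A bound of Plancherel type, read off from the unit-scale estimate at \<kappa> = 0.
  Shifting the frequencies by 1 moves [0, 1) onto [1, 2) and only multiplies the output by a
  unimodular factor.\<close>

lemma low_frequency_static:
  assumes h [measurable]: "h \<in> borel_measurable borel" and Ch: "\<And>\<eta>. norm (h \<eta>) \<le> Ch"
  shows "(\<integral>\<^sup>+x. ennreal ((norm (LINT \<xi>:{0..<1}|lborel. h \<xi> * exp (\<i> * of_real (x * \<xi>))))\<^sup>2) \<partial>lborel)
         \<le> ennreal C * (\<integral>\<^sup>+\<xi>. ennreal ((norm (h \<xi>))\<^sup>2) * indicator {0..<1} \<xi> \<partial>lborel)"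
proof -
  define g where "g = (\<lambda>\<eta>. h (\<eta> - 1) * indicator {1..<2} \<eta>)"
  have [measurable]: "g \<in> borel_measurable borel" unfolding g_def by measurable
  have g: "norm (g \<eta>) \<le> Ch" for \<eta>
    using Ch[of "\<eta> - 1"] order_trans[OF norm_ge_zero Ch] by (auto simp: g_def norm_mult indicator_def)
  \<comment> \<open>The unsimplified \<open>0 * 1\<close> and \<open>0 * 1 powr \<gamma>\<close> are
    the shapes of \<open>\<kappa> * T X\<close> and \<open>\<kappa> * T X powr \<gamma>\<close> for
    \<kappa> = 0 and constant time 1, so that \<open>unit\<close> matches.\<close>
  have eq: "norm (LINT \<xi>:{0..<1}|lborel. h \<xi> * exp (\<i> * of_real (x * \<xi>)))
      = norm (LINT \<eta>:{1..2}|lborel. g \<eta> * osc a x (0 * 1) (0 * 1 powr \<gamma>) \<eta>)" for x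
  proof -
    have "(LINT \<xi>:{0..<1}|lborel. h \<xi> * exp (\<i> * of_real (x * \<xi>)))
      = (\<integral>\<eta>. indicator {0..<1} (\<eta> - 1) *\<^sub>R (h (\<eta> - 1) * exp (\<i> * of_real (x * (\<eta> - 1)))) \<partial>lborel)"
      unfolding set_lebesgue_integral_def
      by (subst lborel_integral_real_affine[where c = 1 and t = "-1"]) auto
    also have "\<dots> = (\<integral>\<eta>. exp (- (\<i> * of_real x)) * (indicator {1..2} \<eta> *\<^sub>R (g \<eta> * osc a x (0 * 1) (0 * 1 powr \<gamma>) \<eta>)) \<partial>lborel)"
    proof (intro Bochner_Integration.integral_cong refl)
      fix \<eta> :: real
      have "exp (\<i> * of_real (x * (\<eta> - 1))) = exp (- (\<i> * of_real x)) * osc a x (0 * 1) (0 * 1 powr \<gamma>) \<eta>"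
        unfolding osc_def mult_exp_exp by (simp add: algebra_simps)
      thus "indicator {0..<1} (\<eta> - 1) *\<^sub>R (h (\<eta> - 1) * exp (\<i> * of_real (x * (\<eta> - 1))))
        = exp (- (\<i> * of_real x)) * (indicator {1..2} \<eta> *\<^sub>R (g \<eta> * osc a x (0 * 1) (0 * 1 powr \<gamma>) \<eta>))"
        by (auto simp: g_def indicator_def)
    qed
    also have "\<dots> = exp (- (\<i> * of_real x)) * (LINT \<eta>:{1..2}|lborel. g \<eta> * osc a x (0 * 1) (0 * 1 powr \<gamma>) \<eta>)"
      unfolding set_lebesgue_integral_def by (rule Bochner_Integration.integral_mult_right_zero)
    finally show ?thesis by (simp add: norm_mult)
  qed
  have "(\<integral>\<^sup>+x. ennreal ((norm (LINT \<xi>:{0..<1}|lborel. h \<xi> * exp (\<i> * of_real (x * \<xi>))))\<^sup>2) \<partial>lborel)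
     \<le> ennreal (C * max 1 (0 powr ((1 - 1 / \<gamma>) / 2))) * (\<integral>\<^sup>+\<eta>. ennreal ((norm (g \<eta>))\<^sup>2) * indicator {1..2} \<eta> \<partial>lborel)"
    unfolding eq by (rule unit[OF _ _ _ _ g, where T = "\<lambda>_. 1"]) auto
  also have "(\<integral>\<^sup>+\<eta>. ennreal ((norm (g \<eta>))\<^sup>2) * indicator {1..2} \<eta> \<partial>lborel)
      = (\<integral>\<^sup>+\<eta>. ennreal ((norm (h (-1 + 1 * \<eta>)))\<^sup>2) * indicator {0..<1} (-1 + 1 * \<eta>) \<partial>lborel)"
    by (intro nn_integral_cong) (auto simp: g_def indicator_def)
  also have "\<dots> = (\<integral>\<^sup>+\<xi>. ennreal ((norm (h \<xi>))\<^sup>2) * indicator {0..<1} \<xi> \<partial>lborel)"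
    using nn_integral_real_affine[of "\<lambda>\<xi>. ennreal ((norm (h \<xi>))\<^sup>2) * indicator {0..<1} \<xi>" 1 "-1"] by simp
  finally show ?thesis by simp
qed

text \<open>The phase \<open>\<xi>\<^sup>a\<close> is not smooth at 0, but \<open>exp ((\<i> T - T\<^sup>\<gamma>) \<xi>\<^sup>a)\<close> may be expanded into a power series,
  each term of which is a time-independent multiplier.\<close>
lemma low_frequency_piece:
  assumes T [measurable]: "T \<in> borel_measurable borel" and T0: "\<And>x. T x > 0" and T1: "\<And>x. T x < 1"
    and h [measurable]: "h \<in> borel_measurable borel" and Ch: "\<And>\<eta>. norm (h \<eta>) \<le> Ch"
  shows "(\<integral>\<^sup>+x. ennreal ((norm (LINT \<xi>:{0..<1}|lborel. h \<xi> * osc a x (T x) (T x powr \<gamma>) \<xi>))\<^sup>2) \<partial>lborel)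
         \<le> ennreal (exp 4 * C) * (\<integral>\<^sup>+\<xi>. ennreal ((norm (h \<xi>))\<^sup>2) * indicator {0..<1} \<xi> \<partial>lborel)"
proof -
  define z where "z = (\<lambda>x. \<i> * complex_of_real (T x) - of_real (T x powr \<gamma>))"
  define hh where "hh = (\<lambda>j \<xi>. h \<xi> * of_real ((\<xi> powr a) ^ j) * indicator {0..<1} \<xi>)"
  define H where "H = (\<lambda>j x. LINT \<xi>:{0..<1}|lborel. hh j \<xi> * exp (\<i> * of_real (x * \<xi>)))"
  define F where "F = (\<lambda>j x. z x ^ j / of_real (fact j) * H j x)"
  \<comment> \<open>Bounds the j-th coefficient of the exponential series, as |z| \<le> 2. The same
    numbers serve as Cauchy-Schwarz weights, so their sum exp 2 enters twice and produces exp
    4.\<close>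
  define c where "c = (\<lambda>j. 2 ^ j / fact j :: real)"
  define R where "R = (\<integral>\<^sup>+\<xi>. ennreal ((norm (h \<xi>))\<^sup>2) * indicator {0..<1} \<xi> \<partial>lborel)"
  have c0: "c j > 0" for j by (simp add: c_def)
  have csums: "c sums exp 2"
    using exp_converges[of "2::real"] by (simp add: c_def divide_inverse mult.commute)
  have Ch0: "Ch \<ge> 0" using Ch norm_ge_zero order_trans by blast
  have zle: "norm (z x) \<le> 2" for x
  proof -
    have "T x powr \<gamma> \<le> 1 powr \<gamma>" using T0[of x] T1[of x] \<gamma> by (intro powr_mono2) auto
    hence "norm (\<i> * complex_of_real (T x)) + norm (complex_of_real (T x powr \<gamma>)) \<le> 2"
      using T0[of x] T1[of x] by (simp add: norm_mult)
    thus ?thesis unfolding z_def using norm_triangle_ineq4 order_trans by blast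
  qed
  have xi1: "\<xi> powr a \<le> 1" if "\<xi> \<in> {0..<1}" for \<xi>
    using that a powr_mono2[of a \<xi> 1] by auto
  have hm [measurable]: "hh j \<in> borel_measurable borel" for j unfolding hh_def by measurable
  have hhle: "norm (hh j \<xi>) \<le> norm (h \<xi>) * indicator {0..<1} \<xi>" for j \<xi>
  proof (cases "\<xi> \<in> {0..<1}")
    case True
    have "(\<xi> powr a) ^ j \<le> 1" using xi1[OF True] by (intro power_le_one) auto
    thus ?thesis using True mult_left_mono[of "(\<xi> powr a) ^ j" 1 "norm (h \<xi>)"]
      by (simp add: hh_def norm_mult norm_power)
  qed (simp add: hh_def)
  have hhC: "norm (hh j \<xi>) \<le> Ch" for j \<xi>
    using hhle[of j \<xi>] Ch[of \<xi>] Ch0 by (cases "\<xi> \<in> {0..<1}") auto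
  have Hm [measurable]: "H j \<in> borel_measurable borel" for j
    unfolding H_def set_lebesgue_integral_def by measurable
  have zm [measurable]: "z \<in> borel_measurable borel" unfolding z_def by measurable
  have Fm: "F j \<in> borel_measurable lborel" for j unfolding F_def by measurable
  have sums: "(\<lambda>j. F j x) sums (LINT \<xi>:{0..<1}|lborel. h \<xi> * osc a x (T x) (T x powr \<gamma>) \<xi>)" for x
  proof -
    define q where "q = (\<lambda>j \<xi>. z x ^ j / of_real (fact j) * (indicator {0..<1} \<xi> *\<^sub>R (hh j \<xi> * exp (\<i> * of_real (x * \<xi>)))))"
    have qle: "norm (q j \<xi>) \<le> c j * (Ch * indicator {0..<1} \<xi>)" for j \<xi>
    proof -
      have "norm (q j \<xi>) = (norm (z x) ^ j / fact j) * (indicator {0..<1} \<xi> * norm (hh j \<xi>))"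
        by (simp add: q_def norm_mult norm_divide norm_power)
      also have "\<dots> \<le> c j * (indicator {0..<1} \<xi> * Ch)"
        unfolding c_def using zle[of x] hhC[of j \<xi>] Ch0
        by (intro mult_mono divide_right_mono power_mono) auto
      finally show ?thesis by (simp add: mult.commute)
    qed
    have i0: "integrable lborel (\<lambda>\<xi>. Ch * indicator {0..<1::real} \<xi>)" by auto
    have qm: "q j \<in> borel_measurable lborel" for j unfolding q_def by measurable
    have qi: "integrable lborel (q j)" for j
      by (rule Bochner_Integration.integrable_bound[OF integrable_mult_right[OF i0, of "c j"] qm])
         (use qle Ch0 in \<open>auto intro!: AE_I2 simp: abs_mult abs_of_pos[OF c0]\<close>)
    have "(\<lambda>j. integral\<^sup>L lborel (q j)) sums (\<integral>\<xi>. (\<Sum>j. q j \<xi>) \<partial>lborel)"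
    proof (rule sums_integral[OF qi])
      show "AE \<xi> in lborel. summable (\<lambda>j. norm (q j \<xi>))"
      proof (rule AE_I2)
        fix \<xi> show "summable (\<lambda>j. norm (q j \<xi>))"
          by (rule summable_comparison_test'[OF summable_mult2[OF sums_summable[OF csums], of "Ch * indicator {0..<1} \<xi>"], of 0])
             (use qle in auto)
      qed
      have "(\<integral>\<xi>. norm (q j \<xi>) \<partial>lborel) \<le> c j * Ch" for j
      proof -
        have "(\<integral>\<xi>. norm (q j \<xi>) \<partial>lborel) \<le> (\<integral>\<xi>. c j * (Ch * indicator {0..<1::real} \<xi>) \<partial>lborel)"
        proof (rule Bochner_Integration.integral_mono)
          show "integrable lborel (\<lambda>\<xi>. norm (q j \<xi>))" using qi by (rule integrable_norm)
          show "integrable lborel (\<lambda>\<xi>. c j * (Ch * indicator {0..<1::real} \<xi>))" using i0 by (rule integrable_mult_right)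
        qed (rule qle)
        also have "\<dots> = c j * (Ch * measure lborel {0..<1::real})" by simp
        finally show ?thesis by simp
      qed
      thus "summable (\<lambda>j. \<integral>\<xi>. norm (q j \<xi>) \<partial>lborel)"
        by (intro summable_comparison_test'[OF summable_mult2[OF sums_summable[OF csums], of Ch], of 0]) auto
    qed
    moreover have "integral\<^sup>L lborel (q j) = F j x" for j
      unfolding q_def F_def H_def set_lebesgue_integral_def by (rule Bochner_Integration.integral_mult_right_zero)
    moreover have "(\<Sum>j. q j \<xi>) = indicator {0..<1} \<xi> *\<^sub>R (h \<xi> * osc a x (T x) (T x powr \<gamma>) \<xi>)" for \<xi>
    proof (cases "\<xi> \<in> {0..<1}")
      case True
      have "(\<lambda>j. h \<xi> * exp (\<i> * of_real (x * \<xi>)) * ((z x * of_real (\<xi> powr a)) ^ j /\<^sub>R fact j))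
          sums (h \<xi> * exp (\<i> * of_real (x * \<xi>)) * exp (z x * of_real (\<xi> powr a)))"
        by (intro sums_mult exp_converges)
      also have "(\<lambda>j. h \<xi> * exp (\<i> * of_real (x * \<xi>)) * ((z x * of_real (\<xi> powr a)) ^ j /\<^sub>R fact j)) = (\<lambda>j. q j \<xi>)"
        using True by (auto simp: q_def hh_def power_mult_distrib scaleR_conv_of_real divide_inverse mult_ac)
      also have "h \<xi> * exp (\<i> * of_real (x * \<xi>)) * exp (z x * of_real (\<xi> powr a)) = h \<xi> * osc a x (T x) (T x powr \<gamma>) \<xi>"
        unfolding mult.assoc mult_exp_exp by (simp add: osc_def z_def algebra_simps)
      finally show ?thesis using True by (simp add: sums_iff)
    qed (simp add: q_def)
    ultimately show ?thesis by (simp add: set_lebesgue_integral_def)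
  qed
  have "(\<integral>\<^sup>+x. ennreal ((norm (LINT \<xi>:{0..<1}|lborel. h \<xi> * osc a x (T x) (T x powr \<gamma>) \<xi>))\<^sup>2) \<partial>lborel)
     \<le> ennreal (suminf c) * (\<Sum>j. ennreal (1 / c j) * (\<integral>\<^sup>+x. ennreal ((norm (F j x))\<^sup>2) \<partial>lborel))"
    using sums c0 csums by (intro nn_integral_square_sums Fm) (auto simp: sums_iff)
  also have "\<dots> \<le> ennreal (suminf c) * (\<Sum>j. ennreal (c j) * (ennreal C * R))"
  proof (intro mult_left_mono suminf_le)
    fix j
    have "(\<integral>\<^sup>+x. ennreal ((norm (F j x))\<^sup>2) \<partial>lborel) \<le> (\<integral>\<^sup>+x. ennreal ((c j)\<^sup>2) * ennreal ((norm (H j x))\<^sup>2) \<partial>lborel)"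
    proof (rule nn_integral_mono)
      fix x
      have "norm (F j x) = (norm (z x) ^ j / fact j) * norm (H j x)"
        by (simp add: F_def norm_mult norm_divide norm_power)
      also have "\<dots> \<le> c j * norm (H j x)"
        unfolding c_def using zle[of x] by (intro mult_right_mono divide_right_mono power_mono) auto
      finally have "(norm (F j x))\<^sup>2 \<le> (c j * norm (H j x))\<^sup>2" by (intro power_mono) auto
      thus "ennreal ((norm (F j x))\<^sup>2) \<le> ennreal ((c j)\<^sup>2) * ennreal ((norm (H j x))\<^sup>2)"
        by (simp add: power_mult_distrib ennreal_leI flip: ennreal_mult)
    qed
    also have "\<dots> = ennreal ((c j)\<^sup>2) * (\<integral>\<^sup>+x. ennreal ((norm (H j x))\<^sup>2) \<partial>lborel)"
      by (rule nn_integral_cmult) measurable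
    also have "\<dots> \<le> ennreal ((c j)\<^sup>2) * (ennreal C * (\<integral>\<^sup>+\<xi>. ennreal ((norm (hh j \<xi>))\<^sup>2) * indicator {0..<1} \<xi> \<partial>lborel))"
      unfolding H_def by (intro mult_left_mono low_frequency_static[OF _ hhC]) auto
    also have "\<dots> \<le> ennreal ((c j)\<^sup>2) * (ennreal C * R)"
      unfolding R_def
    proof (intro mult_left_mono nn_integral_mono)
      fix \<xi>
      have "(norm (hh j \<xi>))\<^sup>2 \<le> (norm (h \<xi>) * indicator {0..<1} \<xi>)\<^sup>2" by (intro power_mono hhle) auto
      thus "ennreal ((norm (hh j \<xi>))\<^sup>2) * indicator {0..<1} \<xi> \<le> ennreal ((norm (h \<xi>))\<^sup>2) * indicator {0..<1} \<xi>"
        by (cases "\<xi> \<in> {0..<1}") (auto intro: ennreal_leI)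
    qed auto
    finally have "ennreal (1 / c j) * (\<integral>\<^sup>+x. ennreal ((norm (F j x))\<^sup>2) \<partial>lborel)
       \<le> ennreal (1 / c j) * (ennreal ((c j)\<^sup>2) * (ennreal C * R))" by (intro mult_left_mono) auto
    also have "\<dots> = ennreal (1 / c j * (c j)\<^sup>2) * (ennreal C * R)"
    proof -
      have "ennreal (1 / c j * (c j)\<^sup>2) = ennreal (1 / c j) * ennreal ((c j)\<^sup>2)"
        using c0[of j] by (intro ennreal_mult) auto
      thus ?thesis by (simp only: mult.assoc)
    qed
    also have "1 / c j * (c j)\<^sup>2 = c j" using c0[of j] by (simp add: power2_eq_square)
    finally show "ennreal (1 / c j) * (\<integral>\<^sup>+x. ennreal ((norm (F j x))\<^sup>2) \<partial>lborel) \<le> ennreal (c j) * (ennreal C * R)" .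
  qed auto
  also have "(\<Sum>j. ennreal (c j) * (ennreal C * R)) = ennreal (suminf c) * (ennreal C * R)"
    using csums c0 by (subst ennreal_suminf_multc) (simp add: suminf_ennreal2 less_imp_le sums_iff)
  also have "ennreal (suminf c) * (ennreal (suminf c) * (ennreal C * R)) = ennreal (exp 4 * C) * R"
  proof -
    have "suminf c = exp 2" using csums by (simp add: sums_iff)
    moreover have "exp 4 = exp 2 * exp (2::real)" by (simp flip: exp_add)
    ultimately show ?thesis using C by (simp add: ennreal_mult mult.assoc)
  qed
  finally show ?thesis unfolding R_def .
qed

end

text \<open>At a positive time the damping alone makes the integrals converge as soon as the
  amplitude is bounded.\<close>

lemma integrable_exp_powr:
  assumes "U > 0" "a > 1"
  shows "integrable lborel (\<lambda>\<xi>::real. exp (- (U * \<bar>\<xi>\<bar> powr a)))"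
proof -
  obtain C where C: "C > 0" "\<And>u. u \<ge> 0 \<Longrightarrow> (1 + u) powr 2 * exp (- (U * u)) \<le> C"
    using one_plus_powr_exp_bounded[of U 2] assms by auto
  have "integrable lborel (\<lambda>\<xi>::real. inverse (1 + \<xi>\<^sup>2))"
    using integrable_inverse_1_plus_square by (simp add: set_integrable_def)
  hence "integrable lborel (\<lambda>\<xi>::real. 4 * C * inverse (1 + \<xi>\<^sup>2))" by (rule integrable_mult_right)
  thus ?thesis
  proof (rule Bochner_Integration.integrable_bound)
    show "AE \<xi> in lborel. norm (exp (- (U * \<bar>\<xi>\<bar> powr a))) \<le> norm (4 * C * inverse (1 + \<xi>\<^sup>2))"
    proof (rule AE_I2)
      fix \<xi> :: real
      define u where "u = \<bar>\<xi>\<bar> powr a"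
      have u: "u \<ge> 0" by (simp add: u_def)
      have "\<bar>\<xi>\<bar> \<le> 1 + u"
      proof (cases "\<bar>\<xi>\<bar> \<le> 1")
        case False
        hence "\<bar>\<xi>\<bar> powr 1 \<le> \<bar>\<xi>\<bar> powr a" using assms by (intro powr_mono) auto
        thus ?thesis using False by (simp add: u_def)
      qed (use u in auto)
      hence "\<bar>\<xi>\<bar>\<^sup>2 \<le> (1 + u)\<^sup>2" by (intro power_mono) auto
      moreover have "1 \<le> (1 + u)\<^sup>2" using u by (simp add: power2_eq_square algebra_simps)
      ultimately have "1 + \<xi>\<^sup>2 \<le> 4 * (1 + u)\<^sup>2" unfolding power2_abs by linarith
      hence "(1 + \<xi>\<^sup>2) * exp (- (U * u)) \<le> 4 * (1 + u)\<^sup>2 * exp (- (U * u))" by (intro mult_right_mono) auto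
      also have "\<dots> \<le> 4 * C" using C(2)[OF u] u by (simp add: powr_numeral)
      finally have "exp (- (U * u)) \<le> 4 * C * inverse (1 + \<xi>\<^sup>2)"
        by (simp add: field_simps add_pos_nonneg)
      moreover have "1 + \<xi>\<^sup>2 > 0" by (intro add_pos_nonneg) auto
      ultimately show "norm (exp (- (U * \<bar>\<xi>\<bar> powr a))) \<le> norm (4 * C * inverse (1 + \<xi>\<^sup>2))"
        using C(1) by (simp add: u_def abs_mult)
    qed
  qed measurable
qed

lemma dyadic_cover:
  fixes A :: "nat \<Rightarrow> real set"
  assumes A: "A = (\<lambda>j. case j of 0 \<Rightarrow> {0..<1} | Suc k \<Rightarrow> {2 ^ k..<2 * 2 ^ k})"
  shows "disjoint_family A" "(\<Union>j. A j) = {0..}"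
proof -
  have lt: "x < y" if ij: "i < j" and xy: "x \<in> A i" "y \<in> A j" for i j x y
  proof -
    obtain k where k: "j = Suc k" using ij by (cases j) auto
    have y: "2 ^ k \<le> y" using ij xy by (simp add: A k)
    have "x < 2 ^ k"
    proof (cases i)
      case 0
      have "(1::real) \<le> 2 ^ k" by simp
      moreover have "x < 1" using xy 0 by (simp add: A)
      ultimately show ?thesis by linarith
    next
      case (Suc m)
      hence "Suc m \<le> k" using ij xy k by simp
      hence "(2::real) ^ Suc m \<le> 2 ^ k" by (intro power_increasing) auto
      thus ?thesis using ij xy Suc by (simp add: A)
    qed
    with y show ?thesis by simp
  qed
  show "disjoint_family A" unfolding disjoint_family_on_def
  proof (intro ballI impI)
    fix m n :: nat assume "m \<noteq> n"
    thus "A m \<inter> A n = {}" using lt[of m n] lt[of n m] by (cases "m < n") (force simp: not_less)+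
  qed
  show "(\<Union>j. A j) = {0..}"
  proof (intro equalityI subsetI)
    fix x assume "x \<in> (\<Union>j. A j)"
    then obtain j where "x \<in> A j" by auto
    thus "x \<in> {0..}" using order_trans[of "0::real" "2 ^ (j - 1)" x] by (cases j) (auto simp: A)
  next
    fix x :: real assume "x \<in> {0..}"
    hence x: "x \<ge> 0" by simp
    show "x \<in> (\<Union>j. A j)"
    proof (cases "x < 1")
      case True
      hence "x \<in> A 0" using x by (simp add: A)
      thus ?thesis by blast
    next
      case False
      define n where "n = nat \<lfloor>x\<rfloor>"
      have n: "n \<ge> 1" "real n \<le> x" "x < real n + 1" using False unfolding n_def by (simp_all, linarith+)
      obtain k where k: "2 ^ k \<le> n" "n < 2 ^ (k + 1)" using ex_power_ivl1[of 2 n] n by auto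
      have "real (2 ^ k) \<le> real n" using k(1) by (simp only: of_nat_le_iff)
      moreover have "real n + 1 \<le> real (2 ^ (k + 1))" using k(2) by linarith
      ultimately have "2 ^ k \<le> real n" "real n + 1 \<le> 2 * 2 ^ k" by simp_all
      hence "2 ^ k \<le> x" "x < 2 * 2 ^ k" using n by (blast intro: order_trans less_le_trans)+
      hence "x \<in> A (Suc k)" by (simp add: A)
      thus ?thesis by blast
    qed
  qed
qed

context unit_scale_estimate
begin

text \<open>The block at N costs N^\<sigma> with \<sigma> below 2 s. The gap \<delta> is spent
  entirely on summable weights N^(-\<delta>): after division by the weight the cost is N^(2 s),
  which the Sobolev weight (1 + \<xi>^2)^s dominates on that block.\<close>

lemma half_line_bound:
  assumes s: "s > 0" "2 * s > a * max 0 (1 - 1 / \<gamma>) / 2"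
  obtains K where "K > 0"
    "\<And>T h Ch. T \<in> borel_measurable borel \<Longrightarrow> (\<And>x. T x > 0) \<Longrightarrow> (\<And>x. T x < 1) \<Longrightarrow>
       h \<in> borel_measurable borel \<Longrightarrow> (\<And>\<eta>. norm (h \<eta>) \<le> Ch) \<Longrightarrow>
       (\<integral>\<^sup>+x. ennreal ((norm (LINT \<xi>:{0..}|lborel. h \<xi> * osc a x (T x) (T x powr \<gamma>) \<xi>))\<^sup>2) \<partial>lborel)
         \<le> ennreal K * (\<integral>\<^sup>+\<xi>. ennreal ((1 + \<xi>\<^sup>2) powr s * (norm (h \<xi>))\<^sup>2) * indicator {0..} \<xi> \<partial>lborel)"
proof -
  define \<sigma> where "\<sigma> = a * max 0 (1 - 1 / \<gamma>) / 2"
  define \<delta> where "\<delta> = 2 * s - \<sigma>"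
  have \<delta>: "\<delta> > 0" using s by (simp add: \<delta>_def \<sigma>_def)
  define A :: "nat \<Rightarrow> real set" where "A = (\<lambda>j. case j of 0 \<Rightarrow> {0..<1} | Suc k \<Rightarrow> {2 ^ k..<2 * 2 ^ k})"
  note cover = dyadic_cover[OF A_def]
  define c :: "nat \<Rightarrow> real" where "c = (\<lambda>j. case j of 0 \<Rightarrow> 1 | Suc k \<Rightarrow> (2 powr (- \<delta>)) ^ k)"
  have c0: "c j > 0" for j by (simp add: c_def split: nat.split)
  have "2 powr (- \<delta>) < 2 powr 0" using \<delta> by (intro powr_less_mono) auto
  hence "summable (\<lambda>k. (2 powr (- \<delta>)) ^ k)" by (intro summable_geometric) auto
  hence "summable (\<lambda>k. c (Suc k))" by (simp add: c_def)
  hence csum: "summable c" by (subst (asm) summable_Suc_iff)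
  have csum0: "suminf c > 0" using csum c0 by (intro suminf_pos) auto
  define K where "K = suminf c * (exp 4 * C)"
  have Am [measurable]: "A j \<in> sets borel" for j by (simp add: A_def split: nat.split)
  have main: "(\<integral>\<^sup>+x. ennreal ((norm (LINT \<xi>:{0..}|lborel. h \<xi> * osc a x (T x) (T x powr \<gamma>) \<xi>))\<^sup>2) \<partial>lborel)
         \<le> ennreal K * (\<integral>\<^sup>+\<xi>. ennreal ((1 + \<xi>\<^sup>2) powr s * (norm (h \<xi>))\<^sup>2) * indicator {0..} \<xi> \<partial>lborel)"
    if T [measurable]: "T \<in> borel_measurable borel" and T0: "\<And>x. T x > 0" and T1: "\<And>x. T x < 1"
      and h [measurable]: "h \<in> borel_measurable borel" and Ch: "\<And>\<eta>. norm (h \<eta>) \<le> Ch" for T h Ch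
  proof -
    have Ch0: "Ch \<ge> 0" using Ch norm_ge_zero order_trans by blast
    define F where "F = (\<lambda>j x. LINT \<xi>:A j|lborel. h \<xi> * osc a x (T x) (T x powr \<gamma>) \<xi>)"
    \<comment> \<open>Reading the weighted energy as a measure turns the sum over the blocks into
      countable additivity.\<close>
    define \<mu> where "\<mu> = density lborel (\<lambda>\<xi>. ennreal ((1 + \<xi>\<^sup>2) powr s * (norm (h \<xi>))\<^sup>2))"
    have \<mu>: "emeasure \<mu> B = (\<integral>\<^sup>+\<xi>. ennreal ((1 + \<xi>\<^sup>2) powr s * (norm (h \<xi>))\<^sup>2) * indicator B \<xi> \<partial>lborel)"
      if "B \<in> sets borel" for B
      unfolding \<mu>_def using that by (subst emeasure_density) auto
    have int: "set_integrable lborel {0..} (\<lambda>\<xi>. h \<xi> * osc a x (T x) (T x powr \<gamma>) \<xi>)" for x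
      unfolding set_integrable_def
    proof (rule Bochner_Integration.integrable_bound[OF integrable_mult_right[OF integrable_exp_powr[of "T x powr \<gamma>" a]]])
      show "T x powr \<gamma> > 0" using T0[of x] by simp
      show "a > 1" by (rule a)
      show "AE \<xi> in lborel. norm (indicator {0..} \<xi> *\<^sub>R (h \<xi> * osc a x (T x) (T x powr \<gamma>) \<xi>))
          \<le> norm (Ch * exp (- (T x powr \<gamma> * \<bar>\<xi>\<bar> powr a)))"
      proof (rule AE_I2)
        fix \<xi> :: real
        show "norm (indicator {0..} \<xi> *\<^sub>R (h \<xi> * osc a x (T x) (T x powr \<gamma>) \<xi>))
          \<le> norm (Ch * exp (- (T x powr \<gamma> * \<bar>\<xi>\<bar> powr a)))"
          using Ch[of \<xi>] Ch0 by (cases "\<xi> \<ge> 0") (auto simp: norm_mult norm_osc intro!: mult_right_mono)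
      qed
    qed measurable
    have sums: "(\<lambda>j. F j x) sums (LINT \<xi>:{0..}|lborel. h \<xi> * osc a x (T x) (T x powr \<gamma>) \<xi>)" for x
      using set_lebesgue_integral_sums[of A lborel "\<lambda>\<xi>. h \<xi> * osc a x (T x) (T x powr \<gamma>) \<xi>"] int[of x]
      unfolding F_def cover(2) using cover(1) by auto
    have "(\<integral>\<^sup>+x. ennreal ((norm (LINT \<xi>:{0..}|lborel. h \<xi> * osc a x (T x) (T x powr \<gamma>) \<xi>))\<^sup>2) \<partial>lborel)
      \<le> ennreal (suminf c) * (\<Sum>j. ennreal (1 / c j) * (\<integral>\<^sup>+x. ennreal ((norm (F j x))\<^sup>2) \<partial>lborel))"
    proof (rule nn_integral_square_sums[OF _ sums c0 csum])
      show "F j \<in> borel_measurable lborel" for j unfolding F_def set_lebesgue_integral_def by measurable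
    qed
    also have "\<dots> \<le> ennreal (suminf c) * (\<Sum>j. ennreal (exp 4 * C) * emeasure \<mu> (A j))"
    proof (intro mult_left_mono suminf_le)
      fix j
      show "ennreal (1 / c j) * (\<integral>\<^sup>+x. ennreal ((norm (F j x))\<^sup>2) \<partial>lborel) \<le> ennreal (exp 4 * C) * emeasure \<mu> (A j)"
      proof (cases j)
        case 0
        have "(\<integral>\<^sup>+x. ennreal ((norm (F j x))\<^sup>2) \<partial>lborel) \<le> ennreal (exp 4 * C) *
            (\<integral>\<^sup>+\<xi>. ennreal ((norm (h \<xi>))\<^sup>2) * indicator {0..<1} \<xi> \<partial>lborel)"
          unfolding F_def 0 A_def using low_frequency_piece[OF T T0 T1 h Ch] by simp
        also have "\<dots> \<le> ennreal (exp 4 * C) * emeasure \<mu> (A j)"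
          unfolding \<mu>[OF Am] unfolding 0
        proof (intro mult_left_mono nn_integral_mono)
          fix \<xi> :: real
          have "1 * (norm (h \<xi>))\<^sup>2 \<le> (1 + \<xi>\<^sup>2) powr s * (norm (h \<xi>))\<^sup>2"
            using s by (intro mult_right_mono ge_one_powr_ge_zero) auto
          thus "ennreal ((norm (h \<xi>))\<^sup>2) * indicator {0..<1} \<xi> \<le>
             ennreal ((1 + \<xi>\<^sup>2) powr s * (norm (h \<xi>))\<^sup>2) * indicator (A 0) \<xi>"
            by (auto simp: A_def indicator_def intro!: ennreal_leI)
        qed auto
        finally show ?thesis by (simp add: c_def 0)
      next
        case (Suc k)
        define N where "N = (2::real) ^ k"
        have N: "N \<ge> 1" by (simp add: N_def)
        have Aj: "A j = {N..<2 * N}" by (simp add: A_def Suc N_def)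
        have cj: "c j = N powr (- \<delta>)"
          by (simp add: c_def Suc N_def powr_power powr_realpow[symmetric] powr_powr mult.commute)
        have max1: "max 1 (N powr (a * (1 - 1 / \<gamma>) / 2)) \<le> N powr \<sigma>"
        proof (rule max.boundedI)
          have \<sigma>0: "\<sigma> \<ge> 0" using a by (simp add: \<sigma>_def)
          show "1 \<le> N powr \<sigma>" using N \<sigma>0 by (rule ge_one_powr_ge_zero)
          have "a * (1 - 1 / \<gamma>) / 2 \<le> \<sigma>" unfolding \<sigma>_def using a by (intro divide_right_mono mult_left_mono) auto
          thus "N powr (a * (1 - 1 / \<gamma>) / 2) \<le> N powr \<sigma>" using N by (intro powr_mono) auto
        qed
        define I where "I = (\<integral>\<^sup>+\<xi>. ennreal ((norm (h \<xi>))\<^sup>2) * indicator {N..<2 * N} \<xi> \<partial>lborel)"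
        have "(\<integral>\<^sup>+x. ennreal ((norm (F j x))\<^sup>2) \<partial>lborel) \<le> ennreal (C * max 1 (N powr (a * (1 - 1 / \<gamma>) / 2))) * I"
          unfolding F_def Aj I_def using N by (intro dyadic_piece[OF T T0 _ h Ch]) auto
        also have "\<dots> \<le> ennreal (C * N powr \<sigma>) * I"
          using C max1 by (intro mult_right_mono ennreal_leI mult_left_mono) auto
        finally have "ennreal (1 / c j) * (\<integral>\<^sup>+x. ennreal ((norm (F j x))\<^sup>2) \<partial>lborel) \<le> ennreal (1 / c j) * (ennreal (C * N powr \<sigma>) * I)"
          by (intro mult_left_mono) auto
        also have "\<dots> = ennreal (1 / c j * (C * N powr \<sigma>)) * I"
          using C c0[of j] by (subst ennreal_mult) (auto simp: mult.assoc)
        also have "1 / c j * (C * N powr \<sigma>) = C * N powr (2 * s)"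
        proof -
          have "N powr \<delta> * N powr \<sigma> = N powr (2 * s)" by (simp add: \<delta>_def flip: powr_add)
          moreover have "1 / c j = N powr \<delta>" using N by (simp add: cj powr_minus divide_inverse)
          ultimately show ?thesis by (metis mult.left_commute)
        qed
        also have "ennreal (C * N powr (2 * s)) * I = ennreal C * (\<integral>\<^sup>+\<xi>. ennreal (N powr (2 * s)) * (ennreal ((norm (h \<xi>))\<^sup>2) * indicator {N..<2 * N} \<xi>) \<partial>lborel)"
          unfolding I_def using C by (subst nn_integral_cmult) (auto simp: ennreal_mult mult.assoc)
        also have "\<dots> \<le> ennreal C * emeasure \<mu> (A j)"
          unfolding \<mu>[OF Am] unfolding Aj
        proof (intro mult_left_mono nn_integral_mono)
          fix \<xi> :: real
          show "ennreal (N powr (2 * s)) * (ennreal ((norm (h \<xi>))\<^sup>2) * indicator {N..<2 * N} \<xi>)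
             \<le> ennreal ((1 + \<xi>\<^sup>2) powr s * (norm (h \<xi>))\<^sup>2) * indicator {N..<2 * N} \<xi>"
          proof (cases "\<xi> \<in> {N..<2 * N}")
            case True
            have "N powr (2 * s) = (N powr 2) powr s" by (simp add: powr_powr)
            also have "\<dots> = (N\<^sup>2) powr s" using N by (simp add: powr_numeral)
            also have "\<dots> \<le> (1 + \<xi>\<^sup>2) powr s"
            proof (rule powr_mono2)
              have "N\<^sup>2 \<le> \<xi>\<^sup>2" using True N by (intro power_mono) auto
              thus "N\<^sup>2 \<le> 1 + \<xi>\<^sup>2" by simp
            qed (use s in auto)
            finally have "N powr (2 * s) * (norm (h \<xi>))\<^sup>2 \<le> (1 + \<xi>\<^sup>2) powr s * (norm (h \<xi>))\<^sup>2"
              by (rule mult_right_mono) auto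
            thus ?thesis using True by (simp add: ennreal_leI flip: ennreal_mult)
          qed simp
        qed auto
        also have "\<dots> \<le> ennreal (exp 4 * C) * emeasure \<mu> (A j)"
          using C by (intro mult_right_mono ennreal_leI) auto
        finally show ?thesis .
      qed
    qed auto
    also have "(\<Sum>j. ennreal (exp 4 * C) * emeasure \<mu> (A j)) = ennreal (exp 4 * C) * emeasure \<mu> {0..}"
      using suminf_emeasure[of A \<mu>] cover Am by (simp add: \<mu>_def image_subset_iff)
    also have "ennreal (suminf c) * (ennreal (exp 4 * C) * emeasure \<mu> {0..}) = ennreal K * emeasure \<mu> {0..}"
      using csum0 C by (simp add: K_def ennreal_mult mult.assoc)
    finally show ?thesis by (simp add: \<mu>)
  qed
  show ?thesis by (rule that[OF _ main]) (use csum0 C in \<open>auto simp: K_def\<close>)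
qed

end

section \<open>The maximal operator\<close>

text \<open>\<open>P_op\<close> with an arbitrary symbol in place of the Fourier transform, so that
  the upper bound can be stated for all bounded measurable symbols.\<close>

definition schroedinger_integral :: "real \<Rightarrow> real \<Rightarrow> (real \<Rightarrow> complex) \<Rightarrow> real \<Rightarrow> real \<Rightarrow> complex" where
  "schroedinger_integral a \<gamma> \<phi> t x =
     (LINT \<xi>|lborel. \<phi> \<xi> * exp (\<i> * of_real (t * \<bar>\<xi>\<bar> powr a))
        * of_real (exp (- (t powr \<gamma>) * \<bar>\<xi>\<bar> powr a)) * exp (\<i> * of_real (x * \<xi>)))"

lemma P_op_eq: "P_op a \<gamma> t f x = schroedinger_integral a \<gamma> (fourier f) t x"
  by (simp add: P_op_def schroedinger_integral_def)

lemma schroedinger_integrand_eq: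
  "\<phi> \<xi> * exp (\<i> * of_real (t * \<bar>\<xi>\<bar> powr a)) * of_real (exp (- (t powr \<gamma>) * \<bar>\<xi>\<bar> powr a)) * exp (\<i> * of_real (x * \<xi>))
   = \<phi> \<xi> * osc a (x * sgn \<xi>) t (t powr \<gamma>) \<bar>\<xi>\<bar>"
proof -
  have x: "x * sgn \<xi> * \<bar>\<xi>\<bar> = x * \<xi>" unfolding mult.assoc by (simp add: sgn_mult_abs)
  have e: "exp (\<i> * of_real (p + q)) = exp (\<i> * complex_of_real q) * exp (\<i> * of_real p)" for p q
    by (simp add: distrib_left exp_add mult.commute)
  have "osc a (x * sgn \<xi>) t (t powr \<gamma>) \<bar>\<xi>\<bar> = exp (\<i> * of_real (t * \<bar>\<xi>\<bar> powr a)) * of_real (exp (- (t powr \<gamma>) * \<bar>\<xi>\<bar> powr a)) * exp (\<i> * of_real (x * \<xi>))"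
    unfolding osc_eq x e by (simp add: mult_ac)
  thus ?thesis by (simp add: mult.assoc)
qed

lemma borel_measurable_schroedinger_integral [measurable (raw)]:
  assumes [measurable]: "\<phi> \<in> borel_measurable borel" "T \<in> borel_measurable M" "X \<in> borel_measurable M"
  shows "(\<lambda>x. schroedinger_integral a \<gamma> \<phi> (T x) (X x)) \<in> borel_measurable M"
  unfolding schroedinger_integral_def by measurable

text \<open>The multiplier is even in \<xi>, so reflecting the negative frequencies only changes the
  sign of x. The indicator of the open half-line keeps the frequency 0 in the first integral
  alone.\<close>

lemma schroedinger_integral_split:
  assumes a: "a > 1" and t: "t > 0"
    and \<phi> [measurable]: "\<phi> \<in> borel_measurable borel" and Ch: "\<And>\<xi>. norm (\<phi> \<xi>) \<le> Ch"
  shows "schroedinger_integral a \<gamma> \<phi> t x = (LINT \<xi>:{0..}|lborel. \<phi> \<xi> * osc a x t (t powr \<gamma>) \<xi>)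
         + (LINT \<xi>:{0..}|lborel. (\<phi> (- \<xi>) * indicator {0<..} \<xi>) * osc a (- x) t (t powr \<gamma>) \<xi>)"
proof -
  let ?q = "\<lambda>\<xi>. \<phi> \<xi> * osc a (x * sgn \<xi>) t (t powr \<gamma>) \<bar>\<xi>\<bar>"
  have Ch0: "Ch \<ge> 0" using Ch norm_ge_zero order_trans by blast
  have qi: "integrable lborel ?q"
  proof (rule Bochner_Integration.integrable_bound[OF integrable_mult_right[OF integrable_exp_powr[of "t powr \<gamma>" a], of Ch]])
    show "AE \<xi> in lborel. norm (?q \<xi>) \<le> norm (Ch * exp (- (t powr \<gamma> * \<bar>\<xi>\<bar> powr a)))"
      using Ch Ch0 by (intro AE_I2) (auto simp: norm_mult norm_osc intro!: mult_right_mono)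
  qed (use a t in auto)
  have "schroedinger_integral a \<gamma> \<phi> t x = (\<integral>\<xi>. ?q \<xi> \<partial>lborel)"
    unfolding schroedinger_integral_def schroedinger_integrand_eq ..
  also have "\<dots> = (\<integral>\<xi>. indicator {0..} \<xi> *\<^sub>R ?q \<xi> + indicator {..<0} \<xi> *\<^sub>R ?q \<xi> \<partial>lborel)"
    by (intro Bochner_Integration.integral_cong) (auto simp: indicator_def)
  also have "\<dots> = (\<integral>\<xi>. indicator {0..} \<xi> *\<^sub>R ?q \<xi> \<partial>lborel) + (\<integral>\<xi>. indicator {..<0} \<xi> *\<^sub>R ?q \<xi> \<partial>lborel)"
    by (intro Bochner_Integration.integral_add integrable_mult_indicator qi) auto
  also have "(\<integral>\<xi>. indicator {0..} \<xi> *\<^sub>R ?q \<xi> \<partial>lborel) = (LINT \<xi>:{0..}|lborel. \<phi> \<xi> * osc a x t (t powr \<gamma>) \<xi>)"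
    unfolding set_lebesgue_integral_def
  proof (rule integral_cong_AE)
    have "AE \<xi> in lborel. \<xi> \<noteq> (0::real)" by (rule AE_lborel_singleton)
    thus "AE \<xi> in lborel. indicator {0..} \<xi> *\<^sub>R ?q \<xi> = indicator {0..} \<xi> *\<^sub>R (\<phi> \<xi> * osc a x t (t powr \<gamma>) \<xi>)"
      by eventually_elim (auto simp: indicator_def)
  qed measurable
  also have "(\<integral>\<xi>. indicator {..<0} \<xi> *\<^sub>R ?q \<xi> \<partial>lborel)
     = (LINT \<xi>:{0..}|lborel. (\<phi> (- \<xi>) * indicator {0<..} \<xi>) * osc a (- x) t (t powr \<gamma>) \<xi>)"
    unfolding set_lebesgue_integral_def
    by (subst lborel_integral_real_affine[where c = "-1" and t = 0])
       (auto simp: indicator_def intro!: Bochner_Integration.integral_cong)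
  finally show ?thesis .
qed

abbreviation weighted_energy :: "real \<Rightarrow> (real \<Rightarrow> complex) \<Rightarrow> ennreal" where
  "weighted_energy s \<phi> \<equiv> \<integral>\<^sup>+\<xi>. ennreal ((1 + \<xi>\<^sup>2) powr s * (norm (\<phi> \<xi>))\<^sup>2) \<partial>lborel"

lemma (in unit_scale_estimate) linearised_bound:
  assumes s: "s > 0" "2 * s > a * max 0 (1 - 1 / \<gamma>) / 2"
  obtains K where "K > 0"
    "\<And>T \<phi> Ch. T \<in> borel_measurable borel \<Longrightarrow> (\<And>x. T x > 0) \<Longrightarrow> (\<And>x. T x < 1) \<Longrightarrow>
       \<phi> \<in> borel_measurable borel \<Longrightarrow> (\<And>\<xi>. norm (\<phi> \<xi>) \<le> Ch) \<Longrightarrow>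
       (\<integral>\<^sup>+x. ennreal ((norm (schroedinger_integral a \<gamma> \<phi> (T x) x))\<^sup>2) \<partial>lborel)
         \<le> ennreal K * weighted_energy s \<phi>"
proof -
  obtain K where K: "K > 0"
    "\<And>T h Ch. T \<in> borel_measurable borel \<Longrightarrow> (\<And>x. T x > 0) \<Longrightarrow> (\<And>x. T x < 1) \<Longrightarrow>
       h \<in> borel_measurable borel \<Longrightarrow> (\<And>\<eta>. norm (h \<eta>) \<le> Ch) \<Longrightarrow>
       (\<integral>\<^sup>+x. ennreal ((norm (LINT \<xi>:{0..}|lborel. h \<xi> * osc a x (T x) (T x powr \<gamma>) \<xi>))\<^sup>2) \<partial>lborel)
         \<le> ennreal K * (\<integral>\<^sup>+\<xi>. ennreal ((1 + \<xi>\<^sup>2) powr s * (norm (h \<xi>))\<^sup>2) * indicator {0..} \<xi> \<partial>lborel)"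
    using half_line_bound[OF s] by blast
  have main: "(\<integral>\<^sup>+x. ennreal ((norm (schroedinger_integral a \<gamma> \<phi> (T x) x))\<^sup>2) \<partial>lborel)
         \<le> ennreal (4 * K) * weighted_energy s \<phi>"
    if T [measurable]: "T \<in> borel_measurable borel" and T0: "\<And>x. T x > 0" and T1: "\<And>x. T x < 1"
      and \<phi> [measurable]: "\<phi> \<in> borel_measurable borel" and Ch: "\<And>\<eta>. norm (\<phi> \<eta>) \<le> Ch" for T \<phi> Ch
  proof -
    have Ch0: "Ch \<ge> 0" using Ch norm_ge_zero order_trans by blast
    define R where "R = weighted_energy s \<phi>"
    define u where "u = (\<lambda>x. LINT \<xi>:{0..}|lborel. \<phi> \<xi> * osc a x (T x) (T x powr \<gamma>) \<xi>)"
    define h where "h = (\<lambda>\<xi>. \<phi> (- \<xi>) * indicator {0<..} \<xi>)"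
    \<comment> \<open>The reflected part lives at - x, so its time function has to be reflected as
      well.\<close>
    define T' where "T' = (\<lambda>x. T (- x))"
    define w where "w = (\<lambda>x. LINT \<xi>:{0..}|lborel. h \<xi> * osc a x (T' x) (T' x powr \<gamma>) \<xi>)"
    have [measurable]: "h \<in> borel_measurable borel" "T' \<in> borel_measurable borel"
      unfolding h_def T'_def by measurable
    have [measurable]: "u \<in> borel_measurable borel" "w \<in> borel_measurable borel"
      unfolding u_def w_def set_lebesgue_integral_def by measurable
    have hC: "norm (h \<xi>) \<le> Ch" for \<xi> using Ch[of "- \<xi>"] Ch0 by (auto simp: h_def indicator_def)
    have U: "(\<integral>\<^sup>+x. ennreal ((norm (u x))\<^sup>2) \<partial>lborel) \<le> ennreal K * R"
    proof -
      have "(\<integral>\<^sup>+x. ennreal ((norm (u x))\<^sup>2) \<partial>lborel) \<le>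
        ennreal K * (\<integral>\<^sup>+\<xi>. ennreal ((1 + \<xi>\<^sup>2) powr s * (norm (\<phi> \<xi>))\<^sup>2) * indicator {0..} \<xi> \<partial>lborel)"
        unfolding u_def by (rule K(2)[OF T T0 T1 \<phi> Ch])
      also have "\<dots> \<le> ennreal K * R"
        unfolding R_def by (intro mult_left_mono nn_integral_mono) (auto simp: indicator_def)
      finally show ?thesis .
    qed
    have W: "(\<integral>\<^sup>+x. ennreal ((norm (w (- x)))\<^sup>2) \<partial>lborel) \<le> ennreal K * R"
    proof -
      have "(\<integral>\<^sup>+x. ennreal ((norm (w (- x)))\<^sup>2) \<partial>lborel) = (\<integral>\<^sup>+x. ennreal ((norm (w x))\<^sup>2) \<partial>lborel)"
        using nn_integral_real_affine[of "\<lambda>x. ennreal ((norm (w x))\<^sup>2)" "-1" 0] by simp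
      also have "\<dots> \<le> ennreal K * (\<integral>\<^sup>+\<xi>. ennreal ((1 + \<xi>\<^sup>2) powr s * (norm (h \<xi>))\<^sup>2) * indicator {0..} \<xi> \<partial>lborel)"
        unfolding w_def by (rule K(2)[OF _ _ _ _ hC]) (auto simp: T'_def T0 T1)
      also have "\<dots> \<le> ennreal K * (\<integral>\<^sup>+\<xi>. ennreal ((1 + (- \<xi>)\<^sup>2) powr s * (norm (\<phi> (- \<xi>)))\<^sup>2) \<partial>lborel)"
        by (intro mult_left_mono nn_integral_mono) (auto simp: indicator_def h_def)
      also have "(\<integral>\<^sup>+\<xi>. ennreal ((1 + (- \<xi>)\<^sup>2) powr s * (norm (\<phi> (- \<xi>)))\<^sup>2) \<partial>lborel) = R"
        unfolding R_def
        using nn_integral_real_affine[of "\<lambda>\<xi>. ennreal ((1 + \<xi>\<^sup>2) powr s * (norm (\<phi> \<xi>))\<^sup>2)" "-1" 0] by simp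
      finally show ?thesis .
    qed
    have "(\<integral>\<^sup>+x. ennreal ((norm (schroedinger_integral a \<gamma> \<phi> (T x) x))\<^sup>2) \<partial>lborel)
      \<le> (\<integral>\<^sup>+x. 2 * ennreal ((norm (u x))\<^sup>2) + 2 * ennreal ((norm (w (- x)))\<^sup>2) \<partial>lborel)"
    proof (rule nn_integral_mono)
      fix x
      have "schroedinger_integral a \<gamma> \<phi> (T x) x = u x + w (- x)"
        unfolding u_def w_def h_def T'_def using schroedinger_integral_split[OF a T0 \<phi> Ch] by simp
      hence "(norm (schroedinger_integral a \<gamma> \<phi> (T x) x))\<^sup>2 \<le> (norm (u x) + norm (w (- x)))\<^sup>2"
        by (intro power_mono) (auto intro: norm_triangle_ineq)
      also have "\<dots> \<le> 2 * (norm (u x))\<^sup>2 + 2 * (norm (w (- x)))\<^sup>2"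
        using sum_squares_bound[of "norm (u x)" "norm (w (- x))"] by (simp add: power2_sum)
      finally have "ennreal ((norm (schroedinger_integral a \<gamma> \<phi> (T x) x))\<^sup>2) \<le> ennreal (2 * (norm (u x))\<^sup>2 + 2 * (norm (w (- x)))\<^sup>2)"
        by (rule ennreal_leI)
      thus "ennreal ((norm (schroedinger_integral a \<gamma> \<phi> (T x) x))\<^sup>2) \<le> 2 * ennreal ((norm (u x))\<^sup>2) + 2 * ennreal ((norm (w (- x)))\<^sup>2)"
        by (simp add: ennreal_mult)
    qed
    also have "\<dots> = 2 * (\<integral>\<^sup>+x. ennreal ((norm (u x))\<^sup>2) \<partial>lborel) + 2 * (\<integral>\<^sup>+x. ennreal ((norm (w (- x)))\<^sup>2) \<partial>lborel)"
      by (subst nn_integral_add) (auto simp: nn_integral_cmult)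
    also have "\<dots> \<le> 2 * (ennreal K * R) + 2 * (ennreal K * R)"
      using U W by (intro add_mono mult_left_mono) auto
    also have "\<dots> = ennreal (4 * K) * R"
    proof -
      have "ennreal (4 * K) = 4 * ennreal K" using K(1) by (simp add: ennreal_mult)
      thus ?thesis by (simp add: distrib_right[symmetric] mult.assoc[symmetric])
    qed
    finally show ?thesis by (simp add: R_def)
  qed
  show ?thesis by (rule that[OF _ main]) (use K in auto)
qed

section \<open>From measurable choices of the time to the supremum\<close>

lemma SUP_power2_ennreal:
  fixes v :: "nat \<Rightarrow> ennreal"
  assumes "incseq v"
  shows "(SUP n. v n)\<^sup>2 \<le> (SUP n. (v n)\<^sup>2)"
proof -
  have "(SUP n. v n)\<^sup>2 = (SUP n. SUP m. v m * v n)"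
    unfolding power2_eq_square by (simp add: SUP_mult_left_ennreal SUP_mult_right_ennreal)
  also have "\<dots> \<le> (SUP n. (v n)\<^sup>2)"
  proof (intro SUP_least)
    fix n m
    have "v m * v n \<le> v (max m n) * v (max m n)"
      using assms by (intro mult_mono) (auto simp: incseq_def)
    also have "\<dots> \<le> (SUP n. (v n)\<^sup>2)" unfolding power2_eq_square by (rule SUP_upper) simp
    finally show "v m * v n \<le> (SUP n. (v n)\<^sup>2)" .
  qed
  finally show ?thesis .
qed

text \<open>Continuity in t by dominated convergence. The rationals approach t from above, because
  then the damping at time t dominates all approximants.\<close>

lemma schroedinger_integral_rational_times:
  assumes a: "a > 1" and \<gamma>: "\<gamma> > 0" and t: "0 < t" "t < 1"
    and \<phi> [measurable]: "\<phi> \<in> borel_measurable borel" and Ch: "\<And>\<xi>. norm (\<phi> \<xi>) \<le> Ch"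
  shows "ennreal (norm (schroedinger_integral a \<gamma> \<phi> t x))
    \<le> (SUP r\<in>\<rat> \<inter> {0<..<1}. ennreal (norm (schroedinger_integral a \<gamma> \<phi> r x)))"
proof -
  have Ch0: "Ch \<ge> 0" using Ch norm_ge_zero order_trans by blast
  have "\<exists>r\<in>\<rat>. t < r \<and> r < min 1 (t + inverse (real (Suc n)))" for n
    using t by (intro Rats_dense_in_real) auto
  then obtain r where r: "\<And>n. r n \<in> \<rat>" "\<And>n. t < r n" "\<And>n. r n < min 1 (t + inverse (real (Suc n)))"
    by metis
  have rt: "r \<longlonglongrightarrow> t"
  proof (rule tendsto_sandwich[of "\<lambda>_. t" _ _ "\<lambda>n. t + inverse (real (Suc n))"])
    show "(\<lambda>n. t + inverse (real (Suc n))) \<longlonglongrightarrow> t"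
      using tendsto_add[OF tendsto_const LIMSEQ_inverse_real_of_nat, of t] by simp
  qed (use r in \<open>auto intro!: always_eventually less_imp_le simp: min_less_iff_conj\<close>)
  have "(\<lambda>n. schroedinger_integral a \<gamma> \<phi> (r n) x) \<longlonglongrightarrow> schroedinger_integral a \<gamma> \<phi> t x"
    unfolding schroedinger_integral_def schroedinger_integrand_eq
  proof (rule integral_dominated_convergence[where w = "\<lambda>\<xi>. Ch * exp (- (t powr \<gamma> * \<bar>\<xi>\<bar> powr a))"])
    show "integrable lborel (\<lambda>\<xi>. Ch * exp (- (t powr \<gamma> * \<bar>\<xi>\<bar> powr a)))"
      using t a by (intro integrable_mult_right integrable_exp_powr) auto
    show "AE \<xi> in lborel. (\<lambda>n. \<phi> \<xi> * osc a (x * sgn \<xi>) (r n) (r n powr \<gamma>) \<bar>\<xi>\<bar>) \<longlonglongrightarrow> \<phi> \<xi> * osc a (x * sgn \<xi>) t (t powr \<gamma>) \<bar>\<xi>\<bar>"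
      unfolding osc_def using rt t by (intro AE_I2 tendsto_intros) auto
    show "AE \<xi> in lborel. norm (\<phi> \<xi> * osc a (x * sgn \<xi>) (r n) (r n powr \<gamma>) \<bar>\<xi>\<bar>) \<le> Ch * exp (- (t powr \<gamma> * \<bar>\<xi>\<bar> powr a))" for n
    proof (rule AE_I2)
      fix \<xi> :: real
      have "t powr \<gamma> \<le> r n powr \<gamma>" using t r(2)[of n] \<gamma> by (intro powr_mono2) auto
      hence "exp (- (r n powr \<gamma> * \<bar>\<xi>\<bar> powr a)) \<le> exp (- (t powr \<gamma> * \<bar>\<xi>\<bar> powr a))"
        by (simp add: mult_right_mono)
      thus "norm (\<phi> \<xi> * osc a (x * sgn \<xi>) (r n) (r n powr \<gamma>) \<bar>\<xi>\<bar>) \<le> Ch * exp (- (t powr \<gamma> * \<bar>\<xi>\<bar> powr a))"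
        unfolding norm_mult norm_osc using Ch Ch0 by (intro mult_mono) auto
    qed
  qed measurable
  hence "(\<lambda>n. ennreal (norm (schroedinger_integral a \<gamma> \<phi> (r n) x))) \<longlonglongrightarrow> ennreal (norm (schroedinger_integral a \<gamma> \<phi> t x))"
    by (intro tendsto_intros)
  thus ?thesis
  proof (rule LIMSEQ_le_const2)
    have "ennreal (norm (schroedinger_integral a \<gamma> \<phi> (r n) x)) \<le> (SUP r\<in>\<rat> \<inter> {0<..<1}. ennreal (norm (schroedinger_integral a \<gamma> \<phi> r x)))" for n
      using r t by (intro SUP_upper) (auto simp: min_less_iff_conj intro: less_trans)
    thus "\<exists>N. \<forall>n\<ge>N. ennreal (norm (schroedinger_integral a \<gamma> \<phi> (r n) x)) \<le> (SUP r\<in>\<rat> \<inter> {0<..<1}. ennreal (norm (schroedinger_integral a \<gamma> \<phi> r x)))"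
      by blast
  qed
qed

text \<open>The supremum over rational times is an increasing limit of linearised operators whose
  bounds share one constant, so monotone convergence finishes the argument.\<close>

lemma (in unit_scale_estimate) maximal_function_bound:
  assumes s: "s > 0" "2 * s > a * max 0 (1 - 1 / \<gamma>) / 2"
  obtains K where "K > 0"
    "\<And>\<phi> Ch. \<phi> \<in> borel_measurable borel \<Longrightarrow> (\<And>\<xi>. norm (\<phi> \<xi>) \<le> Ch) \<Longrightarrow>
       (\<integral>\<^sup>+x. (SUP t\<in>{0<..<1}. ennreal (norm (schroedinger_integral a \<gamma> \<phi> t x)))\<^sup>2 \<partial>lborel)
         \<le> ennreal K * weighted_energy s \<phi>"
proof -
  obtain K where K: "K > 0"
    "\<And>T \<phi> Ch. T \<in> borel_measurable borel \<Longrightarrow> (\<And>x. T x > 0) \<Longrightarrow> (\<And>x. T x < 1) \<Longrightarrow>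
       \<phi> \<in> borel_measurable borel \<Longrightarrow> (\<And>\<xi>. norm (\<phi> \<xi>) \<le> Ch) \<Longrightarrow>
       (\<integral>\<^sup>+x. ennreal ((norm (schroedinger_integral a \<gamma> \<phi> (T x) x))\<^sup>2) \<partial>lborel)
         \<le> ennreal K * weighted_energy s \<phi>"
    using linearised_bound[OF s] by blast
  have main: "(\<integral>\<^sup>+x. (SUP t\<in>{0<..<1}. ennreal (norm (schroedinger_integral a \<gamma> \<phi> t x)))\<^sup>2 \<partial>lborel)
         \<le> ennreal K * weighted_energy s \<phi>"
    if \<phi> [measurable]: "\<phi> \<in> borel_measurable borel" and Ch: "\<And>\<eta>. norm (\<phi> \<eta>) \<le> Ch" for \<phi> Ch
  proof -
    define D :: "real set" where "D = \<rat> \<inter> {0<..<1}"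
    have D: "countable D" "1/2 \<in> D" by (auto simp: D_def countable_rat)
    define \<tau> where "\<tau> = from_nat_into D"
    have \<tau>D: "range \<tau> = D" unfolding \<tau>_def using D by (intro range_from_nat_into) auto
    have \<tau>01: "0 < \<tau> n" "\<tau> n < 1" for n using \<tau>D by (auto simp: D_def)
    let ?P = "\<lambda>t x. norm (schroedinger_integral a \<gamma> \<phi> t x)"
    \<comment> \<open>\<open>T n x\<close> is a best time at x among the first n + 1 rationals, the
      current one being replaced only by a strictly better one. The recursion makes measurability
      and monotonicity immediate.\<close>
    define T where "T = rec_nat (\<lambda>x. \<tau> 0) (\<lambda>n Tn x. if ?P (Tn x) x < ?P (\<tau> (Suc n)) x then \<tau> (Suc n) else Tn x)"
    have T_0: "T 0 = (\<lambda>x. \<tau> 0)" by (simp add: T_def)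
    have T_Suc: "T (Suc n) = (\<lambda>x. if ?P (T n x) x < ?P (\<tau> (Suc n)) x then \<tau> (Suc n) else T n x)" for n
      unfolding T_def by simp
    have Tm [measurable]: "T n \<in> borel_measurable borel" for n
    proof (induction n)
      case (Suc n)
      note Suc [measurable]
      show ?case unfolding T_Suc by measurable
    qed (simp add: T_0)
    have T01: "0 < T n x \<and> T n x < 1" for n x
      by (induction n) (auto simp: T_0 T_Suc \<tau>01)
    have inc: "?P (T n x) x \<le> ?P (T (Suc n) x) x" for n x by (simp add: T_Suc)
    have ge: "?P (\<tau> n) x \<le> ?P (T n x) x" for n x by (cases n) (auto simp: T_0 T_Suc)
    have "(SUP t\<in>{0<..<1}. ennreal (?P t x))\<^sup>2 \<le> (SUP n. ennreal ((?P (T n x) x)\<^sup>2))" for x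
    proof -
      have "(SUP t\<in>{0<..<1}. ennreal (?P t x)) \<le> (SUP n. ennreal (?P (T n x) x))"
      proof (rule SUP_least)
        fix t :: real assume "t \<in> {0<..<1}"
        hence "ennreal (?P t x) \<le> (SUP r\<in>D. ennreal (?P r x))"
          unfolding D_def by (intro schroedinger_integral_rational_times[OF a \<gamma> _ _ \<phi> Ch]) auto
        also have "\<dots> \<le> (SUP n. ennreal (?P (T n x) x))"
          unfolding \<tau>D[symmetric] using ge by (auto intro!: SUP_mono ennreal_leI)
        finally show "ennreal (?P t x) \<le> (SUP n. ennreal (?P (T n x) x))" .
      qed
      hence "(SUP t\<in>{0<..<1}. ennreal (?P t x))\<^sup>2 \<le> (SUP n. ennreal (?P (T n x) x))\<^sup>2"
        by (intro power_mono) auto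
      also have "\<dots> \<le> (SUP n. (ennreal (?P (T n x) x))\<^sup>2)"
        by (rule SUP_power2_ennreal) (auto intro!: incseq_SucI ennreal_leI inc)
      finally show ?thesis by (simp add: ennreal_power)
    qed
    hence "(\<integral>\<^sup>+x. (SUP t\<in>{0<..<1}. ennreal (?P t x))\<^sup>2 \<partial>lborel) \<le> (\<integral>\<^sup>+x. (SUP n. ennreal ((?P (T n x) x)\<^sup>2)) \<partial>lborel)"
      by (intro nn_integral_mono)
    also have "\<dots> = (SUP n. \<integral>\<^sup>+x. ennreal ((?P (T n x) x)\<^sup>2) \<partial>lborel)"
    proof (rule nn_integral_monotone_convergence_SUP)
      show "incseq (\<lambda>n x. ennreal ((?P (T n x) x)\<^sup>2))"
        by (intro incseq_SucI le_funI ennreal_leI power_mono inc) auto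
    qed measurable
    also have "\<dots> \<le> ennreal K * weighted_energy s \<phi>"
      using T01 by (intro SUP_least K(2)[OF Tm _ _ \<phi> Ch]) auto
    finally show ?thesis .
  qed
  show ?thesis by (rule that[OF K(1) main])
qed

section \<open>Return to the norms of the statement\<close>

lemma esqrt_mono: "u \<le> v \<Longrightarrow> esqrt u \<le> esqrt v"
  by (cases u; cases v) (auto simp: esqrt_def top_unique intro!: ennreal_leI)

lemma esqrt_mult:
  assumes "K > 0"
  shows "esqrt (ennreal K * u) = ennreal (sqrt K) * esqrt u"
  using assms
  by (cases u) (auto simp: esqrt_def ennreal_mult_top real_sqrt_mult ennreal_mult ennreal_mult_eq_top_iff enn2real_mult)

text \<open>Supplies the bound \<open>Ch\<close> that is uniform in the frequency; its size never
  enters a constant.\<close>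

lemma norm_fourier_le: "norm (fourier f \<xi>) \<le> (LINT x|lborel. norm (f x))"
proof -
  have "norm (fourier f \<xi>) \<le> (LINT x|lborel. norm (f x * exp (- \<i> * of_real (x * \<xi>))))"
    unfolding fourier_def by (rule integral_norm_bound)
  thus ?thesis by (simp add: norm_mult)
qed

lemma maximal_bound_if_above_critical:
  assumes "a > 1" "\<gamma> > 0" and s: "s > 0" "s > 1 / 4 * a * max 0 (1 - 1 / \<gamma>)"
  shows "maximal_bound a \<gamma> s"
proof -
  obtain C where "unit_scale_estimate a \<gamma> C"
    using unit_scale_bound[OF assms(1,2)] by blast
  then interpret unit_scale_estimate a \<gamma> C .
  obtain K where K: "K > 0"
    "\<And>\<phi> Ch. \<phi> \<in> borel_measurable borel \<Longrightarrow> (\<And>\<xi>. norm (\<phi> \<xi>) \<le> Ch) \<Longrightarrow>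
       (\<integral>\<^sup>+x. (SUP t\<in>{0<..<1}. ennreal (norm (schroedinger_integral a \<gamma> \<phi> t x)))\<^sup>2 \<partial>lborel)
         \<le> ennreal K * weighted_energy s \<phi>"
    using maximal_function_bound[of s] s by auto
  have "L2_norm (P_max a \<gamma> f) \<le> ennreal (sqrt K) * sobolev_norm s f" if f: "f \<in> schwartz_space" for f
  proof -
    \<comment> \<open>The case n = 0 yields continuity of f, hence measurability of its Fourier
      transform.\<close>
    have "iterated_deriv 0 f differentiable (at x)" for x using f by (simp add: schwartz_space_def)
    hence "f differentiable (at x)" for x by (simp add: iterated_deriv_def)
    hence "continuous_on UNIV f"
      by (auto intro!: continuous_at_imp_continuous_on differentiable_imp_continuous_within)
    hence [measurable]: "f \<in> borel_measurable borel" by (rule borel_measurable_continuous_onI)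
    have m: "fourier f \<in> borel_measurable borel" unfolding fourier_def[abs_def] by measurable
    have "L2_norm (P_max a \<gamma> f) \<le> esqrt (ennreal K * weighted_energy s (fourier f))"
      unfolding L2_norm_def P_max_def P_op_eq by (intro esqrt_mono K(2)[OF m norm_fourier_le])
    also have "\<dots> = ennreal (sqrt K) * sobolev_norm s f"
      unfolding sobolev_norm_def by (rule esqrt_mult[OF K(1)])
    finally show ?thesis .
  qed
  thus ?thesis unfolding maximal_bound_def by blast
qed

section \<open>Wave packets and the lower bound\<close>

definition wave_packet :: "real \<Rightarrow> real \<Rightarrow> real \<Rightarrow> complex" where
  "wave_packet N L x = exp (\<i> * of_real (N * x) - of_real (L\<^sup>2 / 2 * x\<^sup>2))"

lemma poly_times_gaussian_bounded:
  fixes p :: "complex poly"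
  assumes "c > 0"
  shows "\<exists>B. \<forall>x. norm (poly p (of_real x)) * exp (- (c * x\<^sup>2)) \<le> B"
  using assms
proof (induction p arbitrary: c)
  case (pCons q p)
  \<comment> \<open>Half of the Gaussian controls the shorter polynomial, the other half the
    additional factor x; this is why the induction is over all c.\<close>
  obtain B where B: "\<And>x. norm (poly p (of_real x)) * exp (- (c / 2 * x\<^sup>2)) \<le> B"
    using pCons.IH[of "c / 2"] pCons.prems by auto
  obtain C where C: "C > 0" "\<And>u. u \<ge> 0 \<Longrightarrow> (1 + u) powr 1 * exp (- (c / 2 * u)) \<le> C"
    using one_plus_powr_exp_bounded[of "c / 2" 1] pCons.prems by auto
  have "norm (poly (pCons q p) (of_real x)) * exp (- (c * x\<^sup>2)) \<le> norm q + C * B" for x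
  proof -
    have "\<bar>x\<bar> \<le> 1 + x\<^sup>2"
      using sum_squares_bound[of 1 "\<bar>x\<bar>"] by simp
    hence "\<bar>x\<bar> * exp (- (c / 2 * x\<^sup>2)) \<le> (1 + x\<^sup>2) * exp (- (c / 2 * x\<^sup>2))" by (rule mult_right_mono) auto
    also have "\<dots> \<le> C" using C(2)[of "x\<^sup>2"] by (simp add: abs_of_nonneg)
    finally have 1: "\<bar>x\<bar> * exp (- (c / 2 * x\<^sup>2)) \<le> C" .
    have e: "exp (- (c * x\<^sup>2)) = exp (- (c / 2 * x\<^sup>2)) * exp (- (c / 2 * x\<^sup>2))" by (simp flip: exp_add)
    have "norm (poly (pCons q p) (of_real x)) \<le> norm q + \<bar>x\<bar> * norm (poly p (of_real x))"
      using norm_triangle_ineq[of q "of_real x * poly p (of_real x)"] by (simp add: norm_mult)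
    hence "norm (poly (pCons q p) (of_real x)) * exp (- (c * x\<^sup>2))
        \<le> (norm q + \<bar>x\<bar> * norm (poly p (of_real x))) * exp (- (c * x\<^sup>2))"
      by (rule mult_right_mono) simp
    also have "\<dots> = norm q * exp (- (c * x\<^sup>2)) + (\<bar>x\<bar> * exp (- (c / 2 * x\<^sup>2))) * (norm (poly p (of_real x)) * exp (- (c / 2 * x\<^sup>2)))"
      unfolding e by (simp add: algebra_simps)
    also have "\<dots> \<le> norm q * 1 + C * B"
      using 1 B[of x] C(1) pCons.prems by (intro add_mono mult_mono mult_left_mono) auto
    finally show ?thesis by simp
  qed
  thus ?case by blast
qed (auto intro!: exI[of _ 0])

text \<open>The logarithmic derivative of the packet is the polynomial \<open>b\<close>, so every
  iterated derivative is a polynomial times the packet; differentiation maps p to p' + p b.\<close>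

lemma wave_packet_schwartz:
  assumes "L > 0"
  shows "wave_packet N L \<in> schwartz_space"
proof -
  define E where "E = wave_packet N L"
  define b where "b = [:\<i> * of_real N, - of_real (L\<^sup>2):]"
  have dE: "((\<lambda>x. poly p (of_real x) * E x) has_vector_derivative (poly (pderiv p + p * b) (of_real x) * E x)) (at x)" for p x
  proof -
    have "((\<lambda>x. \<i> * complex_of_real (N * x) - of_real (L\<^sup>2 / 2 * x\<^sup>2)) has_vector_derivative
        \<i> * of_real N - of_real (L\<^sup>2 * x)) (at x)"
      by (intro has_vector_derivative_diff has_vector_derivative_mult_right has_vector_derivative_of_real)
         (auto intro!: derivative_eq_intros)
    note 1 = exp_has_vector_derivative[OF this]
    have "((\<lambda>x. poly p (complex_of_real x)) has_vector_derivative 1 * poly (pderiv p) (of_real x)) (at x)"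
      using field_vector_diff_chain_at[of complex_of_real 1 x "poly p" "poly (pderiv p) (of_real x)"]
      by (simp add: o_def poly_DERIV has_vector_derivative_of_real[where f = "\<lambda>x. x" and D = 1, simplified])
    from has_vector_derivative_mult[OF this 1]
    show ?thesis unfolding E_def wave_packet_def
      by (rule has_vector_derivative_eq_rhs) (simp add: b_def algebra_simps)
  qed
  have "\<exists>p. iterated_deriv n E = (\<lambda>x. poly p (of_real x) * E x)" for n
  proof (induction n)
    case 0
    show ?case by (rule exI[of _ 1]) (simp add: iterated_deriv_def)
  next
    case (Suc n)
    then obtain p where p: "iterated_deriv n E = (\<lambda>x. poly p (of_real x) * E x)" by blast
    have "iterated_deriv (Suc n) E = (\<lambda>x. vector_derivative (iterated_deriv n E) (at x))"
      by (simp add: iterated_deriv_def)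
    also have "\<dots> = (\<lambda>x. poly (pderiv p + p * b) (of_real x) * E x)"
      unfolding p by (intro ext vector_derivative_at dE)
    finally show ?case by blast
  qed
  then obtain p where p: "\<And>n. iterated_deriv n E = (\<lambda>x. poly (p n) (of_real x) * E x)" by metis
  have "iterated_deriv n E differentiable (at x)" for n x
    unfolding p by (rule differentiableI_vector[OF dE])
  moreover have "bounded (range (\<lambda>x. x ^ k *\<^sub>R iterated_deriv n E x))" for k n
  proof -
    obtain B where B: "\<And>x. norm (poly (monom 1 k * p n) (complex_of_real x)) * exp (- (L\<^sup>2 / 2 * x\<^sup>2)) \<le> B"
      using poly_times_gaussian_bounded[of "L\<^sup>2 / 2" "monom 1 k * p n"] assms by auto
    have "norm (x ^ k *\<^sub>R iterated_deriv n E x) = norm (poly (monom 1 k * p n) (complex_of_real x)) * norm (E x)" for x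
      by (simp add: p norm_mult poly_monom norm_power power_abs)
    moreover have "norm (E x) = exp (- (L\<^sup>2 / 2 * x\<^sup>2))" for x
      by (simp add: E_def wave_packet_def norm_exp)
    ultimately have "norm (x ^ k *\<^sub>R iterated_deriv n E x) \<le> B" for x
      using B[of x] by simp
    thus ?thesis by (auto simp: bounded_iff)
  qed
  ultimately show ?thesis unfolding schwartz_space_def E_def by blast
qed

text \<open>After y = L x this is the characteristic function of the standard normal distribution at
  (N - \<xi>) / L.\<close>

lemma fourier_wave_packet:
  assumes "L > 0"
  shows "fourier (wave_packet N L) \<xi> = of_real (sqrt (2 * pi) / L * exp (- ((\<xi> - N) / L)\<^sup>2 / 2))"
proof -
  define t where "t = (N - \<xi>) / L"
  have "fourier (wave_packet N L) \<xi> = (1 / L) *\<^sub>R (\<integral>y. wave_packet N L (y / L) * exp (- \<i> * of_real (y / L * \<xi>)) \<partial>lborel)"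
    unfolding fourier_def using assms
    by (subst lborel_integral_real_affine[where c = "1 / L" and t = 0]) auto
  also have "(\<integral>y. wave_packet N L (y / L) * exp (- \<i> * of_real (y / L * \<xi>)) \<partial>lborel)
     = (\<integral>y. of_real (sqrt (2 * pi)) * (std_normal_density y *\<^sub>R exp (\<i> * of_real (t * y))) \<partial>lborel)"
  proof (intro Bochner_Integration.integral_cong refl)
    fix y
    have arg: "N * (y / L) - y / L * \<xi> = t * y" using assms by (simp add: t_def field_simps)
    have sq: "L\<^sup>2 / 2 * (y / L)\<^sup>2 = y\<^sup>2 / 2" using assms by (simp add: power_divide)
    have "wave_packet N L (y / L) * exp (- \<i> * of_real (y / L * \<xi>))
       = exp (\<i> * of_real (N * (y / L) - y / L * \<xi>) + of_real (- (y\<^sup>2 / 2)))"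
      unfolding wave_packet_def sq mult_exp_exp by (simp add: algebra_simps)
    also have "\<dots> = exp (\<i> * of_real (t * y)) * of_real (exp (- (y\<^sup>2 / 2)))"
      unfolding arg exp_add exp_of_real ..
    also have "exp (- (y\<^sup>2 / 2)) = sqrt (2 * pi) * std_normal_density y"
      by (simp add: std_normal_density_def)
    finally show "wave_packet N L (y / L) * exp (- \<i> * of_real (y / L * \<xi>))
       = of_real (sqrt (2 * pi)) * (std_normal_density y *\<^sub>R exp (\<i> * of_real (t * y)))"
      by (simp add: scaleR_conv_of_real)
  qed
  also have "\<dots> = of_real (sqrt (2 * pi)) * (\<integral>y. std_normal_density y *\<^sub>R exp (\<i> * of_real (t * y)) \<partial>lborel)"
    by (rule Bochner_Integration.integral_mult_right_zero)
  also have "(\<integral>y. std_normal_density y *\<^sub>R exp (\<i> * of_real (t * y)) \<partial>lborel) = char std_normal_distribution t"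
    unfolding char_def by (subst integral_density) auto
  also have "\<dots> = of_real (exp (- (t\<^sup>2) / 2))"
    by (simp add: char_std_normal_distribution)
  also have "t\<^sup>2 = ((\<xi> - N) / L)\<^sup>2" by (simp add: t_def power_divide power2_commute)
  finally show ?thesis by (simp add: scaleR_conv_of_real)
qed

text \<open>The first bound is for frequencies near N, the second for the tails of the packet, where
  the phase error is out of control.\<close>

lemma norm_exp_damped_minus_1_le:
  fixes \<theta> \<delta> :: real
  assumes "\<delta> \<ge> 0"
  shows "norm (exp (\<i> * of_real \<theta>) * of_real (exp (- \<delta>)) - 1) \<le> \<bar>\<theta>\<bar> + \<delta>"
    and "norm (exp (\<i> * of_real \<theta>) * of_real (exp (- \<delta>)) - 1) \<le> 2"
proof -
  have "exp (\<i> * of_real \<theta>) * of_real (exp (- \<delta>)) - 1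
     = (exp (\<i> * of_real \<theta>) - 1) * of_real (exp (- \<delta>)) + of_real (exp (- \<delta>) - 1)"
    by (simp add: algebra_simps)
  hence "norm (exp (\<i> * of_real \<theta>) * of_real (exp (- \<delta>)) - 1)
     \<le> norm ((exp (\<i> * of_real \<theta>) - 1) * of_real (exp (- \<delta>))) + norm (complex_of_real (exp (- \<delta>) - 1))"
    by (metis norm_triangle_ineq)
  also have "norm ((exp (\<i> * of_real \<theta>) - 1) * of_real (exp (- \<delta>))) \<le> \<bar>\<theta>\<bar> * 1"
    unfolding norm_mult using iexp_approx1[of \<theta> 0] assms by (intro mult_mono) auto
  also have "norm (complex_of_real (exp (- \<delta>) - 1)) \<le> \<delta>"
    unfolding norm_of_real using exp_ge_add_one_self[of "- \<delta>"] assms by simp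
  finally show "norm (exp (\<i> * of_real \<theta>) * of_real (exp (- \<delta>)) - 1) \<le> \<bar>\<theta>\<bar> + \<delta>" by simp
  have "norm (exp (\<i> * of_real \<theta>) * of_real (exp (- \<delta>)) - 1) \<le> norm (exp (\<i> * of_real \<theta>) * of_real (exp (- \<delta>))) + norm (1::complex)"
    by (rule norm_triangle_ineq4)
  also have "\<dots> \<le> 1 + 1" unfolding norm_mult using assms by (intro add_mono) auto
  finally show "norm (exp (\<i> * of_real \<theta>) * of_real (exp (- \<delta>)) - 1) \<le> 2" by simp
qed

text \<open>By homogeneity it suffices to expand r^a at r = 1 for r = \<xi> / N between 1/2 and 3/2,
  away from the singularity at 0. Two applications of the mean value inequality give the
  second-order remainder.\<close>

lemma powr_taylor_remainder:
  fixes a N \<xi> :: real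
  assumes "a > 1" "N > 0" "\<bar>\<xi> - N\<bar> \<le> N / 2"
  shows "\<bar>\<xi> powr a - N powr a - a * N powr (a - 1) * (\<xi> - N)\<bar>
    \<le> a * (a - 1) * 3 powr \<bar>a - 2\<bar> * (N powr (a - 2) * (\<xi> - N)\<^sup>2)"
proof -
  define r where "r = \<xi> / N"
  have "N / 2 \<le> \<xi>" "\<xi> \<le> 3 / 2 * N" using assms(3) by linarith+
  hence r: "r \<in> {1/2..3/2}" using assms(2) by (simp add: r_def pos_le_divide_eq pos_divide_le_eq)
  let ?S = "{1/2..3/2::real}"
  define B where "B = (a - 1) * 3 powr \<bar>a - 2\<bar>"
  have B0: "B \<ge> 0" using assms by (simp add: B_def)
  have 1: "\<bar>y powr (a - 1) - 1\<bar> \<le> B * \<bar>y - 1\<bar>" if y: "y \<in> ?S" for y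
  proof -
    have "norm (y powr (a - 1) - 1 powr (a - 1)) \<le> B * norm (y - 1)"
    proof (rule field_differentiable_bound[of ?S "\<lambda>y. y powr (a - 1)" "\<lambda>y. (a - 1) * y powr (a - 1 - 1)"])
      fix z assume z: "z \<in> ?S"
      show "((\<lambda>y. y powr (a - 1)) has_real_derivative (a - 1) * z powr (a - 1 - 1)) (at z within ?S)"
        using z by (intro DERIV_powr_const) auto
      show "norm ((a - 1) * z powr (a - 1 - 1)) \<le> B"
        using z assms powr_bounds_half_three(1)[of z "a - 2"] by (simp add: B_def abs_mult)
    qed (use y in auto)
    thus ?thesis by simp
  qed
  let ?T = "closed_segment 1 r"
  have T: "?T \<subseteq> ?S" using r by (intro closed_segment_subset) auto
  \<comment> \<open>On the segment from 1 to r no point is further from 1 than r, so the first-order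
    estimate bounds the derivative by a constant times |r - 1|.\<close>
  have "norm ((r powr a - a * r) - (1 powr a - a * 1)) \<le> (a * (B * \<bar>r - 1\<bar>)) * norm (r - 1)"
  proof (rule field_differentiable_bound[of ?T "\<lambda>y. y powr a - a * y" "\<lambda>y. a * y powr (a - 1) - a"])
    fix z assume z: "z \<in> ?T"
    hence zS: "z \<in> ?S" using T by auto
    show "((\<lambda>y. y powr a - a * y) has_real_derivative a * z powr (a - 1) - a) (at z within ?T)"
      using zS by (auto intro!: derivative_eq_intros DERIV_powr_const)
    have "\<bar>z - 1\<bar> \<le> \<bar>r - 1\<bar>" using z by (auto simp: closed_segment_eq_real_ivl split: if_splits)
    hence "\<bar>z powr (a - 1) - 1\<bar> \<le> B * \<bar>r - 1\<bar>" using 1[OF zS] B0 mult_left_mono order_trans by blast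
    hence "a * \<bar>z powr (a - 1) - 1\<bar> \<le> a * (B * \<bar>r - 1\<bar>)" using assms by (intro mult_left_mono) auto
    moreover have "a * z powr (a - 1) - a = a * (z powr (a - 1) - 1)" by (simp add: algebra_simps)
    hence "norm (a * z powr (a - 1) - a) = a * \<bar>z powr (a - 1) - 1\<bar>"
      using assms by (simp only: real_norm_def abs_mult)
    ultimately show "norm (a * z powr (a - 1) - a) \<le> a * (B * \<bar>r - 1\<bar>)" by simp
  qed auto
  hence main: "\<bar>r powr a - 1 - a * (r - 1)\<bar> \<le> a * B * (r - 1)\<^sup>2"
    by (simp add: algebra_simps power2_eq_square abs_mult_self_eq)
  have \<xi>: "\<xi> = N * r" using assms by (simp add: r_def)
  have "\<xi> powr a = N powr a * r powr a" unfolding \<xi> using assms r by (simp add: powr_mult)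
  moreover have "a * N powr (a - 1) * (\<xi> - N) = N powr a * (a * (r - 1))"
    using assms by (simp add: \<xi> powr_diff field_simps)
  ultimately have "\<bar>\<xi> powr a - N powr a - a * N powr (a - 1) * (\<xi> - N)\<bar> = \<bar>N powr a * (r powr a - 1 - a * (r - 1))\<bar>"
    by (simp add: algebra_simps)
  also have "\<dots> \<le> N powr a * (a * B * (r - 1)\<^sup>2)"
    unfolding abs_mult using main by (intro mult_mono) auto
  also have "\<dots> = a * B * (N powr (a - 2) * (\<xi> - N)\<^sup>2)"
  proof -
    have "(\<xi> - N)\<^sup>2 = N\<^sup>2 * (r - 1)\<^sup>2" by (simp add: \<xi> power2_eq_square algebra_simps)
    moreover have "N powr a = N powr (a - 2) * N\<^sup>2" using assms by (simp add: powr_diff powr_numeral)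
    ultimately show ?thesis by simp
  qed
  finally show ?thesis by (simp add: B_def mult.assoc)
qed

text \<open>For \<open>x = - t a N\<^bsup>a-1\<^esup>\<close> the linear part of the phase cancels, so the packet has
  hardly dispersed at this point as long as the three error terms are small.\<close>
lemma wave_packet_evolution_lower:
  assumes a: "a > 1" and \<gamma>: "\<gamma> > 0" and N: "N > 0" and L: "L > 0" and t: "t > 0"
  defines "Ca \<equiv> a * (a - 1) * 3 powr \<bar>a - 2\<bar>"
  shows "norm (schroedinger_integral a \<gamma> (fourier (wave_packet N L)) t (- (t * a * N powr (a - 1))))
    \<ge> 2 * pi * (1 - (Ca * (t * N powr (a - 2) * L\<^sup>2) + 8 * L\<^sup>2 / N\<^sup>2 + 2 powr a * (t powr \<gamma> * N powr a)))"
proof -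
  define x where "x = - (t * a * N powr (a - 1))"
  define \<theta> where "\<theta> = (\<lambda>u. t * (\<bar>N + L * u\<bar> powr a - N powr a - a * N powr (a - 1) * (L * u)))"
  define \<delta> where "\<delta> = (\<lambda>u. t powr \<gamma> * \<bar>N + L * u\<bar> powr a)"
  define m where "m = (\<lambda>u. exp (\<i> * complex_of_real (\<theta> u)) * of_real (exp (- \<delta> u)))"
  define \<omega> where "\<omega> = exp (\<i> * complex_of_real (t * N powr a + x * N))"
  \<comment> \<open>The coefficient of u^2 in the error: dispersion from the Taylor remainder, plus
    the tail |L u| > N / 2, where the crude bound 2 is at most 8 L^2 u^2 / N^2. Damping gives the
    constant error \<open>e2\<close>, with 2^a because frequencies up to 2 N are allowed.\<close>
  define e1 where "e1 = Ca * (t * N powr (a - 2) * L\<^sup>2) + 8 * L\<^sup>2 / N\<^sup>2"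
  define e2 where "e2 = 2 powr a * (t powr \<gamma> * N powr a)"
  have Ca: "Ca \<ge> 0" using a by (simp add: Ca_def)
  have e: "e1 \<ge> 0" "e2 \<ge> 0" using Ca t by (simp_all add: e1_def e2_def)
  have \<delta>0: "\<delta> u \<ge> 0" for u by (simp add: \<delta>_def)
  have [measurable]: "m \<in> borel_measurable borel" unfolding m_def \<theta>_def \<delta>_def by measurable
  have mle: "norm (m u - 1) \<le> e1 * u\<^sup>2 + e2" for u
  proof (cases "\<bar>L * u\<bar> \<le> N / 2")
    case True
    have pos: "N + L * u > 0" using True N by linarith
    have "\<bar>\<theta> u\<bar> \<le> t * (Ca * (N powr (a - 2) * (L * u)\<^sup>2))"
      using powr_taylor_remainder[OF a N, of "N + L * u"] True t pos
      by (simp add: \<theta>_def abs_mult Ca_def)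
    also have "\<dots> = Ca * (t * N powr (a - 2) * L\<^sup>2) * u\<^sup>2" by (simp add: power_mult_distrib mult_ac)
    also have "\<dots> \<le> e1 * u\<^sup>2" unfolding e1_def by (intro mult_right_mono) auto
    finally have 1: "\<bar>\<theta> u\<bar> \<le> e1 * u\<^sup>2" .
    have "\<bar>N + L * u\<bar> powr a \<le> (2 * N) powr a" using True pos a by (intro powr_mono2) auto
    hence "\<delta> u \<le> t powr \<gamma> * (2 * N) powr a" unfolding \<delta>_def by (intro mult_left_mono) auto
    also have "\<dots> = e2" using N by (simp add: e2_def powr_mult)
    finally have 2: "\<delta> u \<le> e2" .
    show ?thesis using norm_exp_damped_minus_1_le(1)[OF \<delta>0, of "\<theta> u" u] 1 2 unfolding m_def by linarith
  next
    case False
    have "(N / 2)\<^sup>2 \<le> \<bar>L * u\<bar>\<^sup>2" using False N by (intro power_mono) auto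
    hence "2 \<le> 8 * L\<^sup>2 / N\<^sup>2 * u\<^sup>2" using N by (simp add: field_simps power_mult_distrib)
    also have "\<dots> \<le> e1 * u\<^sup>2" unfolding e1_def using Ca t by (intro mult_right_mono) auto
    finally show ?thesis using norm_exp_damped_minus_1_le(2)[OF \<delta>0, of "\<theta> u" u] e(2) unfolding m_def by linarith
  qed
  have i0: "integrable lborel std_normal_density" and I0: "integral\<^sup>L lborel std_normal_density = 1"
    using std_normal_moment_even[of 0] by (auto simp: has_bochner_integral_iff)
  have i2: "integrable lborel (\<lambda>u. std_normal_density u * u\<^sup>2)" and I2: "(\<integral>u. std_normal_density u * u\<^sup>2 \<partial>lborel) = 1"
    using std_normal_moment_even[of 1] by (auto simp: has_bochner_integral_iff)
  have ic: "integrable lborel (\<lambda>u. complex_of_real (std_normal_density u))" using i0 by simp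
  have m1: "norm (m u) \<le> 1" for u by (simp add: m_def norm_mult \<delta>0)
  have im: "integrable lborel (\<lambda>u. complex_of_real (std_normal_density u) * m u)"
    by (rule Bochner_Integration.integrable_bound[OF i0])
       (auto intro!: AE_I2 mult_left_le m1 simp: norm_mult)
  have "schroedinger_integral a \<gamma> (fourier (wave_packet N L)) t x
    = L *\<^sub>R (\<integral>u. fourier (wave_packet N L) (N + L * u) * exp (\<i> * of_real (t * \<bar>N + L * u\<bar> powr a))
        * of_real (exp (- (t powr \<gamma>) * \<bar>N + L * u\<bar> powr a)) * exp (\<i> * of_real (x * (N + L * u))) \<partial>lborel)"
    unfolding schroedinger_integral_def using L
    by (subst lborel_integral_real_affine[where c = L and t = N]) auto
  also have "\<dots> = L *\<^sub>R (\<integral>u. of_real (2 * pi / L) * \<omega> * (of_real (std_normal_density u) * m u) \<partial>lborel)"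
  proof (intro arg_cong[where f = "scaleR L"] Bochner_Integration.integral_cong refl)
    fix u
    have sq: "sqrt (2 * pi) * exp (- u\<^sup>2 / 2) = 2 * pi * std_normal_density u"
      by (simp add: std_normal_density_def field_simps)
    have arg: "t * \<bar>N + L * u\<bar> powr a + x * (N + L * u) = (t * N powr a + x * N) + \<theta> u"
      by (simp add: \<theta>_def x_def algebra_simps)
    have ph: "exp (\<i> * of_real (t * \<bar>N + L * u\<bar> powr a)) * exp (\<i> * of_real (x * (N + L * u))) = \<omega> * exp (\<i> * complex_of_real (\<theta> u))"
      unfolding \<omega>_def mult_exp_exp distrib_left[symmetric] of_real_add[symmetric] arg ..
    have F: "fourier (wave_packet N L) (N + L * u) = of_real (2 * pi / L) * of_real (std_normal_density u)"
    proof -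
      have "(N + L * u - N) / L = u" using L by simp
      hence "fourier (wave_packet N L) (N + L * u) = of_real (sqrt (2 * pi) * exp (- u\<^sup>2 / 2) / L)"
        by (simp add: fourier_wave_packet[OF L])
      thus ?thesis unfolding sq by simp
    qed
    have "fourier (wave_packet N L) (N + L * u) * exp (\<i> * of_real (t * \<bar>N + L * u\<bar> powr a))
        * of_real (exp (- (t powr \<gamma>) * \<bar>N + L * u\<bar> powr a)) * exp (\<i> * of_real (x * (N + L * u)))
      = fourier (wave_packet N L) (N + L * u) * (exp (\<i> * of_real (t * \<bar>N + L * u\<bar> powr a)) * exp (\<i> * of_real (x * (N + L * u))))
        * of_real (exp (- \<delta> u))" by (simp add: \<delta>_def mult_ac)
    thus "fourier (wave_packet N L) (N + L * u) * exp (\<i> * of_real (t * \<bar>N + L * u\<bar> powr a))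
        * of_real (exp (- (t powr \<gamma>) * \<bar>N + L * u\<bar> powr a)) * exp (\<i> * of_real (x * (N + L * u)))
      = of_real (2 * pi / L) * \<omega> * (of_real (std_normal_density u) * m u)"
      unfolding ph F m_def by (simp only: mult_ac)
  qed
  also have "\<dots> = L *\<^sub>R (of_real (2 * pi / L) * \<omega> * (\<integral>u. of_real (std_normal_density u) * m u \<partial>lborel))"
    by (subst Bochner_Integration.integral_mult_right_zero) (rule refl)
  finally have "norm (schroedinger_integral a \<gamma> (fourier (wave_packet N L)) t x)
      = 2 * pi * norm (\<integral>u. of_real (std_normal_density u) * m u \<partial>lborel)"
    using L by (simp add: norm_mult \<omega>_def norm_divide)
  \<comment> \<open>The normal density has mass and second moment 1, so averaging e1 u^2 + e2 gives
    e1 + e2.\<close>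
  moreover have "norm (\<integral>u. of_real (std_normal_density u) * m u \<partial>lborel) \<ge> 1 - (e1 + e2)"
  proof -
    have "(\<integral>u. of_real (std_normal_density u) * m u \<partial>lborel) - 1 = (\<integral>u. of_real (std_normal_density u) * (m u - 1) \<partial>lborel)"
      using im ic I0 by (simp add: right_diff_distrib)
    also have "norm \<dots> \<le> (\<integral>u. norm (of_real (std_normal_density u) * (m u - 1)) \<partial>lborel)"
      by (rule integral_norm_bound)
    also have "\<dots> \<le> (\<integral>u. e1 * (std_normal_density u * u\<^sup>2) + e2 * std_normal_density u \<partial>lborel)"
    proof (rule Bochner_Integration.integral_mono)
      show "integrable lborel (\<lambda>u. norm (complex_of_real (std_normal_density u) * (m u - 1)))"
        using im ic by (intro integrable_norm) (simp add: right_diff_distrib)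
      show "integrable lborel (\<lambda>u. e1 * (std_normal_density u * u\<^sup>2) + e2 * std_normal_density u)"
        using i0 i2 by auto
      fix u
      have "norm (complex_of_real (std_normal_density u) * (m u - 1)) = std_normal_density u * norm (m u - 1)"
        unfolding norm_mult norm_of_real by simp
      also have "\<dots> \<le> std_normal_density u * (e1 * u\<^sup>2 + e2)"
        by (intro mult_left_mono mle) auto
      also have "\<dots> = e1 * (std_normal_density u * u\<^sup>2) + e2 * std_normal_density u"
        by (simp add: algebra_simps)
      finally show "norm (complex_of_real (std_normal_density u) * (m u - 1)) \<le> e1 * (std_normal_density u * u\<^sup>2) + e2 * std_normal_density u" .
    qed
    also have "\<dots> = e1 + e2" using i0 i2 I0 I2 by simp
    finally have "norm ((\<integral>u. of_real (std_normal_density u) * m u \<partial>lborel) - 1) \<le> e1 + e2" .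
    thus ?thesis using norm_triangle_ineq2[of 1 "1 - (\<integral>u. of_real (std_normal_density u) * m u \<partial>lborel)"]
      by (simp add: norm_minus_commute)
  qed
  ultimately show ?thesis unfolding x_def e1_def e2_def by (simp add: mult_left_mono)
qed

text \<open>Substitute \<xi> = N + L u. The squared height 2 pi / L^2 times the width L gives 1 / L,
  and L \<le> N bounds the Sobolev weight by N^(2 s) (1 + u^2)^s up to a constant. Squaring produces
  two Gaussian factors: one absorbs the polynomial growth, the other is integrated.\<close>

lemma wave_packet_sobolev:
  assumes s: "s > 0"
  obtains A where "A > 0" "\<And>N L. N \<ge> 1 \<Longrightarrow> 0 < L \<Longrightarrow> L \<le> N \<Longrightarrow>
    weighted_energy s (fourier (wave_packet N L)) \<le> ennreal (A * N powr (2 * s) / L)"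
proof -
  obtain C where C: "C > 0" "\<And>u. u \<ge> 0 \<Longrightarrow> (1 + u) powr s * exp (- (1 / 2 * u)) \<le> C"
    using one_plus_powr_exp_bounded[of "1/2" s] s by auto
  define A where "A = 2 * pi * (3 powr s * C * sqrt (2 * pi))"
  have i0: "integrable lborel std_normal_density" and I0: "integral\<^sup>L lborel std_normal_density = 1"
    using std_normal_moment_even[of 0] by (auto simp: has_bochner_integral_iff)
  have main: "weighted_energy s (fourier (wave_packet N L)) \<le> ennreal (A * N powr (2 * s) / L)"
    if N: "N \<ge> 1" and L: "0 < L" "L \<le> N" for N L
  proof -
    define B where "B = 2 * pi / L\<^sup>2 * (3 powr s * N powr (2 * s) * C * sqrt (2 * pi))"
    have B0: "B \<ge> 0" using C by (simp add: B_def)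
    have m: "(\<lambda>\<xi>. ennreal ((1 + \<xi>\<^sup>2) powr s * (norm (fourier (wave_packet N L) \<xi>))\<^sup>2)) \<in> borel_measurable borel"
      unfolding fourier_wave_packet[OF L(1)] by measurable
    have "weighted_energy s (fourier (wave_packet N L))
      = ennreal L * (\<integral>\<^sup>+u. ennreal ((1 + (N + L * u)\<^sup>2) powr s * (norm (fourier (wave_packet N L) (N + L * u)))\<^sup>2) \<partial>lborel)"
      using L nn_integral_real_affine[OF m, of L N] by simp
    also have "\<dots> \<le> ennreal L * (\<integral>\<^sup>+u. ennreal (B * std_normal_density u) \<partial>lborel)"
    proof (intro mult_left_mono nn_integral_mono ennreal_leI)
      fix u
      have "(1 + (N + L * u)\<^sup>2) powr s \<le> (3 * N\<^sup>2 * (1 + u\<^sup>2)) powr s"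
      proof (rule powr_mono2)
        have "(N + L * u)\<^sup>2 \<le> 2 * N\<^sup>2 + 2 * (L * u)\<^sup>2"
          using sum_squares_bound[of N "L * u"] by (simp add: power2_sum)
        moreover have "(L * u)\<^sup>2 \<le> N\<^sup>2 * u\<^sup>2"
          unfolding power_mult_distrib using L by (intro mult_right_mono power_mono) auto
        moreover have "1 \<le> N\<^sup>2" using N by simp
        moreover have "0 \<le> N\<^sup>2 * u\<^sup>2" by simp
        ultimately have "1 + (N + L * u)\<^sup>2 \<le> 3 * N\<^sup>2 + 3 * (N\<^sup>2 * u\<^sup>2)" by linarith
        thus "1 + (N + L * u)\<^sup>2 \<le> 3 * N\<^sup>2 * (1 + u\<^sup>2)" by (simp add: algebra_simps)
      qed (use s in auto)
      also have "\<dots> = 3 powr s * N powr (2 * s) * (1 + u\<^sup>2) powr s"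
        using N by (simp add: powr_mult powr_powr flip: powr_numeral)
      finally have 1: "(1 + (N + L * u)\<^sup>2) powr s \<le> 3 powr s * N powr (2 * s) * (1 + u\<^sup>2) powr s" .
      have "norm (fourier (wave_packet N L) (N + L * u)) = sqrt (2 * pi) / L * exp (- u\<^sup>2 / 2)"
        using L by (simp add: fourier_wave_packet norm_mult norm_divide)
      hence 2: "(norm (fourier (wave_packet N L) (N + L * u)))\<^sup>2 = 2 * pi / L\<^sup>2 * (exp (- u\<^sup>2 / 2) * exp (- u\<^sup>2 / 2))"
        by (simp add: power_mult_distrib power_divide power2_eq_square[of "exp _"])
      have "(1 + (N + L * u)\<^sup>2) powr s * (norm (fourier (wave_packet N L) (N + L * u)))\<^sup>2
        \<le> (3 powr s * N powr (2 * s) * (1 + u\<^sup>2) powr s) * (2 * pi / L\<^sup>2 * (exp (- u\<^sup>2 / 2) * exp (- u\<^sup>2 / 2)))"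
        unfolding 2 using 1 by (intro mult_right_mono) auto
      also have "\<dots> = 2 * pi / L\<^sup>2 * (3 powr s * N powr (2 * s) * ((1 + u\<^sup>2) powr s * exp (- (1 / 2 * u\<^sup>2))) * exp (- u\<^sup>2 / 2))"
        by (simp add: mult_ac)
      also have "\<dots> \<le> 2 * pi / L\<^sup>2 * (3 powr s * N powr (2 * s) * C * exp (- u\<^sup>2 / 2))"
        using C(2)[of "u\<^sup>2"] by (intro mult_left_mono mult_right_mono) auto
      also have "\<dots> = B * std_normal_density u"
        by (simp add: B_def std_normal_density_def)
      finally show "(1 + (N + L * u)\<^sup>2) powr s * (norm (fourier (wave_packet N L) (N + L * u)))\<^sup>2 \<le> B * std_normal_density u" .
    qed auto
    also have "(\<integral>\<^sup>+u. ennreal (B * std_normal_density u) \<partial>lborel) = ennreal B"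
      using i0 I0 B0 by (subst nn_integral_eq_integral) auto
    also have "ennreal L * ennreal B = ennreal (A * N powr (2 * s) / L)"
      using L B0 by (simp add: B_def A_def power2_eq_square mult_ac flip: ennreal_mult)
    finally show ?thesis .
  qed
  show ?thesis by (rule that[OF _ main]) (use C in \<open>auto simp: A_def\<close>)
qed

lemma esqrt_ennreal: "v \<ge> 0 \<Longrightarrow> esqrt (ennreal v) = ennreal (sqrt v)"
  by (simp add: esqrt_def)

text \<open>The packet keeps the maximal function above pi on an interval of length R, while its
  squared Sobolev norm is at most a multiple of N^(2 s) / L. So R L is at most a multiple of N^(2
  s), whereas below the critical exponent the choices of L and T give R L = a N^(2 s + 3 e).\<close>

lemma critical_if_maximal_bound:
  assumes a: "a > 1" and \<gamma>: "\<gamma> > 0" and s: "s > 0" and bound: "maximal_bound a \<gamma> s"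
  shows "1 / 4 * a * max 0 (1 - 1 / \<gamma>) \<le> s"
proof (rule ccontr)
  assume neg: "\<not> 1 / 4 * a * max 0 (1 - 1 / \<gamma>) \<le> s"
  \<comment> \<open>For \<gamma> \<le> 1 the claimed threshold is 0, which lies below s
    anyway.\<close>
  have "\<gamma> > 1"
  proof (rule ccontr)
    assume "\<not> \<gamma> > 1"
    hence "1 \<le> 1 / \<gamma>" using \<gamma> by simp
    thus False using neg s by simp
  qed
  define \<sigma> where "\<sigma> = a * (1 - 1 / \<gamma>) / 2"
  have \<sigma>s: "\<sigma> > 2 * s" using neg \<open>\<gamma> > 1\<close> by (simp add: \<sigma>_def max_def field_simps split: if_splits)
  have \<sigma>0: "\<sigma> > 0" using \<sigma>s s by linarith
  \<comment> \<open>A quarter of the gap in the exponent: one part is spent on stopping slightly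
    before N^(-a/\<gamma>), and three remain as N^(3 e) for the contradiction.\<close>
  define e where "e = (\<sigma> - 2 * s) / 4"
  have e: "e > 0" using \<sigma>s by (simp add: e_def)
  define \<tau> where "\<tau> = a / \<gamma> + e"
  have \<tau>: "\<tau> > 0" using a \<gamma> e by (simp add: \<tau>_def add_pos_pos)
  define Ca where "Ca = a * (a - 1) * 3 powr \<bar>a - 2\<bar>"
  have Ca: "Ca \<ge> 0" using a by (simp add: Ca_def)
  obtain A where A: "A > 0" "\<And>N L. N \<ge> 1 \<Longrightarrow> 0 < L \<Longrightarrow> L \<le> N \<Longrightarrow>
    weighted_energy s (fourier (wave_packet N L)) \<le> ennreal (A * N powr (2 * s) / L)"
    using wave_packet_sobolev[OF s] by blast
  obtain C0 where C0: "\<And>f. f \<in> schwartz_space \<Longrightarrow> L2_norm (P_max a \<gamma> f) \<le> ennreal C0 * sobolev_norm s f"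
    using bound unfolding maximal_bound_def by blast
  \<comment> \<open>A negative constant is sent to 0 by \<open>ennreal\<close>, so this changes
    nothing in the bound and permits real arithmetic.\<close>
  define C where "C = max 0 C0"
  have C: "C \<ge> 0" by (simp add: C_def)
  have Cb: "L2_norm (P_max a \<gamma> f) \<le> ennreal C * sobolev_norm s f" if "f \<in> schwartz_space" for f
  proof -
    have "ennreal C0 = ennreal C" by (auto simp: C_def max_def ennreal_neg)
    thus ?thesis using C0[OF that] by simp
  qed
  have tz: "((\<lambda>N::real. N powr (- p)) \<longlongrightarrow> 0) at_top" if "p > 0" for p
    using that by (intro tendsto_neg_powr filterlim_ident) auto
  have "((\<lambda>N. Ca * N powr (- e) + 8 * N powr (- (2 * \<sigma>)) + 2 powr a * N powr (- (\<gamma> * e))) \<longlongrightarrow> Ca * 0 + 8 * 0 + 2 powr a * 0) at_top"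
    using e \<sigma>0 \<gamma> by (intro tendsto_intros tz) auto
  hence ev1: "eventually (\<lambda>N. Ca * N powr (- e) + 8 * N powr (- (2 * \<sigma>)) + 2 powr a * N powr (- (\<gamma> * e)) < 1 / 2) at_top"
    by (rule order_tendstoD) simp
  define M where "M = C\<^sup>2 * A / (pi\<^sup>2 * a)"
  have M: "M \<ge> 0" using A a by (simp add: M_def)
  have "eventually (\<lambda>N. N powr (- (3 * e)) < 1 / (M + 1)) at_top"
    using e M by (intro order_tendstoD(2)[OF tz]) auto
  hence "eventually (\<lambda>N. N > 0 \<and> N powr (- (3 * e)) < 1 / (M + 1)) at_top"
    by (intro eventually_conj eventually_gt_at_top)
  hence ev2: "eventually (\<lambda>N. N powr (3 * e) > M) at_top"
  proof eventually_elim
    case (elim N)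
    hence "1 / N powr (3 * e) < 1 / (M + 1)" by (simp only: powr_minus_divide)
    hence "M + 1 < N powr (3 * e)" using elim M by (simp add: field_simps)
    thus ?case by simp
  qed
  obtain N where N: "N > 1" "Ca * N powr (- e) + 8 * N powr (- (2 * \<sigma>)) + 2 powr a * N powr (- (\<gamma> * e)) < 1 / 2"
      "N powr (3 * e) > M"
    using eventually_happens[OF eventually_conj[OF eventually_gt_at_top[of 1] eventually_conj[OF ev1 ev2]]] by auto
  \<comment> \<open>Since a - a / \<gamma> = 2 \<sigma>, the dispersion term T N^(a-2) L^2 is
    exactly N^(-e), so up to the margin e no larger bandwidth is allowed.\<close>
  define L where "L = N powr (1 - \<sigma>)"
  define T where "T = N powr (- \<tau>)"
  define R where "R = a * N powr (a - 1) * T"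
  have L: "L > 0" using N by (simp add: L_def)
  have LN: "L \<le> N" using N \<sigma>0 powr_mono[of "1 - \<sigma>" 1 N] by (simp add: L_def)
  have T: "0 < T" "T < 1" using N \<tau> powr_less_mono[of "- \<tau>" 0 N] by (auto simp: T_def)
  have R: "R > 0" using a N T by (simp add: R_def)
  have v: "a * N powr (a - 1) > 0" using a N by simp
  define f where "f = wave_packet N L"
  have err: "Ca * (t * N powr (a - 2) * L\<^sup>2) + 8 * L\<^sup>2 / N\<^sup>2 + 2 powr a * (t powr \<gamma> * N powr a) \<le> 1 / 2"
    if t: "0 < t" "t \<le> T" for t
  proof -
    have L2: "L\<^sup>2 = N powr (2 - 2 * \<sigma>)" using N by (simp add: L_def powr_power algebra_simps)
    have N2: "N\<^sup>2 = N powr 2" using N by (simp add: powr_numeral)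
    have a\<sigma>: "a - a / \<gamma> = 2 * \<sigma>" by (simp add: \<sigma>_def right_diff_distrib)
    have "t * N powr (a - 2) * L\<^sup>2 \<le> T * N powr (a - 2) * L\<^sup>2" using t by (intro mult_right_mono) auto
    also have "\<dots> = N powr (- e)"
      unfolding L2 T_def powr_add[symmetric] using a\<sigma> by (intro arg_cong[where f = "(powr) N"]) (simp add: \<tau>_def)
    finally have 1: "Ca * (t * N powr (a - 2) * L\<^sup>2) \<le> Ca * N powr (- e)" using Ca by (intro mult_left_mono)
    have "L\<^sup>2 / N\<^sup>2 = N powr (- (2 * \<sigma>))" unfolding L2 N2 powr_diff[symmetric] by simp
    hence 2: "8 * L\<^sup>2 / N\<^sup>2 = 8 * N powr (- (2 * \<sigma>))" by simp
    have "t powr \<gamma> * N powr a \<le> T powr \<gamma> * N powr a" using t \<gamma> by (intro mult_right_mono powr_mono2) auto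
    also have "\<dots> = N powr (- (\<gamma> * e))"
      unfolding T_def powr_powr powr_add[symmetric] using \<gamma> by (intro arg_cong[where f = "(powr) N"]) (simp add: \<tau>_def field_simps)
    finally have 3: "2 powr a * (t powr \<gamma> * N powr a) \<le> 2 powr a * N powr (- (\<gamma> * e))" by (intro mult_left_mono) auto
    show ?thesis using 1 2 3 N(2) by linarith
  qed
  have low: "P_max a \<gamma> f x \<ge> ennreal pi" if x: "x \<in> {- R..<0}" for x
  proof -
    \<comment> \<open>The moment at which the packet, travelling to the left, passes x. The errors
      are then at most 1/2, which leaves half of the initial height 2 pi.\<close>
    define t where "t = - x / (a * N powr (a - 1))"
    have t: "0 < t" "t \<le> T" using x v by (auto simp: t_def R_def field_simps)
    have "t * (a * N powr (a - 1)) = - x"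
      unfolding t_def by (rule nonzero_eq_divide_eq[THEN iffD1, OF _ refl]) (use v in auto)
    hence xt: "x = - (t * a * N powr (a - 1))" by (simp add: mult.assoc)
    have "2 * pi * (1 - 1 / 2) \<le> 2 * pi * (1 - (Ca * (t * N powr (a - 2) * L\<^sup>2) + 8 * L\<^sup>2 / N\<^sup>2 + 2 powr a * (t powr \<gamma> * N powr a)))"
      using err[OF t] by (intro mult_left_mono) auto
    also have "\<dots> \<le> norm (schroedinger_integral a \<gamma> (fourier f) t x)"
      unfolding xt f_def Ca_def using N by (intro wave_packet_evolution_lower a \<gamma> L t) auto
    finally have "ennreal pi \<le> ennreal (cmod (P_op a \<gamma> t f x))" unfolding P_op_eq by (intro ennreal_leI) simp
    also have "\<dots> \<le> P_max a \<gamma> f x" unfolding P_max_def using t T by (intro SUP_upper) auto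
    finally show ?thesis .
  qed
  have "ennreal (pi\<^sup>2 * R) = (\<integral>\<^sup>+x. ennreal (pi\<^sup>2) * indicator {- R..<0} x \<partial>lborel)"
    using R by (subst nn_integral_cmult_indicator) (auto simp: ennreal_mult)
  also have "\<dots> \<le> (\<integral>\<^sup>+x. (P_max a \<gamma> f x)\<^sup>2 \<partial>lborel)"
  proof (rule nn_integral_mono)
    fix x
    show "ennreal (pi\<^sup>2) * indicator {- R..<0} x \<le> (P_max a \<gamma> f x)\<^sup>2"
      using power_mono[OF low, of x 2] by (cases "x \<in> {- R..<0}") (auto simp: ennreal_power)
  qed
  finally have "esqrt (ennreal (pi\<^sup>2 * R)) \<le> L2_norm (P_max a \<gamma> f)"
    unfolding L2_norm_def by (rule esqrt_mono)
  also have "\<dots> \<le> ennreal C * sobolev_norm s f"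
    unfolding f_def by (rule Cb[OF wave_packet_schwartz[OF L]])
  also have "\<dots> \<le> ennreal C * esqrt (ennreal (A * N powr (2 * s) / L))"
    unfolding sobolev_norm_def f_def using A(2)[of N L] N L LN by (intro mult_left_mono esqrt_mono) auto
  also have "esqrt (ennreal (A * N powr (2 * s) / L)) = ennreal (sqrt (A * N powr (2 * s) / L))"
    using A(1) L by (intro esqrt_ennreal) auto
  also have "ennreal C * \<dots> = ennreal (C * sqrt (A * N powr (2 * s) / L))"
    using A(1) L by (intro ennreal_mult[symmetric] C) auto
  also have "esqrt (ennreal (pi\<^sup>2 * R)) = ennreal (sqrt (pi\<^sup>2 * R))"
    using R by (intro esqrt_ennreal) auto
  finally have "ennreal (sqrt (pi\<^sup>2 * R)) \<le> ennreal (C * sqrt (A * N powr (2 * s) / L))" .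
  hence "sqrt (pi\<^sup>2 * R) \<le> C * sqrt (A * N powr (2 * s) / L)"
    using C A(1) L by (subst (asm) ennreal_le_iff) auto
  hence "(sqrt (pi\<^sup>2 * R))\<^sup>2 \<le> (C * sqrt (A * N powr (2 * s) / L))\<^sup>2" using R by (intro power_mono) auto
  hence "pi\<^sup>2 * R \<le> C\<^sup>2 * (A * N powr (2 * s) / L)" using R A(1) L by (simp add: power_mult_distrib)
  hence "pi\<^sup>2 * (R * L) \<le> C\<^sup>2 * A * N powr (2 * s)" using L by (simp add: field_simps)
  moreover have "R * L = a * N powr (3 * e) * N powr (2 * s)"
  proof -
    have "R * L = a * (N powr (a - 1) * N powr (- \<tau>) * N powr (1 - \<sigma>))" by (simp add: R_def T_def L_def)
    also have "N powr (a - 1) * N powr (- \<tau>) * N powr (1 - \<sigma>) = N powr (3 * e + 2 * s)"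
      unfolding powr_add[symmetric]
    proof (intro arg_cong[where f = "(powr) N"])
      have "a - a / \<gamma> = 2 * \<sigma>" by (simp add: \<sigma>_def right_diff_distrib)
      moreover have "4 * e = \<sigma> - 2 * s" by (simp add: e_def)
      ultimately show "a - 1 + - \<tau> + (1 - \<sigma>) = 3 * e + 2 * s" unfolding \<tau>_def by linarith
    qed
    finally show ?thesis by (simp add: powr_add mult.assoc)
  qed
  ultimately have "pi\<^sup>2 * (a * N powr (3 * e) * N powr (2 * s)) \<le> C\<^sup>2 * A * N powr (2 * s)" by (simp only:)
  hence "(pi\<^sup>2 * a * N powr (3 * e)) * N powr (2 * s) \<le> C\<^sup>2 * A * N powr (2 * s)" by (simp only: mult.assoc)
  hence "pi\<^sup>2 * a * N powr (3 * e) \<le> C\<^sup>2 * A" using N by (simp add: mult.assoc)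
  hence "N powr (3 * e) \<le> C\<^sup>2 * A / (pi\<^sup>2 * a)" using a by (simp add: field_simps)
  with N(3) show False by (simp add: M_def)
qed

text \<open>The admissible exponents contain every s above the critical value, which is nonnegative,
  and lie in the closed half-line starting there. This determines the infimum without deciding the
  endpoint.\<close>

theorem theorem1p2:
  fixes a \<gamma> :: real
  assumes "\<gamma> > 0" and "a > 1"
  shows "critical_exponent a \<gamma> = ereal (1 / 4 * a * max 0 (1 - 1 / \<gamma>))"
proof (rule antisym)
  let ?c = "1 / 4 * a * max 0 (1 - 1 / \<gamma>)"
  have c0: "?c \<ge> 0" using assms by simp
  show "critical_exponent a \<gamma> \<le> ereal ?c"
  proof (rule ccontr)
    assume "\<not> critical_exponent a \<gamma> \<le> ereal ?c"
    then obtain s where s: "ereal ?c < ereal s" "ereal s < critical_exponent a \<gamma>"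
      using ereal_dense2[of "ereal ?c" "critical_exponent a \<gamma>"] by (auto simp: not_le)
    have "s > 0" "s > ?c" using s(1) c0 by auto
    hence "critical_exponent a \<gamma> \<le> ereal s"
      unfolding critical_exponent_def using maximal_bound_if_above_critical[OF assms(2,1)]
      by (intro Inf_lower) auto
    with s(2) show False by simp
  qed
  show "ereal ?c \<le> critical_exponent a \<gamma>"
    unfolding critical_exponent_def using critical_if_maximal_bound[OF assms(2,1)]
    by (intro Inf_greatest) auto
qed

end
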